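(* Let $N\ge 1$, $1\le m\le N$, $A\in\mathbb R^{N\times N}$, $B\in\mathbb R^{N\times m}$. Assume that $A$ is diagonalizable over $\mathbb R$, that $(A,B)$ satisfies the Kalman rank condition with Kalman index $K$, and that $0\notin\sigma(A)$. Assume that $\mathcal O\subset\mathbb R$ satisfies the bounded-gap condition (BG). Let $p:=\#\sigma(A)$ be the number of distinct eigenvalues of $A$. Then, for every $T_1>T_{\rm geom}$, there exists a constant $C_{\mathcal O,T_1}>0$, depending only on $\mathcal O$, $A$, $B$, $K$ and $T_1$ (but independent of $T$), such that, for every $T\in(T_{\rm geom},T_1]$, every $q_T\in\mathcal Y_K^-$ and the corresponding solution $q$ of the adjoint system, $$\|q_T\|_{\mathcal Y_K^-}^2\le\frac{C_{\mathcal O,T_1}}{(T-T_{\rm geom})^{2p-1}}\int_0^T\int_{\mathcal O}|B^\top q(t,x)|^2\,dx\,dt .$$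
   Context: Fourier convention: $\widehat f(\xi)=\int_{\mathbb R}f(x)e^{-ix\xi}\,dx$. Kalman rank condition with Kalman index $K$: $K\ge0$ is the smallest integer such that $\operatorname{rank}(B,AB,\dots,A^KB)=N$. Kalman layers: $\mathcal K_k=\operatorname{Ran}(B,AB,\dots,A^kB)\subset\mathbb R^N$, $\mathcal K_{-1}=\{0\}$, $\mathcal V_k=\mathcal K_k\cap\mathcal K_{k-1}^\perp$ for $k=0,\dots,K$ (orthogonality for the Euclidean inner product), so $\mathbb R^N=\bigoplus_{k=0}^K\mathcal V_k$; $\Pi_k$ is the orthogonal projector onto $\mathcal V_k$, extended complex-linearly to $\mathbb C^N$. Weights: $\rho_k(\xi)=\min\{|\xi|^{2k},1\}$. The space $\mathcal Y_K^-$ is the Hilbert completion of the Schwartz space $\mathcal S(\mathbb R;\mathbb C^N)$ for the norm $\|q\|_{\mathcal Y_K^-}^2=\sum_{k=0}^K\int_{\mathbb R}\rho_k(\xi)|\Pi_k\widehat q(\xi)|^2\,d\xi$; it is identified, on the Fourier side, with the space of (classes of) measurable $\widehat q:\mathbb R\to\mathbb C^N$ for which this quantity is finite. Adjoint system: $q_t+A^\top q_x=0$ in $(0,T)\times\mathbb R$, $q(T,\cdot)=q_T$; its solution satisfies $\widehat q(t,\xi)=e^{i\xi(T-t)A^\top}\widehat q_T(\xi)$. For $q_T\in\mathcal Y_K^-$ the solution is understood by completion from Schwartz data (same Fourier formula), and $B^\top q$ is understood as the continuous extension, from $\mathcal S(\mathbb R;\mathbb C^N)$ to $\mathcal Y_K^-$,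 of the map $q_T\mapsto B^\top q\in L^2((0,T)\times\mathbb R;\mathbb C^m)$. Bounded-gap condition (BG): $\mathcal O=\bigcup_{n\in\mathbb Z}(a_n,b_n)$ with $a_n<b_n<a_{n+1}$ for all $n\in\mathbb Z$, $\ell_{\mathcal O}:=\inf_n(b_n-a_n)>0$ and $G_{\mathcal O}:=\sup_n(a_{n+1}-b_n)<\infty$. Geometric time: $T_{\rm geom}:=G_{\mathcal O}/\lambda_*$ with $\lambda_*:=\min_{\lambda\in\sigma(A)}|\lambda|>0$. *)

theory Defs
  imports "HOL-Analysis.Analysis"
begin

section \<open>Matrices: spectrum, diagonalizability, Kalman condition\<close>

abbreviation complex_mat :: "real^'n^'m \<Rightarrow> complex^'n^'m" where
  "complex_mat M \<equiv> map_matrix complex_of_real M"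

definition mat_spectrum :: "real^'n^'n \<Rightarrow> complex set" where
  "mat_spectrum A = {\<mu>. \<exists>v. v \<noteq> 0 \<and> complex_mat A *v v = \<mu> *s v}"

definition diagonalizable_over_reals :: "real^'n^'n \<Rightarrow> bool" where
  "diagonalizable_over_reals A \<longleftrightarrow>
     (\<exists>(P::real^'n^'n) (D::real^'n^'n). invertible P \<and> (\<forall>i j. i \<noteq> j \<longrightarrow> D $ i $ j = 0) \<and>
        A = P ** D ** matrix_inv P)"

text \<open>The matrix \<open>A\<^sup>j B\<close>. The overloaded power \<open>A ^ j\<close> cannot be used here: on vectors,
  multiplication is componentwise.\<close>

definition pow_mult :: "real^'n^'n \<Rightarrow> nat \<Rightarrow> real^'m^'n \<Rightarrow> real^'m^'n" where
  "pow_mult A j B = (((**) A) ^^ j) B"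

text \<open>The range of the block matrix \<open>(B, AB, \<dots>, A\<^sup>k B)\<close>, which acts on tuples
  \<open>(u\<^sub>0, \<dots>, u\<^sub>k)\<close> of vectors; the rank of that matrix is the dimension of this subspace.\<close>

definition kalman_range :: "real^'n^'n \<Rightarrow> real^'m^'n \<Rightarrow> nat \<Rightarrow> (real^'n) set" where
  "kalman_range A B k = {(\<Sum>j\<le>k. pow_mult A j B *v u j) | u. True}"

definition kalman_rank :: "real^'n^'n \<Rightarrow> real^'m^'n \<Rightarrow> nat \<Rightarrow> nat" where
  "kalman_rank A B k = dim (kalman_range A B k)"

definition kalman_index :: "real^'n^'n \<Rightarrow> real^'m^'n \<Rightarrow> nat \<Rightarrow> bool" where
  "kalman_index A B K \<longleftrightarrow>
     kalman_rank A B K = CARD('n) \<and> (\<forall>k<K. kalman_rank A B k \<noteq> CARD('n))"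

definition kalman_layer :: "real^'n^'n \<Rightarrow> real^'m^'n \<Rightarrow> nat \<Rightarrow> (real^'n) set" where
  "kalman_layer A B k =
     kalman_range A B k \<inter> (if k = 0 then {0} else kalman_range A B (k - 1))\<^sup>\<bottom>"

definition orth_projector :: "(real^'n) set \<Rightarrow> real^'n \<Rightarrow> real^'n" where
  "orth_projector V x = (THE y. y \<in> V \<and> x - y \<in> V\<^sup>\<bottom>)"

definition kalman_projector ::
    "real^'n^'n \<Rightarrow> real^'m^'n \<Rightarrow> nat \<Rightarrow> complex^'n \<Rightarrow> complex^'n" where
  "kalman_projector A B k v =
     (\<chi> i. Complex (orth_projector (kalman_layer A B k) (\<chi> j. Re (v $ j)) $ i)
                   (orth_projector (kalman_layer A B k) (\<chi> j. Im (v $ j)) $ i))"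

section \<open>Schwartz functions and the space \<open>\<Y>\<^sub>K\<^sup>-\<close>\<close>

text \<open>\<open>D k\<close> is the \<open>k\<close>-th derivative of \<open>f\<close>.\<close>

definition schwartz :: "(real \<Rightarrow> complex^'n) \<Rightarrow> bool" where
  "schwartz f \<longleftrightarrow> (\<exists>D. D 0 = f \<and>
     (\<forall>k x. (D k has_vector_derivative D (Suc k) x) (at x)) \<and>
     (\<forall>j k. bounded (range (\<lambda>x. x ^ j *\<^sub>R D k x))))"

definition fourier :: "(real \<Rightarrow> complex^'n) \<Rightarrow> real \<Rightarrow> complex^'n" where
  "fourier f \<xi> = (LINT x|lborel. exp (- \<i> * of_real x * of_real \<xi>) *s f x)"

definition weight :: "nat \<Rightarrow> real \<Rightarrow> real" where
  "weight k \<xi> = min (\<bar>\<xi>\<bar> ^ (2 * k)) 1"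

text \<open>Elements of \<open>\<Y>\<^sub>K\<^sup>-\<close> are represented by their Fourier transforms \<open>g\<close>: \<open>Ynorm_sq A B K g\<close> is
  the squared norm of the element with Fourier transform \<open>g\<close>, and a Schwartz function \<open>\<phi>\<close> is
  embedded as \<open>fourier \<phi>\<close>. Every class of Lebesgue measurable functions modulo null sets has a
  Borel representative, so only Borel functions are considered.\<close>

definition Ynorm_sq ::
    "real^'n^'n \<Rightarrow> real^'m^'n \<Rightarrow> nat \<Rightarrow> (real \<Rightarrow> complex^'n) \<Rightarrow> ennreal" where
  "Ynorm_sq A B K g =
     (\<Sum>k\<le>K. \<integral>\<^sup>+\<xi>. ennreal (weight k \<xi> * (norm (kalman_projector A B k (g \<xi>)))\<^sup>2) \<partial>lborel)"

definition Yspace :: "real^'n^'n \<Rightarrow> real^'m^'n \<Rightarrow> nat \<Rightarrow> (real \<Rightarrow> complex^'n) set" where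
  "Yspace A B K = {g \<in> borel_measurable borel. Ynorm_sq A B K g < \<infinity>}"

section \<open>The adjoint system and its observation\<close>

text \<open>Classical solution of \<open>q\<^sub>t + A\<^sup>T q\<^sub>x = 0\<close> in \<open>(0,T) \<times> \<real>\<close> with \<open>q(T,\<cdot>) = q\<^sub>T\<close>.\<close>

definition adjoint_solution ::
    "real^'n^'n \<Rightarrow> real \<Rightarrow> (real \<Rightarrow> complex^'n) \<Rightarrow> (real \<Rightarrow> real \<Rightarrow> complex^'n) \<Rightarrow> bool" where
  "adjoint_solution A T qT q \<longleftrightarrow>
     continuous_on ({0..T} \<times> UNIV) (\<lambda>(t, x). q t x) \<and>
     (\<forall>t\<in>{0<..<T}. \<forall>x. \<exists>qt qx.
        ((\<lambda>(s, y). q s y) has_derivative (\<lambda>(h, k). h *\<^sub>R qt + k *\<^sub>R qx)) (at (t, x)) \<and>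
        qt + complex_mat (transpose A) *v qx = 0) \<and>
     (\<forall>x. q T x = qT x)"

definition sq_integral :: "real \<Rightarrow> real set \<Rightarrow> (real \<Rightarrow> real \<Rightarrow> complex^'m) \<Rightarrow> ennreal" where
  "sq_integral T S w =
     (\<integral>\<^sup>+t\<in>{0<..<T}. (\<integral>\<^sup>+x\<in>S. ennreal ((norm (w t x))\<^sup>2) \<partial>lborel) \<partial>lborel)"

text \<open>\<open>is_observation A B K T g z\<close>: the function \<open>z\<close> represents the class
  \<open>B\<^sup>T q \<in> L\<^sup>2((0,T) \<times> \<real>; \<complex>\<^sup>m)\<close>, where \<open>q\<close> is the adjoint solution with terminal datum the element
  of \<open>\<Y>\<^sub>K\<^sup>-\<close> with Fourier transform \<open>g\<close>. The map \<open>q\<^sub>T \<mapsto> B\<^sup>T q\<close> is first given on Schwartz data and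
  then extended by continuity: \<open>z\<close> is the \<open>L\<^sup>2\<close> limit of \<open>B\<^sup>T q\<^sub>n\<close> along Schwartz data
  \<open>\<phi>\<^sub>n\<close> that converge to \<open>g\<close> in \<open>\<Y>\<^sub>K\<^sup>-\<close>.\<close>

definition is_observation ::
    "real^'n^'n \<Rightarrow> real^'m^'n \<Rightarrow> nat \<Rightarrow> real \<Rightarrow> (real \<Rightarrow> complex^'n)
      \<Rightarrow> (real \<Rightarrow> real \<Rightarrow> complex^'m) \<Rightarrow> bool" where
  "is_observation A B K T g z \<longleftrightarrow>
     (\<lambda>(t, x). z t x) \<in> borel_measurable borel \<and> sq_integral T UNIV z < \<infinity> \<and>
     (\<exists>\<phi> q. (\<forall>n. schwartz (\<phi> n) \<and> adjoint_solution A T (\<phi> n) (q n)) \<and>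
        (\<lambda>n. Ynorm_sq A B K (\<lambda>\<xi>. fourier (\<phi> n) \<xi> - g \<xi>)) \<longlonglongrightarrow> 0 \<and>
        (\<lambda>n. sq_integral T UNIV
           (\<lambda>t x. complex_mat (transpose B) *v q n t x - z t x)) \<longlonglongrightarrow> 0)"

section \<open>Bounded gaps and the geometric time\<close>

definition bounded_gap :: "real set \<Rightarrow> (int \<Rightarrow> real) \<Rightarrow> (int \<Rightarrow> real) \<Rightarrow> bool" where
  "bounded_gap S a b \<longleftrightarrow>
     S = (\<Union>n. {a n<..<b n}) \<and> (\<forall>n. a n < b n \<and> b n < a (n + 1)) \<and>
     (INF n. b n - a n) > 0 \<and> bdd_above (range (\<lambda>n. a (n + 1) - b n))"

definition max_gap :: "(int \<Rightarrow> real) \<Rightarrow> (int \<Rightarrow> real) \<Rightarrow> real" where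
  "max_gap a b = (SUP n. a (n + 1) - b n)"

definition min_speed :: "real^'n^'n \<Rightarrow> real" where
  "min_speed A = Min (norm ` mat_spectrum A)"

definition geom_time :: "real^'n^'n \<Rightarrow> (int \<Rightarrow> real) \<Rightarrow> (int \<Rightarrow> real) \<Rightarrow> real" where
  "geom_time A a b = max_gap a b / min_speed A"

end

theory Submission
  imports Defs "HOL-Probability.Characteristic_Functions" "HOL-Probability.Sinc_Integral"
begin

text \<open>Write \<open>s = T - t\<close> for the time that remains. Diagonalizing \<open>A\<close> turns the observation into a
superposition of travelling waves: each component of \<open>B\<^sup>T q\<close> at remaining time \<open>s\<close> is
\<open>\<Sum>\<^sub>\<nu> f\<^sub>\<nu> (x + \<nu> s)\<close>, one wave for each of the \<open>p\<close> eigenvalues \<open>\<nu>\<close>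
(\<open>eigencomponent_along_characteristic\<close>, \<open>observation_eq_waves\<close>). Let \<open>\<delta>\<close> be the excess of \<open>T\<close> over the
geometric time.

The waves are separated by difference operators. Comparing the observation at \<open>(s, x)\<close> with its value at
\<open>(s + h, x - \<mu> h)\<close> kills the wave of speed \<open>\<mu>\<close> and multiplies the Fourier transform of the wave of speed
\<open>\<nu>\<close> by \<open>exp (\<i> (\<nu> - \<mu>) h \<xi>) - 1\<close>. After \<open>p - 1\<close> such steps only one wave is left. Each step needs a
little more room, in time and inside the intervals, so \<open>h\<close> may be taken up to a small multiple of
\<open>\<delta>\<close>; what is left of the time still exceeds the time of passage through a gap by a multiple of \<open>\<delta>\<close>, so
every characteristic of the surviving wave is seen for a time of order \<open>\<delta>\<close>. Each multiplier, squared and averaged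
over \<open>h\<close>, costs a factor of order \<open>\<delta>\<^sup>2\<close> for frequencies away from \<open>0\<close>. Together this gives the
exponent \<open>2 (p - 1) + 1 = 2 p - 1\<close> (\<open>isolate_wave\<close>, \<open>high_frequency_observability\<close>).

At low frequencies this estimate is too weak, since it would produce the weight \<open>\<xi>\<^bsup>2 (p - 1)\<^esup>\<close> on all Kalman
layers. There one argues differently. A function with small frequencies hardly changes under translations of
bounded length, and every point of a gap is a translate of a point of the observation set by a bounded distance; so its norm
over the line is controlled by its norm over the set, up to the part at frequencies that are not small
(\<open>gap_filling\<close>), which the first estimate already controls. This reduces the low frequencies to an observation on the
whole line, that is, to a finite-dimensional problem for each \<open>\<xi>\<close>. A Taylor expansion in \<open>\<xi> s\<close> shows
that the coefficient of \<open>s\<^sup>r\<close> is, to leading order and up to a constant factor, \<open>\<xi>\<^sup>r (A\<^sup>r B)\<^sup>T \<Pi>\<^sub>r v\<close>. The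
matrix \<open>(A\<^sup>r B)\<^sup>T\<close> is injective on the layer \<open>\<V>\<^sub>r\<close> and vanishes on the higher layers, which
yields exactly the weights \<open>\<xi>\<^bsup>2 r\<^esup>\<close> (\<open>low_frequency_vector_observability\<close>).

The estimates are combined for Schwartz data in \<open>schwartz_observability\<close>; general data follow by passing to the
limit in an inequality between quadratic forms, where the triangle inequality costs a factor \<open>4\<close>.\<close>

section \<open>Plancherel's identity\<close>

text \<open>The class on which Plancherel's identity is established. It contains the Schwartz functions and is stable under
translations and linear combinations, which are the only operations applied to signals below.\<close>

definition tame :: "(real \<Rightarrow> complex) \<Rightarrow> bool" where
  "tame g \<longleftrightarrow> continuous_on UNIV g \<and> bounded (range g) \<and> integrable lborel g"

abbreviation l2_sq :: "(real \<Rightarrow> complex) \<Rightarrow> ennreal" where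
  "l2_sq g \<equiv> \<integral>\<^sup>+x. ennreal ((cmod (g x))\<^sup>2) \<partial>lborel"

definition FT :: "(real \<Rightarrow> complex) \<Rightarrow> real \<Rightarrow> complex" where
  "FT g \<xi> = (LINT x|lborel. exp (- \<i> * of_real x * of_real \<xi>) * g x)"

lemma tame_measurable: "tame g \<Longrightarrow> g \<in> borel_measurable borel"
  by (simp add: tame_def borel_measurable_continuous_onI)

lemma tame_add: "tame f \<Longrightarrow> tame g \<Longrightarrow> tame (\<lambda>x. f x + g x)"
  unfolding tame_def by (auto intro!: continuous_intros bounded_plus_comp)

lemma tame_cmult: "tame f \<Longrightarrow> tame (\<lambda>x. c * f x)"
  unfolding tame_def
  by (auto intro!: continuous_intros integrable_mult_right bounded_linear_image[OF _ bounded_linear_mult_right, of "range f" c, unfolded image_image])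

lemma tame_zero: "tame (\<lambda>x. 0)"
  unfolding tame_def by auto

lemma tame_sum: "finite I \<Longrightarrow> (\<And>i. i \<in> I \<Longrightarrow> tame (f i)) \<Longrightarrow> tame (\<lambda>x. \<Sum>i\<in>I. f i x)"
  by (induction I rule: finite_induct) (auto intro: tame_add tame_zero)

lemma tame_diff: "tame f \<Longrightarrow> tame g \<Longrightarrow> tame (\<lambda>x. f x - g x)"
  using tame_add[of f "\<lambda>x. -1 * g x"] tame_cmult[of g "-1"] by simp

lemma tame_shift: assumes "tame f" shows "tame (\<lambda>x. f (x + c))"
proof -
  have "integrable lborel (\<lambda>x. f (c + 1 * x))"
    using assms unfolding tame_def by (intro lborel_integrable_real_affine) auto
  moreover have "bounded (range (\<lambda>x. f (x + c)))"
    using assms unfolding tame_def by (auto intro: bounded_subset)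
  moreover have "continuous_on UNIV (\<lambda>x. f (x + c))"
    using assms unfolding tame_def
    by (auto intro!: continuous_on_compose2[of UNIV f] continuous_intros)
  ultimately show ?thesis by (simp add: tame_def add.commute)
qed

lemma norm_kernel [simp]: "cmod (exp (- \<i> * of_real x * of_real \<xi>)) = 1"
  "cmod (exp (- (\<i> * of_real x * of_real \<xi>))) = 1"
  "cmod (exp (\<i> * of_real x * of_real \<xi>)) = 1"
  by (simp_all add: norm_exp_eq_Re)

lemma integrable_kernel_mult:
  assumes "integrable lborel g"
  shows "integrable lborel (\<lambda>x. exp (- \<i> * of_real x * of_real \<xi>) * g x)"
proof -
  have [measurable]: "g \<in> borel_measurable borel" using assms by auto
  show ?thesis
    using assms by (rule Bochner_Integration.integrable_bound) (auto simp: norm_mult)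
qed

lemma FT_add: "integrable lborel f \<Longrightarrow> integrable lborel g \<Longrightarrow>
   FT (\<lambda>x. f x + g x) \<xi> = FT f \<xi> + FT g \<xi>"
  unfolding FT_def
  by (simp only: distrib_left Bochner_Integration.integral_add integrable_kernel_mult)

lemma FT_cmult: "FT (\<lambda>x. c * f x) \<xi> = c * FT f \<xi>"
  unfolding FT_def by (subst integral_mult_right_zero[symmetric]) (simp add: ac_simps)

lemma FT_sum: "finite I \<Longrightarrow> (\<And>i. i \<in> I \<Longrightarrow> tame (f i)) \<Longrightarrow>
   FT (\<lambda>x. \<Sum>i\<in>I. f i x) \<xi> = (\<Sum>i\<in>I. FT (f i) \<xi>)"
proof (induction I rule: finite_induct)
  case empty
  then show ?case by (simp add: FT_def)
next
  case (insert i I)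
  then show ?case
    using tame_sum[of I f] by (simp add: tame_def FT_add)
qed

lemma FT_diff: "tame f \<Longrightarrow> tame g \<Longrightarrow> FT (\<lambda>x. f x - g x) \<xi> = FT f \<xi> - FT g \<xi>"
  using FT_add[of f "\<lambda>x. -1 * g x" \<xi>] tame_cmult[of g "-1"] FT_cmult[of "-1" g \<xi>]
  by (simp add: tame_def)

lemma FT_shift:
  "FT (\<lambda>x. g (x + c)) \<xi> = exp (\<i> * of_real c * of_real \<xi>) * FT g \<xi>"
proof -
  have "FT g \<xi> = (LINT x|lborel. exp (- \<i> * of_real (c + 1 * x) * of_real \<xi>) * g (c + 1 * x))"
    unfolding FT_def by (subst lborel_integral_real_affine[of 1 _ c]) auto
  also have "\<dots> = (LINT x|lborel. exp (- \<i> * of_real c * of_real \<xi>) *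
      (exp (- \<i> * of_real x * of_real \<xi>) * g (x + c)))"
    by (rule Bochner_Integration.integral_cong)
       (auto simp: algebra_simps exp_add[symmetric] mult_exp_exp)
  also have "\<dots> = exp (- \<i> * of_real c * of_real \<xi>) * FT (\<lambda>x. g (x + c)) \<xi>"
    unfolding FT_def by simp
  finally show ?thesis
    by (simp add: mult.assoc[symmetric] exp_add[symmetric] mult_exp_exp)
qed

lemma FT_continuous:
  assumes "integrable lborel g"
  shows "continuous_on UNIV (FT g)"
proof -
  have "(\<lambda>n. FT g (X n)) \<longlonglongrightarrow> FT g \<xi>" if X: "X \<longlonglongrightarrow> \<xi>" for X \<xi>
    unfolding FT_def
  proof (rule integral_dominated_convergence[where w = "\<lambda>x. norm (g x)"])
    show "AE x in lborel. (\<lambda>n. exp (- \<i> * of_real x * of_real (X n)) * g x)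
        \<longlonglongrightarrow> exp (- \<i> * of_real x * of_real \<xi>) * g x"
      using X by (auto intro!: tendsto_intros)
  qed (use assms in \<open>auto simp: norm_mult\<close>)
  then show ?thesis
    by (auto simp: continuous_on_sequentially comp_def)
qed

lemma FT_measurable: "tame g \<Longrightarrow> FT g \<in> borel_measurable borel"
  by (auto simp: tame_def intro!: borel_measurable_continuous_onI FT_continuous)

lemma cmod_FT_le: "integrable lborel g \<Longrightarrow> cmod (FT g \<xi>) \<le> (LINT x|lborel. cmod (g x))"
  unfolding FT_def
  using integral_norm_bound[of lborel "\<lambda>x. exp (- \<i> * of_real x * of_real \<xi>) * g x"]
  by (simp add: norm_mult)

text \<open>Both sides are the double integral of \<open>exp (- \<i> x \<xi>) g(x) H(\<xi>)\<close>.\<close>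

lemma FT_multiplication_formula:
  assumes g: "integrable lborel g" and H: "integrable lborel H"
  shows "(LINT \<xi>|lborel. FT g \<xi> * H \<xi>) = (LINT x|lborel. g x * FT H x)"
proof -
  let ?F = "\<lambda>x \<xi>. exp (- \<i> * of_real x * of_real \<xi>) * (g x * H \<xi>)"
  have [measurable]: "g \<in> borel_measurable borel" "H \<in> borel_measurable borel"
    using g H by auto
  have int: "integrable (lborel \<Otimes>\<^sub>M lborel) (\<lambda>(x, \<xi>). ?F x \<xi>)"
  proof (rule lborel_pair.Fubini_integrable)
    show "(\<lambda>(x, \<xi>). ?F x \<xi>) \<in> borel_measurable (lborel \<Otimes>\<^sub>M lborel)"
      by measurable
    have "integrable lborel (\<lambda>x. cmod (g x) * (LINT y|lborel. cmod (H y)))"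
      using g by (intro integrable_mult_left) auto
    then show "integrable lborel (\<lambda>x. LINT y|lborel. cmod ((\<lambda>(x, \<xi>). ?F x \<xi>) (x, y)))"
      by (simp add: norm_mult)
    show "AE x in lborel. integrable lborel (\<lambda>y. (\<lambda>(x, \<xi>). ?F x \<xi>) (x, y))"
    proof (rule AE_I2)
      fix x :: real
      show "integrable lborel (\<lambda>y. (\<lambda>(x, \<xi>). ?F x \<xi>) (x, y))"
        by (rule Bochner_Integration.integrable_bound[OF integrable_mult_right[OF H, of "g x"]])
           (auto simp: norm_mult)
    qed
  qed
  have "(LINT \<xi>|lborel. FT g \<xi> * H \<xi>) = (LINT \<xi>|lborel. LINT x|lborel. ?F x \<xi>)"
    unfolding FT_def
    by (subst integral_mult_left_zero[symmetric]) (simp add: ac_simps)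
  also have "\<dots> = (LINT x|lborel. LINT \<xi>|lborel. ?F x \<xi>)"
    by (rule lborel_pair.Fubini_integral[OF int])
  also have "\<dots> = (LINT x|lborel. g x * FT H x)"
    unfolding FT_def
    by (subst integral_mult_right_zero[symmetric]) (simp add: ac_simps)
  finally show ?thesis .
qed

text \<open>The transform of a Gaussian, read off from the characteristic function of the standard normal distribution.\<close>

lemma gaussian_FT:
  assumes "\<sigma> > 0"
  shows "integrable lborel (\<lambda>\<xi>. complex_of_real (exp (- (\<sigma> * \<xi>)\<^sup>2 / 2)))"
    and "(LINT \<xi>|lborel. exp (- \<i> * of_real z * of_real \<xi>) * complex_of_real (exp (- (\<sigma> * \<xi>)\<^sup>2 / 2)))
      = complex_of_real (2 * pi / \<sigma> * std_normal_density (z / \<sigma>))"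
proof -
  have n: "exp (- (\<sigma> * \<xi>)\<^sup>2 / 2) = sqrt (2 * pi) * std_normal_density (0 + \<sigma> * \<xi>)" for \<xi>
    by (simp add: std_normal_density_def)
  have "integrable lborel std_normal_density"
    using integrable_std_normal_moment[of 0] by simp
  then have "integrable lborel (\<lambda>\<xi>. std_normal_density (0 + \<sigma> * \<xi>))"
    using assms by (intro lborel_integrable_real_affine) auto
  then have "integrable lborel (\<lambda>\<xi>. complex_of_real (sqrt (2 * pi) * std_normal_density (0 + \<sigma> * \<xi>)))"
    by (intro integrable_of_real integrable_mult_right)
  then show "integrable lborel (\<lambda>\<xi>. complex_of_real (exp (- (\<sigma> * \<xi>)\<^sup>2 / 2)))"
    unfolding n .
  let ?t = "- z / \<sigma>"
  have "complex_of_real (exp (- (?t\<^sup>2) / 2)) = (LINT x|std_normal_distribution. iexp (?t * x))"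
    using char_std_normal_distribution by (metis char_def)
  also have "\<dots> = (LINT x|lborel. std_normal_density x *\<^sub>R iexp (?t * x))"
    by (intro integral_density) auto
  also have "\<dots> = \<bar>\<sigma>\<bar> *\<^sub>R (LINT x|lborel. std_normal_density (0 + \<sigma> * x) *\<^sub>R iexp (?t * (0 + \<sigma> * x)))"
    using assms by (intro lborel_integral_real_affine) auto
  also have "(LINT x|lborel. std_normal_density (0 + \<sigma> * x) *\<^sub>R iexp (?t * (0 + \<sigma> * x)))
     = (LINT \<xi>|lborel. (1 / sqrt (2 * pi)) *\<^sub>R (exp (- \<i> * of_real z * of_real \<xi>) * complex_of_real (exp (- (\<sigma> * \<xi>)\<^sup>2 / 2))))"
    using assms by (intro Bochner_Integration.integral_cong)
      (auto simp: std_normal_density_def scaleR_conv_of_real mult.assoc)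
  finally have e: "complex_of_real (exp (- (?t\<^sup>2) / 2)) = (\<sigma> / sqrt (2 * pi)) *\<^sub>R
     (LINT \<xi>|lborel. exp (- \<i> * of_real z * of_real \<xi>) * complex_of_real (exp (- (\<sigma> * \<xi>)\<^sup>2 / 2)))"
    using assms by simp
  let ?I = "(LINT \<xi>|lborel. exp (- \<i> * of_real z * of_real \<xi>) * complex_of_real (exp (- (\<sigma> * \<xi>)\<^sup>2 / 2)))"
  have "?I = (sqrt (2 * pi) / \<sigma>) *\<^sub>R complex_of_real (exp (- (?t\<^sup>2) / 2))"
    unfolding e using assms by simp
  also have "\<dots> = complex_of_real (2 * pi / \<sigma> * std_normal_density (z / \<sigma>))"
  proof -
    have q: "sqrt (2 * pi) = 2 * pi / sqrt (2 * pi)"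
      by (simp add: real_div_sqrt)
    have "(sqrt (2 * pi) / \<sigma>) * exp (- (?t\<^sup>2) / 2) = 2 * pi / \<sigma> * std_normal_density (z / \<sigma>)"
      unfolding std_normal_density_def by (subst q) (simp add: power_divide)
    then show ?thesis
      by (simp only: scaleR_conv_of_real of_real_mult[symmetric])
  qed
  finally show "?I = complex_of_real (2 * pi / \<sigma> * std_normal_density (z / \<sigma>))" .
qed

text \<open>Write the square of the transform as a product with the conjugate transform, which is again a transform. Two uses of the
multiplication formula move both transforms onto the Gaussian. The right-hand side is an expectation: \<open>g\<close> is compared
with its translate by \<open>\<sigma> Z\<close>, where \<open>Z\<close> is a standard normal variable.\<close>

lemma regularised_Plancherel:
  assumes g: "tame g" and s: "\<sigma> > 0"
  shows "integrable lborel (\<lambda>\<xi>. (cmod (FT g \<xi>))\<^sup>2 * exp (- (\<sigma> * \<xi>)\<^sup>2 / 2))"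
    and "complex_of_real (LINT \<xi>|lborel. (cmod (FT g \<xi>))\<^sup>2 * exp (- (\<sigma> * \<xi>)\<^sup>2 / 2))
      = 2 * pi * (LINT x|lborel. g x * (LINT z|lborel. std_normal_density z *\<^sub>R cnj (g (x - \<sigma> * z))))"
proof -
  have gi: "integrable lborel g" using g by (simp add: tame_def)
  have [measurable]: "g \<in> borel_measurable borel" "FT g \<in> borel_measurable borel"
    using g by (auto intro: tame_measurable FT_measurable)
  define \<gamma> where "\<gamma> \<xi> = complex_of_real (exp (- (\<sigma> * \<xi>)\<^sup>2 / 2))" for \<xi>
  have \<gamma>i: "integrable lborel \<gamma>" unfolding \<gamma>_def by (rule gaussian_FT(1)[OF s])
  have [measurable]: "\<gamma> \<in> borel_measurable borel" using \<gamma>i by auto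
  define M where "M = (LINT x|lborel. cmod (g x))"
  have M: "cmod (FT g \<xi>) \<le> M" for \<xi> unfolding M_def by (rule cmod_FT_le[OF gi])
  have M0: "M \<ge> 0" unfolding M_def by simp
  have bnd: "integrable lborel (\<lambda>\<xi>. h \<xi> * \<gamma> \<xi>)"
    if "\<And>\<xi>. cmod (h \<xi>) \<le> c" and [measurable]: "h \<in> borel_measurable borel"
    for h :: "real \<Rightarrow> complex" and c
    apply (rule Bochner_Integration.integrable_bound[OF integrable_mult_right[OF \<gamma>i, of "complex_of_real c"]])
     apply simp
    using that(1) by (auto simp: norm_mult intro!: mult_right_mono AE_I2 order_trans[OF that(1) abs_ge_self])
  have [measurable]: "(\<lambda>\<xi>. cnj (FT g \<xi>)) \<in> borel_measurable borel"
    using g by (intro borel_measurable_continuous_onI continuous_intros FT_continuous) (simp add: tame_def)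
  have Hi: "integrable lborel (\<lambda>\<xi>. cnj (FT g \<xi>) * \<gamma> \<xi>)"
    by (rule bnd[of _ M]) (use M in auto)
  have "integrable lborel (\<lambda>\<xi>. (FT g \<xi> * cnj (FT g \<xi>)) * \<gamma> \<xi>)"
    by (rule bnd[of _ "M * M"]) (use M M0 in \<open>auto simp: norm_mult intro!: mult_mono\<close>)
  moreover have eq: "(FT g \<xi> * cnj (FT g \<xi>)) * \<gamma> \<xi> = complex_of_real ((cmod (FT g \<xi>))\<^sup>2 * exp (- (\<sigma> * \<xi>)\<^sup>2 / 2))" for \<xi>
    by (simp add: \<gamma>_def complex_norm_square[symmetric])
  ultimately show "integrable lborel (\<lambda>\<xi>. (cmod (FT g \<xi>))\<^sup>2 * exp (- (\<sigma> * \<xi>)\<^sup>2 / 2))"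
    by (simp only: eq complex_of_real_integrable_eq)
  define g' where "g' y = cnj (g (- y))" for y
  have g'i: "integrable lborel g'"
    unfolding g'_def using lborel_integrable_real_affine[OF gi, of "-1" 0] by simp
  have cnjFT: "cnj (FT g \<xi>) = FT g' \<xi>" for \<xi>
  proof -
    have "cnj (FT g \<xi>) = (LINT x|lborel. cnj (exp (- \<i> * of_real x * of_real \<xi>) * g x))"
      unfolding FT_def by (rule Bochner_Integration.integral_bounded_linear
        [OF bounded_linear_cnj integrable_kernel_mult[OF gi], symmetric])
    also have "\<dots> = (LINT x|lborel. exp (\<i> * of_real x * of_real \<xi>) * cnj (g x))"
      by (simp add: exp_cnj)
    also have "\<dots> = (LINT x|lborel. exp (\<i> * of_real (0 + (-1) * x) * of_real \<xi>) * cnj (g (0 + (-1) * x)))"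
      by (subst lborel_integral_real_affine[of "-1" _ 0]) auto
    finally show ?thesis unfolding FT_def g'_def by simp
  qed
  have inner: "FT (\<lambda>\<xi>. cnj (FT g \<xi>) * \<gamma> \<xi>) x = 2 * pi * (LINT z|lborel. std_normal_density z *\<^sub>R cnj (g (x - \<sigma> * z)))" for x
  proof -
    let ?k = "\<lambda>\<xi>. exp (- \<i> * of_real \<xi> * of_real x) * \<gamma> \<xi>"
    have ki: "integrable lborel ?k" by (rule integrable_kernel_mult[OF \<gamma>i])
    have "FT (\<lambda>\<xi>. cnj (FT g \<xi>) * \<gamma> \<xi>) x = (LINT \<xi>|lborel. FT g' \<xi> * ?k \<xi>)"
      unfolding cnjFT FT_def[of "\<lambda>\<xi>. FT g' \<xi> * \<gamma> \<xi>"] by (simp add: ac_simps)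
    also have "\<dots> = (LINT y|lborel. g' y * FT ?k y)"
      by (rule FT_multiplication_formula[OF g'i ki])
    also have "\<dots> = (LINT y|lborel. g' y * complex_of_real (2 * pi / \<sigma> * std_normal_density ((x + y) / \<sigma>)))"
    proof -
      have "FT ?k y = (LINT \<xi>|lborel. exp (- \<i> * of_real (x + y) * of_real \<xi>) * complex_of_real (exp (- (\<sigma> * \<xi>)\<^sup>2 / 2)))" for y
        unfolding FT_def \<gamma>_def
        by (intro Bochner_Integration.integral_cong) (auto simp: algebra_simps exp_add[symmetric] mult_exp_exp)
      then show ?thesis by (simp only: gaussian_FT(2)[OF s])
    qed
    also have "\<dots> = \<bar>\<sigma>\<bar> *\<^sub>R (LINT z|lborel. g' (- x + \<sigma> * z) * complex_of_real (2 * pi / \<sigma> * std_normal_density ((x + (- x + \<sigma> * z)) / \<sigma>)))"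
      using s by (intro lborel_integral_real_affine) auto
    also have "\<dots> = (LINT z|lborel. \<bar>\<sigma>\<bar> *\<^sub>R (g' (- x + \<sigma> * z) * complex_of_real (2 * pi / \<sigma> * std_normal_density ((x + (- x + \<sigma> * z)) / \<sigma>))))"
      by (rule integral_scaleR_right[symmetric])
    also have "\<dots> = (LINT z|lborel. (2 * pi) *\<^sub>R (std_normal_density z *\<^sub>R cnj (g (x - \<sigma> * z))))"
      using s by (intro Bochner_Integration.integral_cong) (auto simp: g'_def scaleR_conv_of_real field_simps)
    also have "\<dots> = (2 * pi) *\<^sub>R (LINT z|lborel. std_normal_density z *\<^sub>R cnj (g (x - \<sigma> * z)))"
      by (rule integral_scaleR_right)
    finally show ?thesis by (simp add: scaleR_conv_of_real)
  qed
  have "complex_of_real (LINT \<xi>|lborel. (cmod (FT g \<xi>))\<^sup>2 * exp (- (\<sigma> * \<xi>)\<^sup>2 / 2))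
      = (LINT \<xi>|lborel. FT g \<xi> * (cnj (FT g \<xi>) * \<gamma> \<xi>))"
    by (simp only: mult.assoc[symmetric] eq integral_complex_of_real)
  also have "\<dots> = (LINT x|lborel. g x * FT (\<lambda>\<xi>. cnj (FT g \<xi>) * \<gamma> \<xi>) x)"
    by (rule FT_multiplication_formula[OF gi Hi])
  also have "\<dots> = (LINT x|lborel. (2 * pi) * (g x * (LINT z|lborel. std_normal_density z *\<^sub>R cnj (g (x - \<sigma> * z)))))"
    unfolding inner by (intro Bochner_Integration.integral_cong) auto
  also have "\<dots> = 2 * pi * (LINT x|lborel. g x * (LINT z|lborel. std_normal_density z *\<^sub>R cnj (g (x - \<sigma> * z))))"
    by (rule integral_mult_right_zero)
  finally show "complex_of_real (LINT \<xi>|lborel. (cmod (FT g \<xi>))\<^sup>2 * exp (- (\<sigma> * \<xi>)\<^sup>2 / 2))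
      = 2 * pi * (LINT x|lborel. g x * (LINT z|lborel. std_normal_density z *\<^sub>R cnj (g (x - \<sigma> * z))))" .
qed

lemma tame_square_integrable:
  assumes "tame g"
  shows "integrable lborel (\<lambda>x. (cmod (g x))\<^sup>2)"
proof -
  obtain C where C: "\<And>x. cmod (g x) \<le> C"
    using assms unfolding tame_def bounded_iff by auto
  have "C \<ge> 0" using C[of 0] norm_ge_zero order_trans by blast
  have [measurable]: "g \<in> borel_measurable borel" using assms by (rule tame_measurable)
  show ?thesis
    by (rule Bochner_Integration.integrable_bound[of _ "\<lambda>x. C * cmod (g x)"])
       (use assms C \<open>C \<ge> 0\<close> in \<open>auto simp: tame_def power2_eq_square abs_mult intro!: mult_right_mono\<close>)
qed

text \<open>Let \<open>\<sigma>\<close> tend to \<open>0\<close> in the regularised identity: monotone convergence applies on the left, and on the right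
continuity and boundedness of \<open>g\<close> allow dominated convergence, first in \<open>z\<close> and then in \<open>x\<close>.\<close>

theorem Plancherel:
  assumes g: "tame g"
  shows "l2_sq (FT g) = ennreal (2 * pi) * l2_sq g"
proof -
  define \<sigma> where "\<sigma> n = 1 / real (Suc n)" for n
  have s: "\<sigma> n > 0" for n by (simp add: \<sigma>_def)
  have s0: "\<sigma> \<longlonglongrightarrow> 0" unfolding \<sigma>_def using LIMSEQ_inverse_real_of_nat by (simp add: inverse_eq_divide)
  have [measurable]: "g \<in> borel_measurable borel" "FT g \<in> borel_measurable borel"
    using g by (auto intro: tame_measurable FT_measurable)
  have [measurable]: "cnj \<in> borel_measurable borel"
    by (intro borel_measurable_continuous_onI continuous_intros)
  obtain C where C: "\<And>x. cmod (g x) \<le> C"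
    using g unfolding tame_def bounded_iff by auto
  have C0: "C \<ge> 0" using C[of 0] norm_ge_zero order_trans by blast
  have stdi: "integrable lborel std_normal_density"
    using integrable_std_normal_moment[of 0] by simp
  have std1: "(LINT z|lborel. std_normal_density z) = 1"
    using integral_std_normal_moment_even[of 0] by simp
  let ?R = "\<lambda>n x. LINT z|lborel. std_normal_density z *\<^sub>R cnj (g (x - \<sigma> n * z))"
  have R: "(\<lambda>n. ?R n x) \<longlonglongrightarrow> cnj (g x)" for x
  proof -
    have "(\<lambda>n. ?R n x) \<longlonglongrightarrow> (LINT z|lborel. std_normal_density z *\<^sub>R cnj (g x))"
    proof (rule integral_dominated_convergence[where w = "\<lambda>z. C * std_normal_density z"])
      have "(\<lambda>n. x - \<sigma> n * z) \<longlonglongrightarrow> x - 0 * z" for z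
        by (intro tendsto_intros s0)
      then have "(\<lambda>n. g (x - \<sigma> n * z)) \<longlonglongrightarrow> g (x - 0 * z)" for z
        by (rule continuous_on_tendsto_compose[of UNIV g, rotated]) (use g in \<open>auto simp: tame_def\<close>)
      then show "AE z in lborel. (\<lambda>n. std_normal_density z *\<^sub>R cnj (g (x - \<sigma> n * z))) \<longlonglongrightarrow> std_normal_density z *\<^sub>R cnj (g x)"
        by (auto intro!: tendsto_intros)
      show "AE z in lborel. norm (std_normal_density z *\<^sub>R cnj (g (x - \<sigma> n * z))) \<le> C * std_normal_density z" for n
        using C by (auto simp: mult.commute[of C] intro!: mult_left_mono)
    qed (use stdi in auto)
    then show ?thesis using std1 stdi by simp
  qed
  have Rb: "cmod (?R n x) \<le> C" for n x
  proof -
    have "cmod (?R n x) \<le> (LINT z|lborel. C * std_normal_density z)"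
    proof (rule Bochner_Integration.integral_norm_bound_integral)
      have b: "norm (std_normal_density z *\<^sub>R cnj (g (x - \<sigma> n * z))) \<le> C * std_normal_density z" for z
        using C by (auto simp: mult.commute[of C] intro!: mult_left_mono)
      then show "norm (std_normal_density z *\<^sub>R cnj (g (x - \<sigma> n * z))) \<le> C * std_normal_density z" for z .
      show i: "integrable lborel (\<lambda>z. C * std_normal_density z)"
        using stdi by simp
      show "integrable lborel (\<lambda>z. std_normal_density z *\<^sub>R cnj (g (x - \<sigma> n * z)))"
        by (rule Bochner_Integration.integrable_bound[OF i])
           (use b in \<open>auto intro!: AE_I2 order_trans[OF _ abs_ge_self]\<close>)
    qed
    then show ?thesis using std1 by simp
  qed
  have [measurable]: "?R n \<in> borel_measurable borel" for n
    by measurable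
  define I where "I n = (LINT \<xi>|lborel. (cmod (FT g \<xi>))\<^sup>2 * exp (- (\<sigma> n * \<xi>)\<^sup>2 / 2))" for n
  have "(\<lambda>n. LINT x|lborel. g x * ?R n x) \<longlonglongrightarrow> (LINT x|lborel. g x * cnj (g x))"
  proof (rule integral_dominated_convergence[where w = "\<lambda>x. cmod (g x) * C"])
    show "AE x in lborel. (\<lambda>n. g x * ?R n x) \<longlonglongrightarrow> g x * cnj (g x)"
      using R by (auto intro!: tendsto_intros)
    show "AE x in lborel. norm (g x * ?R n x) \<le> cmod (g x) * C" for n
      using Rb by (auto simp: norm_mult intro!: mult_left_mono)
  qed (use g in \<open>auto simp: tame_def\<close>)
  then have "(\<lambda>n. 2 * pi * (LINT x|lborel. g x * ?R n x)) \<longlonglongrightarrow> 2 * pi * (LINT x|lborel. g x * cnj (g x))"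
    by (intro tendsto_intros)
  then have "(\<lambda>n. complex_of_real (I n)) \<longlonglongrightarrow> complex_of_real (2 * pi * (LINT x|lborel. (cmod (g x))\<^sup>2))"
    unfolding I_def using regularised_Plancherel(2)[OF g s]
    by (simp add: complex_norm_square[symmetric] flip: of_real_power)
  then have I: "I \<longlonglongrightarrow> 2 * pi * (LINT x|lborel. (cmod (g x))\<^sup>2)"
    by (simp only: tendsto_of_real_iff)
  have "(\<lambda>n. ennreal (I n)) \<longlonglongrightarrow> l2_sq (FT g)"
  proof -
    have "ennreal (I n) = (\<integral>\<^sup>+\<xi>. ennreal ((cmod (FT g \<xi>))\<^sup>2 * exp (- (\<sigma> n * \<xi>)\<^sup>2 / 2)) \<partial>lborel)" for n
      unfolding I_def by (rule nn_integral_eq_integral[symmetric])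
        (rule regularised_Plancherel(1)[OF g s], simp)
    moreover have "(\<lambda>n. \<integral>\<^sup>+\<xi>. ennreal ((cmod (FT g \<xi>))\<^sup>2 * exp (- (\<sigma> n * \<xi>)\<^sup>2 / 2)) \<partial>lborel) \<longlonglongrightarrow> l2_sq (FT g)"
    proof (rule nn_integral_LIMSEQ)
      have "\<sigma> n \<le> \<sigma> m" if "m \<le> n" for m n using that by (simp add: \<sigma>_def frac_le)
      then have "(\<sigma> n * \<xi>)\<^sup>2 \<le> (\<sigma> m * \<xi>)\<^sup>2" if "m \<le> n" for m n \<xi>
        using that less_imp_le[OF s] by (auto simp: power_mult_distrib intro!: mult_right_mono power_mono)
      then show "incseq (\<lambda>n \<xi>. ennreal ((cmod (FT g \<xi>))\<^sup>2 * exp (- (\<sigma> n * \<xi>)\<^sup>2 / 2)))"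
        by (auto simp: incseq_def le_fun_def intro!: ennreal_leI mult_left_mono)
      have "(\<lambda>n. exp (- (\<sigma> n * \<xi>)\<^sup>2 / 2)) \<longlonglongrightarrow> exp (- (0 * \<xi>)\<^sup>2 / 2)" for \<xi>
        by (intro tendsto_intros s0) auto
      then have "(\<lambda>n. (cmod (FT g \<xi>))\<^sup>2 * exp (- (\<sigma> n * \<xi>)\<^sup>2 / 2)) \<longlonglongrightarrow> (cmod (FT g \<xi>))\<^sup>2 * 1" for \<xi>
        by (intro tendsto_intros) simp
      then show "(\<lambda>n. ennreal ((cmod (FT g \<xi>))\<^sup>2 * exp (- (\<sigma> n * \<xi>)\<^sup>2 / 2))) \<longlonglongrightarrow> ennreal ((cmod (FT g \<xi>))\<^sup>2)" for \<xi>
        by (intro tendsto_ennrealI) simp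
    qed auto
    ultimately show ?thesis by simp
  qed
  moreover have "(\<lambda>n. ennreal (I n)) \<longlonglongrightarrow> ennreal (2 * pi * (LINT x|lborel. (cmod (g x))\<^sup>2))"
    by (intro tendsto_ennrealI I)
  ultimately have "l2_sq (FT g) = ennreal (2 * pi * (LINT x|lborel. (cmod (g x))\<^sup>2))"
    by (rule LIMSEQ_unique)
  then show ?thesis
    by (simp add: nn_integral_eq_integral[OF tame_square_integrable[OF g]] ennreal_mult)
qed

section \<open>Superpositions of travelling waves seen from a union of intervals\<close>

text \<open>The union of the intervals with a margin \<open>R\<close> removed at both ends: a point of it may be moved by up to \<open>R\<close>
without leaving the observation set.\<close>

definition shrink :: "(int \<Rightarrow> real) \<Rightarrow> (int \<Rightarrow> real) \<Rightarrow> real \<Rightarrow> real set" where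
  "shrink a b R = (\<Union>n. {a n + R<..<b n - R})"

lemma shrink_measurable [measurable]: "shrink a b R \<in> sets borel"
  unfolding shrink_def by (intro borel_open open_UN ballI) auto

lemma shrink_mono: "R \<le> R' \<Longrightarrow> shrink a b R' \<subseteq> shrink a b R"
  unfolding shrink_def by (rule UN_mono) auto

lemma shrink_translate:
  assumes "x \<in> shrink a b (R + \<rho>)" "\<bar>d\<bar> \<le> \<rho>"
  shows "x - d \<in> shrink a b R"
proof -
  obtain n where "a n + (R + \<rho>) < x" "x < b n - (R + \<rho>)"
    using assms(1) by (auto simp: shrink_def)
  then have "x - d \<in> {a n + R<..<b n - R}" using assms(2) by auto
  then show ?thesis by (auto simp: shrink_def)
qed

text \<open>The observed energy of a scalar signal; the time variable \<open>s\<close> runs backwards from the terminal time, so that a wave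
of speed \<open>\<nu>\<close> has the form \<open>f (x + \<nu> s)\<close>.\<close>

definition energy :: "real \<Rightarrow> real set \<Rightarrow> (real \<Rightarrow> real \<Rightarrow> complex) \<Rightarrow> ennreal" where
  "energy T X w = (\<integral>\<^sup>+s. \<integral>\<^sup>+x. indicator {0<..<T} s * indicator X x * ennreal ((cmod (w s x))\<^sup>2)
     \<partial>lborel \<partial>lborel)"

lemma nn_integral_shift:
  fixes c :: real
  assumes "f \<in> borel_measurable borel"
  shows "(\<integral>\<^sup>+x. f (x + c) \<partial>lborel) = (\<integral>\<^sup>+x. f x \<partial>lborel)"
  using nn_integral_real_affine[OF assms, of 1 c] by (simp add: add.commute)

text \<open>In the coordinate \<open>y = x + \<nu> s\<close> the wave does not depend on \<open>s\<close>, so its energy is weighted, at each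
\<open>y\<close>, by the time that the characteristic through \<open>y\<close> spends in \<open>X\<close>.\<close>

lemma energy_single_wave:
  assumes [measurable]: "f \<in> borel_measurable borel" "X \<in> sets borel"
    and visits: "\<And>y. ennreal \<kappa> \<le> (\<integral>\<^sup>+s. indicator {0<..<T} s * indicator X (y - \<nu> * s) \<partial>lborel)"
  shows "ennreal \<kappa> * l2_sq f \<le> energy T X (\<lambda>s x. f (x + \<nu> * s))"
proof -
  have "energy T X (\<lambda>s x. f (x + \<nu> * s)) =
    (\<integral>\<^sup>+s. \<integral>\<^sup>+y. indicator {0<..<T} s * indicator X (y - \<nu> * s) * ennreal ((cmod (f y))\<^sup>2) \<partial>lborel \<partial>lborel)"
    unfolding energy_def
  proof (rule nn_integral_cong)
    fix s
    show "(\<integral>\<^sup>+x. indicator {0<..<T} s * indicator X x * ennreal ((cmod (f (x + \<nu> * s)))\<^sup>2) \<partial>lborel)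
      = (\<integral>\<^sup>+y. indicator {0<..<T} s * indicator X (y - \<nu> * s) * ennreal ((cmod (f y))\<^sup>2) \<partial>lborel)"
      by (subst nn_integral_shift[of _ "\<nu> * s", symmetric]) auto
  qed
  also have "\<dots> = (\<integral>\<^sup>+y. \<integral>\<^sup>+s. indicator {0<..<T} s * indicator X (y - \<nu> * s) * ennreal ((cmod (f y))\<^sup>2) \<partial>lborel \<partial>lborel)"
    by (rule lborel_pair.Fubini'[symmetric]) measurable
  also have "\<dots> = (\<integral>\<^sup>+y. (\<integral>\<^sup>+s. indicator {0<..<T} s * indicator X (y - \<nu> * s) \<partial>lborel) * ennreal ((cmod (f y))\<^sup>2) \<partial>lborel)"
    by (subst nn_integral_multc) auto
  also have "\<dots> \<ge> (\<integral>\<^sup>+y. ennreal \<kappa> * ennreal ((cmod (f y))\<^sup>2) \<partial>lborel)"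
    by (intro nn_integral_mono mult_right_mono visits) auto
  also have "(\<integral>\<^sup>+y. ennreal \<kappa> * ennreal ((cmod (f y))\<^sup>2) \<partial>lborel) = ennreal \<kappa> * l2_sq f"
    by (rule nn_integral_cmult) auto
  finally show ?thesis .
qed

lemma energy_mono:
  assumes "X' \<subseteq> X" "T' \<le> T"
  shows "energy T' X' w \<le> energy T X w"
  unfolding energy_def using assms
  by (intro nn_integral_mono mult_mono) (auto simp: indicator_def)

lemma energy_translate:
  assumes [measurable]: "(\<lambda>(s, x). w s x) \<in> borel_measurable (borel \<Otimes>\<^sub>M borel)"
    and [measurable]: "X \<in> sets borel" "X' \<in> sets borel"
    and X: "\<And>x. x \<in> X' \<Longrightarrow> x - d \<in> X" and h: "0 \<le> h" "T' + h \<le> T"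
  shows "energy T' X' (\<lambda>s x. w (s + h) (x - d)) \<le> energy T X w"
proof -
  have "energy T' X' (\<lambda>s x. w (s + h) (x - d)) \<le>
     (\<integral>\<^sup>+s. \<integral>\<^sup>+x. indicator {0<..<T} (s + h) * indicator X (x + - d) * ennreal ((cmod (w (s + h) (x + - d)))\<^sup>2)
     \<partial>lborel \<partial>lborel)"
    unfolding energy_def using X h
    by (intro nn_integral_mono) (auto simp: indicator_def)
  also have "\<dots> = (\<integral>\<^sup>+s. \<integral>\<^sup>+x. indicator {0<..<T} (s + h) * indicator X x * ennreal ((cmod (w (s + h) x))\<^sup>2)
     \<partial>lborel \<partial>lborel)"
    by (intro nn_integral_cong nn_integral_shift
          [of "\<lambda>x. indicator {0<..<T} (_ + h) * indicator X x * ennreal ((cmod (w (_ + h) x))\<^sup>2)"]) measurable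
  also have "\<dots> = energy T X w"
    unfolding energy_def
    by (rule nn_integral_shift
          [of "\<lambda>s. \<integral>\<^sup>+x. indicator {0<..<T} s * indicator X x * ennreal ((cmod (w s x))\<^sup>2) \<partial>lborel"]) measurable
  finally show ?thesis .
qed

lemma norm_diff_square_le: "(norm (x - y))\<^sup>2 \<le> 2 * (norm x)\<^sup>2 + 2 * (norm (y :: 'a :: real_normed_vector))\<^sup>2"
proof -
  have "(norm (x - y))\<^sup>2 \<le> (norm x + norm y)\<^sup>2"
    by (intro power_mono norm_triangle_ineq4) auto
  also have "\<dots> \<le> 2 * (norm x)\<^sup>2 + 2 * (norm y)\<^sup>2"
    using zero_le_power2[of "norm x - norm y"] by (simp add: power2_eq_square algebra_simps)
  finally show ?thesis .
qed

lemma energy_diff_le: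
  assumes [measurable]: "(\<lambda>(s, x). v s x) \<in> borel_measurable (borel \<Otimes>\<^sub>M borel)"
    "(\<lambda>(s, x). w s x) \<in> borel_measurable (borel \<Otimes>\<^sub>M borel)" "X \<in> sets borel"
  shows "energy T X (\<lambda>s x. v s x - w s x) \<le> 2 * energy T X v + 2 * energy T X w"
proof -
  have "energy T X (\<lambda>s x. v s x - w s x) \<le> (\<integral>\<^sup>+s. \<integral>\<^sup>+x.
     2 * (indicator {0<..<T} s * indicator X x * ennreal ((cmod (v s x))\<^sup>2)) +
     2 * (indicator {0<..<T} s * indicator X x * ennreal ((cmod (w s x))\<^sup>2)) \<partial>lborel \<partial>lborel)"
    unfolding energy_def
  proof (intro nn_integral_mono)
    fix s x
    have "ennreal ((cmod (v s x - w s x))\<^sup>2) \<le> ennreal (2 * (cmod (v s x))\<^sup>2 + 2 * (cmod (w s x))\<^sup>2)"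
      by (intro ennreal_leI norm_diff_square_le)
    also have "\<dots> = 2 * ennreal ((cmod (v s x))\<^sup>2) + 2 * ennreal ((cmod (w s x))\<^sup>2)"
      by (simp add: ennreal_mult)
    finally show "indicator {0<..<T} s * indicator X x * ennreal ((cmod (v s x - w s x))\<^sup>2) \<le>
     2 * (indicator {0<..<T} s * indicator X x * ennreal ((cmod (v s x))\<^sup>2)) +
     2 * (indicator {0<..<T} s * indicator X x * ennreal ((cmod (w s x))\<^sup>2))"
      by (auto simp: indicator_def)
  qed
  also have "\<dots> = 2 * energy T X v + 2 * energy T X w"
    unfolding energy_def by (simp add: nn_integral_add nn_integral_cmult)
  finally show ?thesis .
qed

text \<open>A difference of step \<open>h\<close> acts on the Fourier side as \<open>exp (\<i> c h) - 1\<close>, which vanishes when \<open>c h\<close> is a multiple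
of \<open>2\<pi>\<close>. Integrating its square over the step removes these zeros, except the one at \<open>c = 0\<close>.\<close>

definition multiplier :: "real \<Rightarrow> real \<Rightarrow> ennreal" where
  "multiplier c h0 = (\<integral>\<^sup>+h. indicator {0<..<h0} h * ennreal ((cmod (exp (\<i> * of_real (c * h)) - 1))\<^sup>2) \<partial>lborel)"

lemma multiplier_measurable [measurable]: "(\<lambda>c. multiplier c h0) \<in> borel_measurable borel"
  unfolding multiplier_def by measurable

lemma cmod_exp_minus_one_square: "(cmod (exp (\<i> * of_real t) - 1))\<^sup>2 = 2 - 2 * cos t"
proof -
  have "(cmod (exp (\<i> * of_real t) - 1))\<^sup>2 = (cos t - 1)\<^sup>2 + (sin t)\<^sup>2"
    by (simp add: cmod_power2 Re_exp Im_exp)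
  also have "\<dots> = 2 - 2 * cos t"
    using sin_cos_squared_add[of t] by (simp add: power2_eq_square algebra_simps)
  finally show ?thesis .
qed

lemma sinc_gap:
  assumes "X > 0"
  shows "min (X\<^sup>2) 1 / 10 \<le> 1 - sin X / (X::real)"
proof (cases "X \<le> 2")
  case True
  have e1: "(\<Sum>m<5. sin_coeff m * X ^ m) = X - X ^ 3 / 6"
    by (simp add: lessThan_Suc eval_nat_numeral sin_coeff_Suc cos_coeff_Suc)
  have e2: "inverse (fact 5) = (1 / 120 :: real)"
    by (simp add: fact_numeral)
  have "\<bar>sin X - (X - X ^ 3 / 6)\<bar> \<le> 1 / 120 * \<bar>X\<bar> ^ 5"
    using Maclaurin_sin_bound[of X 5] unfolding e1 e2 .
  then have "sin X - (X - X ^ 3 / 6) \<le> 1 / 120 * \<bar>X\<bar> ^ 5"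
    by (rule order_trans[OF abs_ge_self])
  then have "sin X \<le> X - X ^ 3 / 6 + X ^ 5 / 120"
    using assms by simp
  then have "sin X / X \<le> (X - X ^ 3 / 6 + X ^ 5 / 120) / X"
    using assms by (intro divide_right_mono) auto
  also have "\<dots> = 1 - X\<^sup>2 / 6 + X\<^sup>2 * X\<^sup>2 / 120"
    using assms by (simp add: field_simps eval_nat_numeral)
  also have "\<dots> \<le> 1 - X\<^sup>2 / 6 + X\<^sup>2 * 4 / 120"
  proof -
    have "X\<^sup>2 * X\<^sup>2 \<le> X\<^sup>2 * 4"
      using power_mono[of X 2 2] assms True by (intro mult_left_mono) auto
    then show ?thesis by (intro add_left_mono divide_right_mono) auto
  qed
  finally have "sin X / X \<le> 1 - X\<^sup>2 / 6 + X\<^sup>2 * 4 / 120" .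
  moreover have "s \<le> 1 - q / 6 + q * 4 / 120 \<Longrightarrow> 0 \<le> q \<Longrightarrow> min q 1 / 10 \<le> 1 - s" for s q :: real
    by (auto simp: min_def)
  ultimately show ?thesis using zero_le_power2 by blast
next
  case False
  have "sin X / X \<le> 1 / X" using assms by (intro divide_right_mono) auto
  also have "\<dots> \<le> 1 / 2" using False by (intro divide_left_mono) auto
  finally have "sin X / X \<le> 1 / 2" .
  moreover have "s \<le> 1 / 2 \<Longrightarrow> min q 1 / 10 \<le> 1 - s" for s q :: real
    by (auto simp: min_def)
  ultimately show ?thesis by blast
qed

text \<open>The integral equals \<open>2 h0 - 2 sin (c h0) / c\<close>. It is of order \<open>h0\<close> if \<open>c h0\<close> is large and of order
\<open>c\<^sup>2 h0\<^sup>3\<close> if \<open>c h0\<close> is small; for \<open>c\<close> bounded away from \<open>0\<close> the second behaviour is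
the worse one.\<close>

lemma multiplier_lower_bound:
  assumes "0 < h0" "h0 \<le> 1" "0 < \<epsilon>" "\<epsilon> \<le> \<bar>c\<bar>"
  shows "ennreal (min (\<epsilon>\<^sup>2) 1 / 5 * h0 ^ 3) \<le> multiplier c h0"
proof -
  have c: "c \<noteq> 0" using assms by auto
  have "(\<integral>\<^sup>+h. ennreal (2 - 2 * cos (c * h)) * indicator {0..h0} h \<partial>lborel)
      = ennreal ((2 * h0 - 2 * sin (c * h0) / c) - (2 * 0 - 2 * sin (c * 0) / c))"
    using assms c by (intro nn_integral_FTC_Icc[where F = "\<lambda>h. 2 * h - 2 * sin (c * h) / c"])
      (auto intro!: derivative_eq_intros simp: has_real_derivative_iff_has_vector_derivative[symmetric])
  also have "(\<integral>\<^sup>+h. ennreal (2 - 2 * cos (c * h)) * indicator {0..h0} h \<partial>lborel) = multiplier c h0"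
    unfolding multiplier_def cmod_exp_minus_one_square
    by (rule nn_integral_cong_AE, rule AE_mp[OF AE_lborel_singleton[of 0]], rule AE_mp[OF AE_lborel_singleton[of h0]])
       (auto simp: indicator_def)
  finally have m: "multiplier c h0 = ennreal (2 * h0 - 2 * sin (c * h0) / c)" by simp
  let ?X = "\<bar>c\<bar> * h0"
  have X: "?X > 0" using assms by simp
  have "min (\<epsilon>\<^sup>2) 1 * h0\<^sup>2 \<le> min (?X\<^sup>2) 1"
  proof -
    have "\<epsilon>\<^sup>2 \<le> \<bar>c\<bar>\<^sup>2" using assms by (intro power_mono) auto
    then have "min (\<epsilon>\<^sup>2) 1 * h0\<^sup>2 \<le> ?X\<^sup>2"
      using mult_right_mono[of "min (\<epsilon>\<^sup>2) 1" "\<bar>c\<bar>\<^sup>2" "h0\<^sup>2"] by (simp add: power_mult_distrib)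
    moreover have "min (\<epsilon>\<^sup>2) 1 * h0\<^sup>2 \<le> 1 * 1"
      using assms by (intro mult_mono) (auto simp: power_le_one)
    ultimately show ?thesis by simp
  qed
  also have "min (?X\<^sup>2) 1 \<le> 10 * (1 - sin ?X / ?X)" 
  proof -
    have "y / 10 \<le> z \<Longrightarrow> y \<le> 10 * z" for y z :: real by simp
    then show ?thesis using sinc_gap[OF X] .
  qed
  also have "sin ?X / ?X = sin (c * h0) / (c * h0)"
    by (cases "c > 0") (auto simp: abs_if)
  finally have "min (\<epsilon>\<^sup>2) 1 * h0\<^sup>2 / 10 \<le> 1 - sin (c * h0) / (c * h0)"
    by (simp only: pos_divide_le_eq mult.commute zero_less_numeral)
  then have "2 * h0 * (min (\<epsilon>\<^sup>2) 1 * h0\<^sup>2 / 10) \<le> 2 * h0 * (1 - sin (c * h0) / (c * h0))"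
    using assms by (intro mult_left_mono) auto
  also have "\<dots> = 2 * h0 - 2 * sin (c * h0) / c"
    using assms c by (simp add: field_simps)
  finally have "min (\<epsilon>\<^sup>2) 1 / 5 * h0 ^ 3 \<le> 2 * h0 - 2 * sin (c * h0) / c"
    by (simp add: eval_nat_numeral ac_simps)
  then show ?thesis unfolding m by (rule ennreal_leI)
qed

locale gaps =
  fixes a b :: "int \<Rightarrow> real" and G l :: real
  assumes l_pos: "l > 0" and len: "\<And>n. l \<le> b n - a n" and gap: "\<And>n. a (n + 1) - b n \<le> G"
    and disj: "\<And>n. b n < a (n + 1)"
begin

text \<open>The right ends increase by at least \<open>l\<close> from each interval to the next, so they are unbounded in both directions.\<close>

lemma crossing: "\<exists>n. b n \<le> x \<and> x < b (n + 1)"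
proof -
  have step: "b n + l \<le> b (n + 1)" for n using len[of "n + 1"] disj[of n] by linarith
  have up: "b n + real k * l \<le> b (n + int k)" for n k
  proof (induction k)
    case (Suc k)
    then show ?case using step[of "n + int k"] by (simp add: algebra_simps)
  qed simp
  obtain k1 :: nat where k1: "b 0 - x < real k1 * l"
    using reals_Archimedean3[OF l_pos] by blast
  define N where "N = - int k1"
  have N: "b N \<le> x" using up[of N k1] k1 by (simp add: N_def)
  obtain k2 :: nat where k2: "x - b N < real k2 * l"
    using reals_Archimedean3[OF l_pos] by blast
  \<comment> \<open>the wanted index precedes the first right end beyond \<open>x\<close>\<close>
  define P where "P k \<longleftrightarrow> x < b (N + int k)" for k
  have "P k2" using up[of N k2] k2 by (simp add: P_def)
  then have P: "P (LEAST k. P k)" by (rule LeastI)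
  define k where "k = (LEAST k. P k)"
  have "k \<noteq> 0"
  proof
    assume "k = 0"
    then have "P 0" using P by (simp add: k_def)
    then show False using N by (simp add: P_def)
  qed
  then obtain k' where k': "k = Suc k'" by (cases k) auto
  have "\<not> P k'" using not_less_Least[of k' P] k' by (simp add: k_def)
  then have "b (N + int k') \<le> x" by (simp add: P_def)
  moreover have "x < b (N + int k' + 1)" 
  proof -
    have "P k" using P by (simp add: k_def)
    then show ?thesis using k' by (simp add: P_def ac_simps)
  qed
  ultimately show ?thesis by blast
qed

text \<open>While it travels the distance \<open>\<bar>\<nu>\<bar> T\<close>, a characteristic crosses at most one gap, of length at most \<open>G + 2 R\<close>
after shrinking, before it has spent the length \<open>\<kappa>\<close> in the set. The interval in question is the first one
whose right end lies beyond \<open>c + \<kappa>\<close>, where \<open>c\<close> is the left end of the path: either its left end is already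
passed, or the path reaches it with a length of at least \<open>\<kappa>\<close> to spare.\<close>

lemma passage_time:
  assumes "0 < \<kappa>" "0 \<le> R" "\<kappa> \<le> l - 2 * R" "\<nu> \<noteq> 0" "G + 2 * R + 2 * \<kappa> \<le> \<bar>\<nu>\<bar> * T"
  shows "ennreal (\<kappa> / \<bar>\<nu>\<bar>) \<le> (\<integral>\<^sup>+s. indicator {0<..<T} s * indicator (shrink a b R) (y - \<nu> * s) \<partial>lborel)"
proof -
  have G: "G > 0" using gap[of 0] disj[of 0] by linarith
  define L where "L = \<bar>\<nu>\<bar> * T"
  \<comment> \<open>the characteristic \<open>y - \<nu> s\<close> sweeps the interval from \<open>c\<close> to \<open>c + L\<close>\<close>
  define c where "c = (if \<nu> > 0 then y - L else y)"
  obtain n where n: "b n - R \<le> c + \<kappa>" "c + \<kappa> < b (n + 1) - R"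
    using crossing[of "c + \<kappa> + R"] by (auto simp: algebra_simps)
  define \<alpha> where "\<alpha> = max (a (n + 1) + R) c"
  define \<beta> where "\<beta> = min (b (n + 1) - R) (c + L)"
  have L: "L \<ge> G + 2 * R + 2 * \<kappa>" using assms by (simp add: L_def)
  have len': "\<beta> - \<alpha> \<ge> \<kappa>"
    using n len[of "n + 1"] gap[of n] assms(1-3) L G unfolding \<alpha>_def \<beta>_def by (auto simp: max_def min_def)
  have sub: "{\<alpha><..<\<beta>} \<subseteq> shrink a b R" "c \<le> \<alpha>" "\<beta> \<le> c + L"
    unfolding \<alpha>_def \<beta>_def shrink_def by force+
  define lo where "lo = (if \<nu> > 0 then (y - \<beta>) / \<bar>\<nu>\<bar> else (\<alpha> - y) / \<bar>\<nu>\<bar>)"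
  define hi where "hi = (if \<nu> > 0 then (y - \<alpha>) / \<bar>\<nu>\<bar> else (\<beta> - y) / \<bar>\<nu>\<bar>)"
  have d: "hi - lo = (\<beta> - \<alpha>) / \<bar>\<nu>\<bar>"
    by (auto simp: hi_def lo_def diff_divide_distrib)
  have in1: "0 < s \<and> s < T \<and> y - \<nu> * s \<in> shrink a b R" if "lo < s" "s < hi" for s
  proof (cases "\<nu> > 0")
    case True
    then have "y - \<beta> < \<nu> * s" "\<nu> * s < y - \<alpha>"
      using that by (auto simp: lo_def hi_def field_simps)
    moreover have "c = y - \<nu> * T" "c + L = y" using True by (simp_all add: c_def L_def)
    then have "0 < \<nu> * s" "\<nu> * s < \<nu> * T"
      using sub calculation by linarith+
    ultimately show ?thesis using True sub(1) by (auto simp: zero_less_mult_iff)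
  next
    case False
    then have "\<alpha> - y < - \<nu> * s" "- \<nu> * s < \<beta> - y"
      using that assms(4) by (auto simp: lo_def hi_def field_simps)
    moreover have "c = y" "c + L = y - \<nu> * T" using False by (simp_all add: c_def L_def)
    then have "0 < - \<nu> * s" "- \<nu> * s < - \<nu> * T"
      using sub calculation by linarith+
    ultimately show ?thesis using False sub(1) by (auto simp: zero_less_mult_iff mult_less_0_iff)
  qed
  have "lo \<le> hi" using d len' assms(1,4) by (smt (verit) divide_nonneg_pos zero_less_abs_iff)
  have "ennreal (\<kappa> / \<bar>\<nu>\<bar>) \<le> ennreal (hi - lo)"
    unfolding d using len' by (intro ennreal_leI divide_right_mono) auto
  also have "\<dots> = (\<integral>\<^sup>+s. indicator {lo<..<hi} s \<partial>lborel)"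
    using \<open>lo \<le> hi\<close> by (simp add: nn_integral_indicator)
  also have "\<dots> \<le> (\<integral>\<^sup>+s. indicator {0<..<T} s * indicator (shrink a b R) (y - \<nu> * s) \<partial>lborel)"
    using in1 by (intro nn_integral_mono) (auto simp: indicator_def)
  finally show ?thesis .
qed

lemma superposition_measurable:
  assumes "\<And>\<nu>. tame (f \<nu>)"
  shows "(\<lambda>(s, x). \<Sum>\<nu>\<in>L. f \<nu> (x + \<nu> * s)) \<in> borel_measurable (borel \<Otimes>\<^sub>M borel)"
proof -
  have [measurable]: "f \<nu> \<in> borel_measurable borel" for \<nu> using tame_measurable[OF assms] .
  show ?thesis by measurable
qed

text \<open>The speeds in \<open>\<mu>s\<close> are eliminated one after the other. Replacing \<open>w s x\<close> by
\<open>w (s + h) (x - \<mu> h) - w s x\<close> replaces each profile \<open>f \<nu> y\<close> by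
\<open>f \<nu> (y + (\<nu> - \<mu>) h) - f \<nu> y\<close>, hence removes the speed \<open>\<mu>\<close>; it at most quadruples the energy, provided that the
time is shortened by \<open>h0\<close> and the set shrunk by \<open>\<rho>\<close>. The induction hypothesis holds for each step \<open>h < h0\<close>
with the same right-hand side. Integrating it over \<open>h\<close> independently at each stage makes the averaged multipliers
factorize. When one wave is left, the time of passage and Plancherel's identity conclude.\<close>

lemma isolate_wave:
  assumes "distinct (j # \<mu>s)" "j \<noteq> 0" "\<And>\<nu>. tame (f \<nu>)" "0 < h0" "0 \<le> \<rho>" "0 \<le> R" "0 < \<kappa>"
    and "\<And>\<mu>. \<mu> \<in> set \<mu>s \<Longrightarrow> \<bar>\<mu>\<bar> * h0 \<le> \<rho>"
    and "\<kappa> \<le> l - 2 * (R + real (length \<mu>s) * \<rho>)"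
    and "G + 2 * (R + real (length \<mu>s) * \<rho>) + 2 * \<kappa> \<le> \<bar>j\<bar> * (T - real (length \<mu>s) * h0)"
  shows "ennreal (\<kappa> / \<bar>j\<bar>) * (\<integral>\<^sup>+\<xi>. ennreal ((cmod (FT (f j) \<xi>))\<^sup>2) *
            prod_list (map (\<lambda>\<mu>. multiplier ((j - \<mu>) * \<xi>) h0) \<mu>s) \<partial>lborel)
     \<le> ennreal (2 * pi) * ennreal (4 * h0) ^ length \<mu>s *
        energy T (shrink a b R) (\<lambda>s x. \<Sum>\<nu>\<in>set (j # \<mu>s). f \<nu> (x + \<nu> * s))"
  using assms
proof (induction \<mu>s arbitrary: f T R)
  case Nil
  have [measurable]: "f j \<in> borel_measurable borel" using tame_measurable[OF Nil(3)] .
  have "ennreal (\<kappa> / \<bar>j\<bar>) * l2_sq (f j) \<le> energy T (shrink a b R) (\<lambda>s x. f j (x + j * s))"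
    using Nil by (intro energy_single_wave passage_time) auto
  then have "ennreal (2 * pi) * (ennreal (\<kappa> / \<bar>j\<bar>) * l2_sq (f j))
     \<le> ennreal (2 * pi) * energy T (shrink a b R) (\<lambda>s x. f j (x + j * s))"
    by (rule mult_left_mono) auto
  then show ?case
    using Plancherel[OF Nil(3)[of j]] by (simp add: ac_simps)
next
  case (Cons \<mu> \<mu>s)
  let ?r = "length \<mu>s"
  let ?W = "\<lambda>s x. \<Sum>\<nu>\<in>set (j # \<mu> # \<mu>s). f \<nu> (x + \<nu> * s)"
  let ?E = "energy T (shrink a b R) ?W"
  let ?C = "ennreal (2 * pi) * ennreal (4 * h0) ^ ?r * (4 * ?E)"
  have [measurable]: "FT (f j) \<in> borel_measurable borel" using FT_measurable[OF Cons(4)] .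
  have [measurable]: "(\<lambda>\<xi>. prod_list (map (\<lambda>\<mu>. multiplier ((j - \<mu>) * \<xi>) h0) ms)) \<in> borel_measurable borel" for ms
    by (induction ms) auto
  let ?P = "\<lambda>\<xi>. prod_list (map (\<lambda>\<mu>. multiplier ((j - \<mu>) * \<xi>) h0) \<mu>s)"
  have step: "ennreal (\<kappa> / \<bar>j\<bar>) * (\<integral>\<^sup>+\<xi>. ennreal ((cmod (exp (\<i> * of_real ((j - \<mu>) * \<xi> * h)) - 1))\<^sup>2) *
       (ennreal ((cmod (FT (f j) \<xi>))\<^sup>2) * ?P \<xi>) \<partial>lborel) \<le> ?C" if h: "0 < h" "h < h0" for h
  proof -
    define f' where "f' \<nu> y = f \<nu> (y + (\<nu> - \<mu>) * h) - f \<nu> y" for \<nu> y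
    have f': "tame (f' \<nu>)" for \<nu>
      unfolding f'_def by (intro tame_diff tame_shift Cons)
    have FT': "FT (f' j) \<xi> = (exp (\<i> * of_real ((j - \<mu>) * \<xi> * h)) - 1) * FT (f j) \<xi>" for \<xi>
    proof -
      have "FT (f' j) \<xi> = FT (\<lambda>y. f j (y + (j - \<mu>) * h)) \<xi> - FT (f j) \<xi>"
        unfolding f'_def by (intro FT_diff tame_shift Cons.prems(3))
      moreover have "exp (\<i> * of_real ((j - \<mu>) * h) * of_real \<xi>) = exp (\<i> * of_real ((j - \<mu>) * \<xi> * h))"
        by (simp add: ac_simps)
      ultimately show ?thesis
        unfolding FT_shift by (simp add: left_diff_distrib)
    qed
    have "ennreal (\<kappa> / \<bar>j\<bar>) * (\<integral>\<^sup>+\<xi>. ennreal ((cmod (FT (f' j) \<xi>))\<^sup>2) * ?P \<xi> \<partial>lborel)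
       \<le> ennreal (2 * pi) * ennreal (4 * h0) ^ ?r *
          energy (T - h0) (shrink a b (R + \<rho>)) (\<lambda>s x. \<Sum>\<nu>\<in>set (j # \<mu>s). f' \<nu> (x + \<nu> * s))"
      by (rule Cons.IH) (use Cons.prems f' in \<open>auto simp: algebra_simps\<close>)
    also have "(\<lambda>s x. \<Sum>\<nu>\<in>set (j # \<mu>s). f' \<nu> (x + \<nu> * s)) = (\<lambda>s x. ?W (s + h) (x - \<mu> * h) - ?W s x)"
    proof (intro ext)
      fix s x
      have "?W (s + h) (x - \<mu> * h) - ?W s x = (\<Sum>\<nu>\<in>set (j # \<mu> # \<mu>s). f' \<nu> (x + \<nu> * s))"
        unfolding sum_subtractf[symmetric] f'_def by (intro sum.cong) (auto simp: algebra_simps)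
      also have "\<dots> = (\<Sum>\<nu>\<in>set (j # \<mu>s). f' \<nu> (x + \<nu> * s))"
      proof -
        have "set (j # \<mu> # \<mu>s) = insert \<mu> (set (j # \<mu>s))" by auto
        then show ?thesis
          using Cons.prems(1) by (simp only:) (subst sum.insert, auto simp: f'_def)
      qed
      finally show "(\<Sum>\<nu>\<in>set (j # \<mu>s). f' \<nu> (x + \<nu> * s)) = ?W (s + h) (x - \<mu> * h) - ?W s x" by simp
    qed
    also have "energy (T - h0) (shrink a b (R + \<rho>)) (\<lambda>s x. ?W (s + h) (x - \<mu> * h) - ?W s x) \<le> 4 * ?E"
    proof -
      note [measurable] = superposition_measurable[OF Cons(4), where L = "set (j # \<mu> # \<mu>s)"]
      have d: "\<bar>\<mu> * h\<bar> \<le> \<rho>"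
        using Cons.prems(8)[of \<mu>] h mult_left_mono[of h h0 "\<bar>\<mu>\<bar>"] by (simp add: abs_mult)
      have "energy (T - h0) (shrink a b (R + \<rho>)) (\<lambda>s x. ?W (s + h) (x - \<mu> * h) - ?W s x) \<le>
         2 * energy (T - h0) (shrink a b (R + \<rho>)) (\<lambda>s x. ?W (s + h) (x - \<mu> * h)) + 2 * energy (T - h0) (shrink a b (R + \<rho>)) ?W"
      proof (rule energy_diff_le)
        have [measurable]: "f \<nu> \<in> borel_measurable borel" for \<nu>
          using tame_measurable[OF Cons(4)] .
        show "(\<lambda>(s, x). ?W (s + h) (x - \<mu> * h)) \<in> borel_measurable (borel \<Otimes>\<^sub>M borel)"
          by measurable
      qed measurable
      also have "\<dots> \<le> 2 * ?E + 2 * ?E"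
        using h Cons.prems d
        by (intro add_mono mult_left_mono energy_translate energy_mono shrink_mono
              superposition_measurable) (auto intro: shrink_translate)
      also have "\<dots> = 4 * ?E" by (simp flip: distrib_right)
      finally show ?thesis .
    qed
    finally show ?thesis
      by (simp add: FT' norm_mult power_mult_distrib ennreal_mult mult.assoc mult_left_mono)
  qed
  have "ennreal (\<kappa> / \<bar>j\<bar>) * (\<integral>\<^sup>+\<xi>. ennreal ((cmod (FT (f j) \<xi>))\<^sup>2) *
            prod_list (map (\<lambda>\<mu>. multiplier ((j - \<mu>) * \<xi>) h0) (\<mu> # \<mu>s)) \<partial>lborel)
    = ennreal (\<kappa> / \<bar>j\<bar>) * (\<integral>\<^sup>+\<xi>. \<integral>\<^sup>+h. indicator {0<..<h0} h * (ennreal ((cmod (exp (\<i> * of_real ((j - \<mu>) * \<xi> * h)) - 1))\<^sup>2) *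
       (ennreal ((cmod (FT (f j) \<xi>))\<^sup>2) * ?P \<xi>)) \<partial>lborel \<partial>lborel)"
    unfolding multiplier_def[of "(j - \<mu>) * _"] list.map prod_list.Cons
    by (simp add: nn_integral_multc[symmetric] nn_integral_cmult[symmetric] ac_simps)
  also have "\<dots> = (\<integral>\<^sup>+h. indicator {0<..<h0} h * (ennreal (\<kappa> / \<bar>j\<bar>) * (\<integral>\<^sup>+\<xi>. ennreal ((cmod (exp (\<i> * of_real ((j - \<mu>) * \<xi> * h)) - 1))\<^sup>2) *
       (ennreal ((cmod (FT (f j) \<xi>))\<^sup>2) * ?P \<xi>) \<partial>lborel)) \<partial>lborel)"
    by (subst lborel_pair.Fubini'[symmetric], measurable)
       (simp add: nn_integral_cmult[symmetric] mult.left_commute)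
  also have "\<dots> \<le> (\<integral>\<^sup>+h. indicator {0<..<h0} h * ?C \<partial>lborel)"
    by (intro nn_integral_mono) (use step in \<open>auto simp: indicator_def\<close>)
  also have "\<dots> = ennreal h0 * ?C"
    using \<open>0 < h0\<close> by (subst nn_integral_multc) auto
  also have "\<dots> = ennreal (2 * pi) * ennreal (4 * h0) ^ length (\<mu> # \<mu>s) * ?E"
    using \<open>0 < h0\<close> by (simp add: ennreal_mult ac_simps)
  finally show ?case .
qed

end

section \<open>High frequencies, and filling the gaps at low frequencies\<close>

abbreviation high_sq :: "real \<Rightarrow> (real \<Rightarrow> complex) \<Rightarrow> ennreal" where
  "high_sq \<epsilon> h \<equiv> \<integral>\<^sup>+\<xi>. indicator {\<xi>. \<epsilon> \<le> \<bar>\<xi>\<bar>} \<xi> * ennreal ((cmod (h \<xi>))\<^sup>2) \<partial>lborel"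

lemma separated_finite_set:
  assumes "finite L"
  shows "\<exists>\<sigma>>0. \<forall>x\<in>L. \<forall>y\<in>L. x \<noteq> y \<longrightarrow> \<sigma> \<le> \<bar>x - y :: real\<bar>"
proof -
  define D where "D = insert 1 ((\<lambda>(x, y). \<bar>x - y\<bar>) ` {(x, y) \<in> L \<times> L. x \<noteq> y})"
  have "finite {(x, y) \<in> L \<times> L. x \<noteq> y}"
    by (rule finite_subset[of _ "L \<times> L"]) (use assms in auto)
  then have fin: "finite D" by (simp add: D_def)
  have "Min D \<in> D" using fin by (intro Min_in) (auto simp: D_def)
  then have "Min D > 0" by (auto simp: D_def)
  moreover have "Min D \<le> \<bar>x - y\<bar>" if "x \<in> L" "y \<in> L" "x \<noteq> y" for x y
    using fin that by (intro Min_le) (auto simp: D_def)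
  ultimately show ?thesis by blast
qed

lemma prod_list_map_ge_power:
  fixes f :: "'a \<Rightarrow> ennreal"
  assumes "\<And>x. x \<in> set xs \<Longrightarrow> c \<le> f x"
  shows "c ^ length xs \<le> prod_list (map f xs)"
  using assms by (induction xs) (auto intro!: mult_mono)

lemma ennreal_le_of_mult_le:
  assumes "ennreal p * x \<le> y" "0 < p"
  shows "x \<le> ennreal (1 / p) * y"
proof -
  have "ennreal (1 / p) * (ennreal p * x) \<le> ennreal (1 / p) * y"
    using assms(1) by (intro mult_left_mono) auto
  moreover have "ennreal (1 / p) * (ennreal p * x) = x"
    using assms(2) by (simp add: mult.assoc[symmetric] ennreal_mult[symmetric])
  ultimately show ?thesis by simp
qed

lemma ennreal_mult_collapse:
  "0 \<le> p \<Longrightarrow> 0 \<le> q \<Longrightarrow> p * q = r \<Longrightarrow> ennreal p * (ennreal q * x) = ennreal r * x"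
  by (auto simp: ennreal_mult mult.assoc)

context gaps
begin

text \<open>The step size \<open>h0\<close>, also used as the distance \<open>\<kappa>\<close> travelled inside the set, is a fixed fraction \<open>k\<close> of the
excess time. Each of the \<open>card L - 1\<close> multipliers contributes \<open>h0\<^sup>3\<close>, against \<open>h0\<close> from averaging on the
other side, and the time of passage contributes one more factor \<open>h0\<close>.\<close>

lemma high_frequency_observability:
  assumes fin: "finite L" and lam: "lam > 0" "\<And>\<nu>. \<nu> \<in> L \<Longrightarrow> lam \<le> \<bar>\<nu>\<bar>"
    and eps: "\<epsilon> > 0" and D: "D > 0"
  shows "\<exists>C>0. \<forall>T f j. G / lam < T \<longrightarrow> T \<le> G / lam + D \<longrightarrow> (\<forall>\<nu>. tame (f \<nu>)) \<longrightarrow> j \<in> L \<longrightarrow>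
    high_sq \<epsilon> (FT (f j))
      \<le> ennreal (C / (T - G / lam) ^ (2 * card L - 1)) *
        energy T (shrink a b 0) (\<lambda>s x. \<Sum>\<nu>\<in>L. f \<nu> (x + \<nu> * s))"
proof -
  define r where "r = card L - 1"
  define M where "M = 1 + (\<Sum>\<nu>\<in>L. \<bar>\<nu>\<bar>)"
  have M: "\<bar>\<nu>\<bar> \<le> M" if "\<nu> \<in> L" for \<nu>
    using member_le_sum[of \<nu> L abs] that fin by (simp add: M_def)
  have M1: "M \<ge> 1" unfolding M_def by (simp add: sum_nonneg)
  obtain \<sigma> where \<sigma>: "\<sigma> > 0" "\<And>x y. x \<in> L \<Longrightarrow> y \<in> L \<Longrightarrow> x \<noteq> y \<Longrightarrow> \<sigma> \<le> \<bar>x - y\<bar>"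
    using separated_finite_set[OF fin] by blast
  define q where "q = 2 * real r * M"
  have q: "q \<ge> 0" using M1 by (simp add: q_def)
  \<comment> \<open>the three bounds leave enough time, enough room inside the intervals, and make \<open>h0 \<le> 1\<close>\<close>
  define k where "k = min (lam / (lam * real r + q + 2)) (min (l / ((q + 1) * D)) (1 / D))"
  have den: "lam * real r + q + 2 > 0" using q lam by (simp add: add_nonneg_pos)
  have k: "k > 0" using lam D l_pos q den by (simp add: k_def)
  define c where "c = min ((\<sigma> * \<epsilon>)\<^sup>2) 1 / 5"
  have c: "c > 0" using \<sigma> eps by (simp add: c_def)
  define C where "C = 2 * pi * M * 4 ^ r / (c ^ r * k ^ (2 * r + 1))"
  have C0: "C > 0" using M1 c k by (simp add: C_def)
  have main: "high_sq \<epsilon> (FT (f j))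
      \<le> ennreal (C / (T - G / lam) ^ (2 * card L - 1)) *
        energy T (shrink a b 0) (\<lambda>s x. \<Sum>\<nu>\<in>L. f \<nu> (x + \<nu> * s))"
    if T: "G / lam < T" "T \<le> G / lam + D" and f: "\<And>\<nu>. tame (f \<nu>)" and j: "j \<in> L" for T f j
  proof -
    define \<delta> where "\<delta> = T - G / lam"
    have \<delta>: "0 < \<delta>" "\<delta> \<le> D" using T by (auto simp: \<delta>_def)
    define h0 where "h0 = k * \<delta>"
    have h0: "0 < h0" using k \<delta> by (simp add: h0_def)
    have h1: "(lam * real r + q + 2) * h0 \<le> lam * \<delta>"
    proof -
      have "(lam * real r + q + 2) * k \<le> (lam * real r + q + 2) * (lam / (lam * real r + q + 2))"
        using den by (intro mult_left_mono) (auto simp: k_def)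
      also have "\<dots> = lam" using den by simp
      finally show ?thesis using mult_right_mono[of _ lam \<delta>] \<delta> by (simp add: h0_def mult.assoc)
    qed
    have h2: "(q + 1) * h0 \<le> l"
    proof -
      have "(q + 1) * (k * \<delta>) \<le> (q + 1) * (l / ((q + 1) * D) * D)"
        using q \<delta> D k l_pos by (intro mult_left_mono mult_mono) (auto simp: k_def)
      then show ?thesis using q D by (simp add: h0_def)
    qed
    have h3: "h0 \<le> 1"
    proof -
      have "k * \<delta> \<le> 1 / D * D"
        using \<delta> D k by (intro mult_mono) (auto simp: k_def)
      then show ?thesis using D by (simp add: h0_def)
    qed
    obtain \<mu>s where \<mu>s: "set \<mu>s = L - {j}" "distinct \<mu>s"
      using finite_distinct_list[of "L - {j}"] fin by auto
    have len': "length \<mu>s = r"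
      using distinct_card[OF \<mu>s(2)] \<mu>s(1) j fin by (simp add: r_def)
    have setL: "set (j # \<mu>s) = L" using \<mu>s j by auto
    have card: "2 * card L - 1 = 2 * r + 1"
      using j fin card_gt_0_iff[of L] unfolding r_def by auto
    let ?E = "energy T (shrink a b 0) (\<lambda>s x. \<Sum>\<nu>\<in>L. f \<nu> (x + \<nu> * s))"
    have rh: "2 * (0 + real (length \<mu>s) * (M * h0)) = q * h0"
      by (simp add: len' q_def)
    have iso: "ennreal (h0 / \<bar>j\<bar>) * (\<integral>\<^sup>+\<xi>. ennreal ((cmod (FT (f j) \<xi>))\<^sup>2) *
            prod_list (map (\<lambda>\<mu>. multiplier ((j - \<mu>) * \<xi>) h0) \<mu>s) \<partial>lborel)
      \<le> ennreal (2 * pi) * ennreal (4 * h0) ^ length \<mu>s *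
        energy T (shrink a b 0) (\<lambda>s x. \<Sum>\<nu>\<in>set (j # \<mu>s). f \<nu> (x + \<nu> * s))"
    proof (rule isolate_wave[where \<rho> = "M * h0"])
      show "distinct (j # \<mu>s)" using \<mu>s by auto
      show "j \<noteq> 0" using lam j by fastforce
      show "0 \<le> M * h0" using M1 h0 by simp
      show "\<bar>\<mu>\<bar> * h0 \<le> M * h0" if "\<mu> \<in> set \<mu>s" for \<mu>
        using that \<mu>s M h0 by (intro mult_right_mono) auto
      show "h0 \<le> l - 2 * (0 + real (length \<mu>s) * (M * h0))"
        using h2 unfolding rh by (simp add: algebra_simps)
      have "lam * (T - real r * h0) = G + lam * \<delta> - lam * real r * h0"
        using lam(1) by (simp add: \<delta>_def field_simps)
      then have *: "G + q * h0 + 2 * h0 \<le> lam * (T - real r * h0)"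
        using h1 by (simp add: algebra_simps)
      have "G > 0" using gap[of 0] disj[of 0] by linarith
      then have "0 \<le> lam * (T - real r * h0)" using * q h0 by (intro order_trans[OF _ *]) simp
      then have "0 \<le> T - real r * h0" using lam(1) by (simp add: zero_le_mult_iff)
      then have "lam * (T - real r * h0) \<le> \<bar>j\<bar> * (T - real r * h0)"
        using lam(2)[OF j] by (intro mult_right_mono)
      then show "G + 2 * (0 + real (length \<mu>s) * (M * h0)) + 2 * h0 \<le> \<bar>j\<bar> * (T - real (length \<mu>s) * h0)"
        using * unfolding rh unfolding len' by linarith
    qed (use f h0 in auto)
    let ?H = "high_sq \<epsilon> (FT (f j))"
    have [measurable]: "FT (f j) \<in> borel_measurable borel" using FT_measurable[OF f] .
    have "ennreal ((c * h0 ^ 3) ^ r) * ?H =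
      (\<integral>\<^sup>+\<xi>. ennreal ((c * h0 ^ 3) ^ r) * (indicator {\<xi>. \<epsilon> \<le> \<bar>\<xi>\<bar>} \<xi> * ennreal ((cmod (FT (f j) \<xi>))\<^sup>2)) \<partial>lborel)"
      by (rule nn_integral_cmult[symmetric]) measurable
    also have "\<dots> \<le> (\<integral>\<^sup>+\<xi>. ennreal ((cmod (FT (f j) \<xi>))\<^sup>2) *
            prod_list (map (\<lambda>\<mu>. multiplier ((j - \<mu>) * \<xi>) h0) \<mu>s) \<partial>lborel)"
    proof (rule nn_integral_mono)
      fix \<xi>
      have "ennreal ((c * h0 ^ 3) ^ r) \<le> prod_list (map (\<lambda>\<mu>. multiplier ((j - \<mu>) * \<xi>) h0) \<mu>s)" if "\<epsilon> \<le> \<bar>\<xi>\<bar>"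
      proof -
        have "ennreal (c * h0 ^ 3) \<le> multiplier ((j - \<mu>) * \<xi>) h0" if "\<mu> \<in> set \<mu>s" for \<mu>
          unfolding c_def
        proof (rule multiplier_lower_bound[OF h0 h3])
          show "0 < \<sigma> * \<epsilon>" using \<sigma> eps by simp
          show "\<sigma> * \<epsilon> \<le> \<bar>(j - \<mu>) * \<xi>\<bar>"
            unfolding abs_mult using \<sigma> eps j that \<mu>s \<open>\<epsilon> \<le> \<bar>\<xi>\<bar>\<close> by (intro mult_mono) auto
        qed
        then have "ennreal (c * h0 ^ 3) ^ length \<mu>s \<le> prod_list (map (\<lambda>\<mu>. multiplier ((j - \<mu>) * \<xi>) h0) \<mu>s)"
          by (rule prod_list_map_ge_power)
        then show ?thesis using c h0 by (simp add: len' ennreal_power)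
      qed
      then show "ennreal ((c * h0 ^ 3) ^ r) * (indicator {\<xi>. \<epsilon> \<le> \<bar>\<xi>\<bar>} \<xi> * ennreal ((cmod (FT (f j) \<xi>))\<^sup>2))
         \<le> ennreal ((cmod (FT (f j) \<xi>))\<^sup>2) * prod_list (map (\<lambda>\<mu>. multiplier ((j - \<mu>) * \<xi>) h0) \<mu>s)"
        by (auto simp: indicator_def mult.commute intro!: mult_left_mono)
    qed
    finally have iso': "ennreal (h0 / \<bar>j\<bar>) * (ennreal ((c * h0 ^ 3) ^ r) * ?H) \<le>
       ennreal (2 * pi) * ennreal (4 * h0) ^ r * ?E"
      using iso unfolding setL len' by (meson mult_left_mono order_trans zero_le)
    have jpos: "\<bar>j\<bar> > 0" using lam j by fastforce
    have "ennreal (h0 / \<bar>j\<bar> * (c * h0 ^ 3) ^ r) * ?H \<le> ennreal (2 * pi * (4 * h0) ^ r) * ?E"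
    proof -
      have "ennreal (h0 / \<bar>j\<bar> * (c * h0 ^ 3) ^ r) = ennreal (h0 / \<bar>j\<bar>) * ennreal ((c * h0 ^ 3) ^ r)"
        using h0 c by (intro ennreal_mult) auto
      moreover have "ennreal (2 * pi * (4 * h0) ^ r) = ennreal (2 * pi) * ennreal (4 * h0) ^ r"
        using h0 by (subst ennreal_mult) (auto simp only: ennreal_power, auto)
      ultimately show ?thesis
        using iso' by (simp only: mult.assoc)
    qed
    then have "?H \<le> ennreal (1 / (h0 / \<bar>j\<bar> * (c * h0 ^ 3) ^ r)) * (ennreal (2 * pi * (4 * h0) ^ r) * ?E)"
      using h0 c jpos by (intro ennreal_le_of_mult_le) auto
    also have "\<dots> = ennreal (1 / (h0 / \<bar>j\<bar> * (c * h0 ^ 3) ^ r) * (2 * pi * (4 * h0) ^ r)) * ?E"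
      using h0 c jpos by (subst ennreal_mult) (auto simp: mult.assoc)
    also have "\<dots> \<le> ennreal (C / \<delta> ^ (2 * r + 1)) * ?E"
    proof (intro mult_right_mono ennreal_leI)
      have "1 / (h0 / \<bar>j\<bar> * (c * h0 ^ 3) ^ r) * (2 * pi * (4 * h0) ^ r)
         = 2 * pi * \<bar>j\<bar> * 4 ^ r / (c ^ r * h0 ^ (2 * r + 1))"
      proof -
        have "(c * h0 ^ 3) ^ r = c ^ r * (h0 ^ (2 * r) * h0 ^ r)"
          by (simp add: power_mult_distrib power_mult[symmetric] power_add[symmetric])
        moreover have "1 / (h / J * (c' * (X * Y))) * (2 * pi * (F * Y)) = 2 * pi * J * F / (c' * (X * h))"
          if "0 < h" "0 < J" "0 < c'" "0 < X" "0 < Y" for h J c' X Y F :: real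
          using that by (simp add: field_simps)
        ultimately show ?thesis
          using h0 c jpos by (simp add: power_mult_distrib)
      qed
      also have "\<dots> \<le> 2 * pi * M * 4 ^ r / (c ^ r * h0 ^ (2 * r + 1))"
        using h0 c M[OF j] by (intro divide_right_mono mult_right_mono mult_left_mono) auto
      also have "\<dots> = C / \<delta> ^ (2 * r + 1)"
        by (simp only: C_def h0_def power_mult_distrib divide_divide_eq_left mult.assoc)
      finally show "1 / (h0 / \<bar>j\<bar> * (c * h0 ^ 3) ^ r) * (2 * pi * (4 * h0) ^ r) \<le> C / \<delta> ^ (2 * r + 1)" .
    qed auto
    finally show ?thesis unfolding card \<delta>_def .
  qed
  show ?thesis
  proof (rule exI[of _ C], intro conjI allI impI)
    fix T j :: real and f :: "real \<Rightarrow> real \<Rightarrow> complex"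
    assume "G / lam < T" "T \<le> G / lam + D" "\<forall>\<nu>. tame (f \<nu>)" "j \<in> L"
    then show "high_sq \<epsilon> (FT (f j))
      \<le> ennreal (C / (T - G / lam) ^ (2 * card L - 1)) *
        energy T (shrink a b 0) (\<lambda>s x. \<Sum>\<nu>\<in>L. f \<nu> (x + \<nu> * s))"
      by (intro main) simp_all
  qed (rule C0)
qed

text \<open>Starting from a point of a gap, steps to the left of length less than \<open>l\<close> cannot jump over the preceding interval.\<close>

lemma reaches_set:
  assumes "\<eta> > 0" "\<eta> < l" "G \<le> real N * \<eta>"
  shows "\<exists>k\<le>Suc N. x - real k * \<eta> \<in> shrink a b 0"
proof -
  obtain n where n: "b n \<le> x" "x < b (n + 1)" using crossing by blast
  show ?thesis
  proof (cases "a (n + 1) < x")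
    case True
    then have "x - real 0 * \<eta> \<in> shrink a b 0" using n by (auto simp: shrink_def)
    then show ?thesis by blast
  next
    case False
    define k where "k = nat \<lfloor>(x - b n) / \<eta>\<rfloor>"
    have fl: "\<lfloor>(x - b n) / \<eta>\<rfloor> \<ge> 0" using n assms by simp
    then have k: "real k \<le> (x - b n) / \<eta>" "(x - b n) / \<eta> < real k + 1"
      unfolding k_def by linarith+
    then have k': "real k * \<eta> \<le> x - b n" "x - b n < (real k + 1) * \<eta>"
      using assms(1) by (auto simp: field_simps)
    have "real k * \<eta> \<le> real N * \<eta>" using k'(1) False gap[of n] assms by linarith
    then have "k \<le> N" using assms by simp
    moreover have "x - real (Suc k) * \<eta> \<in> {a n<..<b n}"
      using k' len[of n] assms by (auto simp: algebra_simps)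
    then have "x - real (Suc k) * \<eta> \<in> shrink a b 0" by (auto simp: shrink_def)
    ultimately show ?thesis by (intro exI[of _ "Suc k"]) auto
  qed
qed

text \<open>A form of the Logvinenko-Sereda inequality. At each point, \<open>g\<close> is bounded by its value at a translate in the set plus
the difference \<open>g - g(\<cdot> - k \<eta>)\<close> for one of finitely many \<open>k\<close>. By Plancherel the differences are small on
frequencies below \<open>\<epsilon>0\<close>, where they can be absorbed in the left-hand side, and bounded on the others.\<close>

lemma gap_filling:
  "\<exists>\<epsilon>0>0. \<exists>C>0. \<forall>g. tame g \<longrightarrow>
    l2_sq (FT g) \<le>
      ennreal C * (\<integral>\<^sup>+x. indicator (shrink a b 0) x * ennreal ((cmod (g x))\<^sup>2) \<partial>lborel) +
      ennreal C * high_sq \<epsilon>0 (FT g)"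
proof -
  define \<eta> where "\<eta> = l / 2"
  have \<eta>: "0 < \<eta>" "\<eta> < l" using l_pos by (auto simp: \<eta>_def)
  obtain N :: nat where N: "G \<le> real N * \<eta>"
    using reals_Archimedean3[OF \<eta>(1)] less_imp_le by metis
  define m where "m = real N + 2"
  have m: "m \<ge> 2" by (simp add: m_def)
  \<comment> \<open>chosen so that the low-frequency parts of the \<open>m\<close> differences amount to half of the left-hand side\<close>
  define \<epsilon>0 where "\<epsilon>0 = 1 / (2 * m * m * \<eta>)"
  have \<epsilon>0: "\<epsilon>0 > 0" using m \<eta> by (simp add: \<epsilon>0_def)
  let ?S = "shrink a b 0"
  define C where "C = 8 * pi * m + 16 * m"
  have C0: "C > 0" using m by (simp add: C_def add_pos_pos)
  have main: "l2_sq (FT g) \<le>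
      ennreal C * (\<integral>\<^sup>+x. indicator ?S x * ennreal ((cmod (g x))\<^sup>2) \<partial>lborel) +
      ennreal C * high_sq \<epsilon>0 (FT g)"
    if g: "tame g" for g
  proof -
    let ?P = "l2_sq (FT g)"
    let ?O = "\<integral>\<^sup>+x. indicator ?S x * ennreal ((cmod (g x))\<^sup>2) \<partial>lborel"
    let ?H = "high_sq \<epsilon>0 (FT g)"
    have [measurable]: "g \<in> borel_measurable borel" "FT g \<in> borel_measurable borel"
      using g by (auto intro: tame_measurable FT_measurable)
    define d where "d k x = g x - g (x + - (real k * \<eta>))" for k x
    have d: "tame (d k)" for k unfolding d_def by (intro tame_diff tame_shift g)
    have [measurable]: "d k \<in> borel_measurable borel" for k using tame_measurable[OF d] .
    have Pfin: "?P < \<infinity>"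
      using Plancherel[OF g] nn_integral_eq_integral[OF tame_square_integrable[OF g]]
      by (simp add: ennreal_mult_less_top)
    have pw: "ennreal ((cmod (g x))\<^sup>2) \<le> (\<Sum>k\<le>Suc N.
         2 * (indicator ?S (x + - (real k * \<eta>)) * ennreal ((cmod (g (x + - (real k * \<eta>))))\<^sup>2))
         + 2 * ennreal ((cmod (d k x))\<^sup>2))" (is "_ \<le> (\<Sum>k\<le>Suc N. ?t k)") for x
    proof -
      obtain k where k: "k \<le> Suc N" "x - real k * \<eta> \<in> ?S"
        using reaches_set[OF \<eta> N] by blast
      have "ennreal ((cmod (g x))\<^sup>2) \<le> ennreal (2 * (cmod (g (x + - (real k * \<eta>))))\<^sup>2 + 2 * (cmod (d k x))\<^sup>2)"
      proof (rule ennreal_leI)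
        have "g x = g (x + - (real k * \<eta>)) - (- d k x)" by (simp add: d_def)
        then show "(cmod (g x))\<^sup>2 \<le> 2 * (cmod (g (x + - (real k * \<eta>))))\<^sup>2 + 2 * (cmod (d k x))\<^sup>2"
          using norm_diff_square_le[of "g (x + - (real k * \<eta>))" "- d k x"] by simp
      qed
      also have "\<dots> = ?t k" using k by (simp add: ennreal_mult)
      also have "\<dots> \<le> (\<Sum>k\<le>Suc N. ?t k)" using k by (intro member_le_sum) auto
      finally show ?thesis .
    qed
    have dk: "ennreal (2 * pi) * l2_sq (d k) \<le>
        ennreal (1 / (4 * m)) * ?P + 4 * ?H" if k: "k \<le> Suc N" for k
    proof -
      have F: "FT (d k) \<xi> = (1 - exp (\<i> * of_real (- (real k * \<eta>) * \<xi>))) * FT g \<xi>" for \<xi>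
      proof -
        have "FT (d k) \<xi> = FT g \<xi> - FT (\<lambda>x. g (x + - (real k * \<eta>))) \<xi>"
          unfolding d_def by (intro FT_diff tame_shift g)
        also have "\<dots> = FT g \<xi> - exp (\<i> * of_real (- (real k * \<eta>) * \<xi>)) * FT g \<xi>"
          by (simp only: FT_shift of_real_mult mult.assoc)
        finally show ?thesis by (simp only: left_diff_distrib mult_1)
      qed
      have b: "(cmod (1 - exp (\<i> * of_real t)))\<^sup>2 \<le> 4" "(cmod (1 - exp (\<i> * of_real t)))\<^sup>2 \<le> t\<^sup>2" for t
      proof -
        have "cmod (1 - exp (\<i> * of_real t)) \<le> cmod 1 + cmod (exp (\<i> * of_real t))"
          by (rule norm_triangle_ineq4)
        then have "(cmod (1 - exp (\<i> * of_real t)))\<^sup>2 \<le> 2\<^sup>2" by (intro power_mono) auto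
        then show "(cmod (1 - exp (\<i> * of_real t)))\<^sup>2 \<le> 4" by simp
        have "cmod (exp (\<i> * of_real t) - 1) \<le> \<bar>t\<bar>"
          using iexp_approx1[of t 0] by simp
        then have "(cmod (exp (\<i> * of_real t) - 1))\<^sup>2 \<le> \<bar>t\<bar>\<^sup>2" by (intro power_mono) auto
        then show "(cmod (1 - exp (\<i> * of_real t)))\<^sup>2 \<le> t\<^sup>2" by (simp add: norm_minus_commute)
      qed
      have mult: "(cmod (1 - exp (\<i> * of_real (- (real k * \<eta>) * \<xi>))))\<^sup>2 \<le> 1 / (4 * m) + 4 * indicator {\<xi>. \<epsilon>0 \<le> \<bar>\<xi>\<bar>} \<xi>" for \<xi>
      proof (cases "\<epsilon>0 \<le> \<bar>\<xi>\<bar>")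
        case True
        then show ?thesis using b(1)[of "- (real k * \<eta>) * \<xi>"] m
          by (intro order_trans[OF b(1)]) simp
      next
        case False
        have "(- (real k * \<eta>) * \<xi>)\<^sup>2 = (real k * \<eta> * \<bar>\<xi>\<bar>)\<^sup>2" by (simp add: power_mult_distrib)
        also have "\<dots> \<le> (m * \<eta> * \<epsilon>0)\<^sup>2"
          using False k \<eta> m \<epsilon>0 by (intro power_mono mult_mono) (auto simp: m_def)
        also have "\<dots> = 1 / (4 * m * m)"
          using m \<eta> by (simp add: \<epsilon>0_def power2_eq_square)
        also have "\<dots> \<le> 1 / (4 * m * 1)" using m by (intro divide_left_mono mult_left_mono) auto
        finally show ?thesis using False b(2)[of "- (real k * \<eta>) * \<xi>"] by simp
      qed
      have "ennreal (2 * pi) * l2_sq (d k) = l2_sq (FT (d k))"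
        by (rule Plancherel[OF d, symmetric])
      also have "\<dots> \<le> (\<integral>\<^sup>+\<xi>. ennreal (1 / (4 * m)) * ennreal ((cmod (FT g \<xi>))\<^sup>2)
          + 4 * (indicator {\<xi>. \<epsilon>0 \<le> \<bar>\<xi>\<bar>} \<xi> * ennreal ((cmod (FT g \<xi>))\<^sup>2)) \<partial>lborel)"
      proof (rule nn_integral_mono)
        fix \<xi>
        have "ennreal ((cmod (FT (d k) \<xi>))\<^sup>2) \<le> ennreal ((1 / (4 * m) + 4 * indicator {\<xi>. \<epsilon>0 \<le> \<bar>\<xi>\<bar>} \<xi>) * (cmod (FT g \<xi>))\<^sup>2)"
          unfolding F norm_mult power_mult_distrib by (intro ennreal_leI mult_right_mono mult) auto
        also have "\<dots> = ennreal (1 / (4 * m)) * ennreal ((cmod (FT g \<xi>))\<^sup>2)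
          + 4 * (indicator {\<xi>. \<epsilon>0 \<le> \<bar>\<xi>\<bar>} \<xi> * ennreal ((cmod (FT g \<xi>))\<^sup>2))"
        proof -
          have "ennreal ((p + 4 * i) * X) = ennreal p * ennreal X + 4 * (ennreal i * ennreal X)"
            if "0 \<le> p" "0 \<le> i" "0 \<le> X" for p i X :: real
            using that by (simp add: distrib_right ennreal_mult ennreal_plus mult.assoc)
          then show ?thesis using m by (simp add: ennreal_indicator)
        qed
        finally show "ennreal ((cmod (FT (d k) \<xi>))\<^sup>2) \<le> ennreal (1 / (4 * m)) * ennreal ((cmod (FT g \<xi>))\<^sup>2)
          + 4 * (indicator {\<xi>. \<epsilon>0 \<le> \<bar>\<xi>\<bar>} \<xi> * ennreal ((cmod (FT g \<xi>))\<^sup>2))" .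
      qed
      also have "\<dots> = ennreal (1 / (4 * m)) * ?P + 4 * ?H"
        by (simp add: nn_integral_add nn_integral_cmult)
      finally show ?thesis .
    qed
    have "?P = ennreal (2 * pi) * l2_sq g"
      by (rule Plancherel[OF g])
    also have "\<dots> \<le> ennreal (2 * pi) * (\<integral>\<^sup>+x. (\<Sum>k\<le>Suc N.
         2 * (indicator ?S (x + - (real k * \<eta>)) * ennreal ((cmod (g (x + - (real k * \<eta>))))\<^sup>2))
         + 2 * ennreal ((cmod (d k x))\<^sup>2)) \<partial>lborel)"
      by (intro mult_left_mono nn_integral_mono pw) auto
    also have "\<dots> = ennreal (2 * pi) * (\<Sum>k\<le>Suc N.
         2 * (\<integral>\<^sup>+x. indicator ?S (x + - (real k * \<eta>)) * ennreal ((cmod (g (x + - (real k * \<eta>))))\<^sup>2) \<partial>lborel)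
         + 2 * l2_sq (d k))"
      by (simp add: nn_integral_sum nn_integral_add nn_integral_cmult del: sum.atMost_Suc)
    also have "\<dots> = ennreal (2 * pi) * (\<Sum>k\<le>Suc N. 2 * ?O + 2 * l2_sq (d k))"
    proof -
      have "(\<integral>\<^sup>+x. indicator ?S (x + c) * ennreal ((cmod (g (x + c)))\<^sup>2) \<partial>lborel) = ?O" for c
        by (rule nn_integral_shift[of "\<lambda>x. indicator ?S x * ennreal ((cmod (g x))\<^sup>2)"]) measurable
      then show ?thesis by (simp only:)
    qed
    also have "\<dots> = (\<Sum>k\<le>Suc N. 2 * (ennreal (2 * pi) * ?O) + 2 * (ennreal (2 * pi) * l2_sq (d k)))"
      by (simp add: sum_distrib_left distrib_left mult.left_commute del: sum.atMost_Suc)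
    also have "\<dots> \<le> (\<Sum>k\<le>Suc N. 2 * (ennreal (2 * pi) * ?O) + 2 * (ennreal (1 / (4 * m)) * ?P + 4 * ?H))"
      by (intro sum_mono add_left_mono mult_left_mono dk) auto
    also have "\<dots> = ennreal m * (2 * (ennreal (2 * pi) * ?O) + 2 * (ennreal (1 / (4 * m)) * ?P + 4 * ?H))"
    proof -
      have "ennreal m = of_nat (Suc (Suc N))"
        unfolding ennreal_of_nat_eq_real_of_nat m_def by simp
      then show ?thesis by (simp only: sum_constant card_atMost)
    qed
    also have "\<dots> = ennreal (4 * pi * m) * ?O + ennreal (1 / 2) * ?P + ennreal (8 * m) * ?H"
    proof -
      have "2 * (ennreal (2 * pi) * ?O) = ennreal (4 * pi) * ?O" "2 * (4 * ?H) = ennreal 8 * ?H"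
        "2 * (ennreal (1 / (4 * m)) * ?P) = ennreal (1 / (2 * m)) * ?P"
        using m ennreal_mult_collapse[of 2 "2 * pi" "4 * pi" ?O] ennreal_mult_collapse[of 2 4 8 ?H]
          ennreal_mult_collapse[of 2 "1 / (4 * m)" "1 / (2 * m)" ?P] by auto
      moreover have "ennreal m * (ennreal (4 * pi) * ?O) = ennreal (4 * pi * m) * ?O"
        "ennreal m * (ennreal 8 * ?H) = ennreal (8 * m) * ?H"
        "ennreal m * (ennreal (1 / (2 * m)) * ?P) = ennreal (1 / 2) * ?P"
        by (rule ennreal_mult_collapse; use m in simp)+
      ultimately show ?thesis by (simp only: distrib_left add.assoc)
    qed
    finally have split: "?P \<le> ennreal (1 / 2) * ?P + (ennreal (4 * pi * m) * ?O + ennreal (8 * m) * ?H)"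
      by (simp add: ac_simps)
    \<comment> \<open>the term to be absorbed is finite since \<open>g\<close> is square integrable\<close>
    have absorb: "p \<le> 2 * y" if py: "p \<le> ennreal (1 / 2) * p + y" "p < \<infinity>" for p y :: ennreal
    proof (cases y)
      case (real y')
      obtain p' where p': "p = ennreal p'" "p' \<ge> 0" using py(2) by (cases p) auto
      have "ennreal (1 / 2 * p' + y') = ennreal (1 / 2 * p') + ennreal y'"
        using p' real by (intro ennreal_plus) auto
      moreover have "ennreal (1 / 2 * p') = ennreal (1 / 2) * ennreal p'"
        using p' by (intro ennreal_mult) auto
      ultimately have "ennreal p' \<le> ennreal (1 / 2 * p' + y')"
        using py(1) p' real by (simp only:)
      then have "p' \<le> 1 / 2 * p' + y'" using p' real by (subst (asm) ennreal_le_iff) auto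
      then have "p' \<le> 2 * y'" by simp
      then have "ennreal p' \<le> ennreal (2 * y')" by (rule ennreal_leI)
      then show ?thesis using p' real by (simp add: ennreal_mult)
    qed (simp add: ennreal_mult_top)
    have "?P \<le> 2 * (ennreal (4 * pi * m) * ?O + ennreal (8 * m) * ?H)"
      by (rule absorb[OF split Pfin])
    also have "\<dots> = ennreal (8 * pi * m) * ?O + ennreal (16 * m) * ?H"
    proof -
      have "2 * (ennreal (4 * pi * m) * ?O) = ennreal (8 * pi * m) * ?O"
        "2 * (ennreal (8 * m) * ?H) = ennreal (16 * m) * ?H"
        using m ennreal_mult_collapse[of 2 "4 * pi * m" "8 * pi * m" ?O] ennreal_mult_collapse[of 2 "8 * m" "16 * m" ?H] by auto
      then show ?thesis by (simp only: distrib_left)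
    qed
    also have "\<dots> \<le> ennreal C * ?O + ennreal C * ?H"
      using m by (intro add_mono mult_right_mono ennreal_leI) (auto simp: C_def)
    finally show ?thesis .
  qed
  show ?thesis
    by (rule exI[of _ \<epsilon>0], rule conjI[OF \<epsilon>0], rule exI[of _ C], rule conjI[OF C0]) (intro allI impI main)
qed

end

section \<open>Kalman layers\<close>

lemma orth_projector_eq:
  assumes "subspace V" "y \<in> V" "x - y \<in> V\<^sup>\<bottom>"
  shows "orth_projector V x = y"
  unfolding orth_projector_def
proof (rule the_equality)
  fix z assume z: "z \<in> V \<and> x - z \<in> V\<^sup>\<bottom>"
  have "y - z \<in> V\<^sup>\<bottom>"
    using subspace_diff[OF subspace_orthogonal_comp, of "x - z" V "x - y"] z assms(3) by simp
  moreover have "y - z \<in> V" using z assms by (intro subspace_diff) auto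
  ultimately have "orthogonal (y - z) (y - z)" by (simp add: orthogonal_comp_def)
  then show "z = y" by (simp add: orthogonal_self)
qed (use assms in auto)

lemma orth_projector:
  assumes "subspace V"
  shows "orth_projector V x \<in> V" "x - orth_projector V x \<in> V\<^sup>\<bottom>"
proof -
  obtain y z where yz: "y \<in> span V" "\<And>w. w \<in> span V \<Longrightarrow> orthogonal z w" "x = y + z"
    using orthogonal_subspace_decomp_exists[of V x] by metis
  then have "y \<in> V" "x - y \<in> V\<^sup>\<bottom>"
    using assms by (auto simp: span_eq_iff[THEN iffD2] orthogonal_comp_def orthogonal_commute)
  then show "orth_projector V x \<in> V" "x - orth_projector V x \<in> V\<^sup>\<bottom>"
    using orth_projector_eq[OF assms, of y x] by auto
qed

lemma linear_orth_projector:
  fixes V :: "(real^'n) set"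
  assumes "subspace V" shows "linear (orth_projector V)"
proof (rule linearI)
  fix x y :: "real^'n" and c :: real
  show "orth_projector V (x + y) = orth_projector V x + orth_projector V y"
  proof (rule orth_projector_eq[OF assms])
    show "orth_projector V x + orth_projector V y \<in> V"
      using orth_projector[OF assms] assms by (intro subspace_add) auto
    have "(x - orth_projector V x) + (y - orth_projector V y) \<in> V\<^sup>\<bottom>"
      using orth_projector[OF assms] by (intro subspace_add subspace_orthogonal_comp) auto
    then show "x + y - (orth_projector V x + orth_projector V y) \<in> V\<^sup>\<bottom>"
      by (simp add: algebra_simps)
  qed
  show "orth_projector V (c *\<^sub>R x) = c *\<^sub>R orth_projector V x"
  proof (rule orth_projector_eq[OF assms])
    show "c *\<^sub>R orth_projector V x \<in> V"
      using orth_projector[OF assms] assms by (intro subspace_mul) auto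
    have "c *\<^sub>R (x - orth_projector V x) \<in> V\<^sup>\<bottom>"
      using orth_projector[OF assms] by (intro subspace_mul subspace_orthogonal_comp) auto
    then show "c *\<^sub>R x - c *\<^sub>R orth_projector V x \<in> V\<^sup>\<bottom>"
      by (simp add: algebra_simps)
  qed
qed

lemma norm_orth_projector_le:
  assumes "subspace V" shows "norm (orth_projector V x) \<le> norm x"
proof -
  let ?p = "orth_projector V x"
  have "orthogonal ?p (x - ?p)"
    using orth_projector[OF assms, of x] by (auto simp: orthogonal_comp_def)
  then have "(norm (?p + (x - ?p)))\<^sup>2 = (norm ?p)\<^sup>2 + (norm (x - ?p))\<^sup>2"
    by (rule norm_add_Pythagorean)
  then have "(norm ?p)\<^sup>2 \<le> (norm x)\<^sup>2" by simp
  then show ?thesis by (rule power2_le_imp_le) simp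
qed

lemma subspace_kalman_range: "subspace (kalman_range A B k)"
  unfolding subspace_def
proof (intro conjI ballI allI)
  show "0 \<in> kalman_range A B k"
    unfolding kalman_range_def by (rule CollectI, rule exI[of _ "\<lambda>j. 0"]) simp
next
  fix x y assume "x \<in> kalman_range A B k" "y \<in> kalman_range A B k"
  then obtain u v where "x = (\<Sum>j\<le>k. pow_mult A j B *v u j)" "y = (\<Sum>j\<le>k. pow_mult A j B *v v j)"
    unfolding kalman_range_def by auto
  then have "x + y = (\<Sum>j\<le>k. pow_mult A j B *v (u j + v j))"
    by (simp add: matrix_vector_right_distrib sum.distrib)
  then show "x + y \<in> kalman_range A B k"
    unfolding kalman_range_def by (intro CollectI exI[of _ "\<lambda>j. u j + v j"]) simp
next
  fix c x assume "x \<in> kalman_range A B k"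
  then obtain u where "x = (\<Sum>j\<le>k. pow_mult A j B *v u j)"
    unfolding kalman_range_def by auto
  then have "c *\<^sub>R x = (\<Sum>j\<le>k. pow_mult A j B *v (c *\<^sub>R u j))"
    by (simp add: scaleR_sum_right linear_scale[OF matrix_vector_mul_linear])
  then show "c *\<^sub>R x \<in> kalman_range A B k"
    unfolding kalman_range_def by (intro CollectI exI[of _ "\<lambda>j. c *\<^sub>R u j"]) simp
qed

lemma kalman_range_mono:
  assumes "k \<le> k'" shows "kalman_range A B k \<subseteq> kalman_range A B k'"
proof
  fix x assume "x \<in> kalman_range A B k"
  then obtain u where "x = (\<Sum>j\<le>k. pow_mult A j B *v u j)"
    unfolding kalman_range_def by auto
  also have "\<dots> = (\<Sum>j\<le>k'. pow_mult A j B *v (if j \<le> k then u j else 0))"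
    using assms by (intro sum.mono_neutral_cong_left) auto
  finally show "x \<in> kalman_range A B k'"
    unfolding kalman_range_def by (intro CollectI exI[of _ "\<lambda>j. if j \<le> k then u j else 0"]) simp
qed

lemma mult_in_kalman_range:
  assumes "j \<le> k" shows "pow_mult A j B *v u \<in> kalman_range A B k"
proof -
  have "pow_mult A j B *v u = (\<Sum>i\<le>k. pow_mult A i B *v (if i = j then u else 0))"
    using assms by (subst sum.remove[of _ j]) (auto intro!: sum.neutral)
  then show ?thesis
    unfolding kalman_range_def by (intro CollectI exI[of _ "\<lambda>i. if i = j then u else 0"]) simp
qed

lemma subspace_kalman_layer: "subspace (kalman_layer A B k)"
  unfolding kalman_layer_def
  by (intro subspace_inter subspace_kalman_range subspace_orthogonal_comp)

lemma kalman_layers_orthogonal: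
  assumes "x \<in> kalman_layer A B i" "y \<in> kalman_layer A B k" "i \<noteq> k"
  shows "orthogonal x y"
proof -
  have *: "orthogonal x y" if "x \<in> kalman_layer A B i" "y \<in> kalman_layer A B k" "i < k" for x y i k
  proof -
    have "i \<le> k - 1" using that by simp
    then have "kalman_range A B i \<subseteq> kalman_range A B (k - 1)" by (rule kalman_range_mono)
    moreover have "x \<in> kalman_range A B i" using that by (simp add: kalman_layer_def)
    ultimately have "x \<in> kalman_range A B (k - 1)" by (rule subsetD)
    then show ?thesis using that by (auto simp: kalman_layer_def orthogonal_comp_def)
  qed
  show ?thesis
    using assms *[of x i y k] *[of y k x i] by (cases "i < k") (auto simp: orthogonal_commute)
qed

text \<open>Peel off the last layer: the part of \<open>x\<close> orthogonal to the previous range lies in the last layer.\<close>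

lemma kalman_range_decompose:
  "x \<in> kalman_range A B k \<Longrightarrow> \<exists>y. (\<forall>i\<le>k. y i \<in> kalman_layer A B i) \<and> x = (\<Sum>i\<le>k. y i)"
proof (induction k arbitrary: x)
  case 0
  then show ?case by (intro exI[of _ "\<lambda>i. x"]) (auto simp: kalman_layer_def)
next
  case (Suc k)
  define z where "z = orth_projector (kalman_range A B k) x"
  have z: "z \<in> kalman_range A B k" "x - z \<in> (kalman_range A B k)\<^sup>\<bottom>"
    unfolding z_def using orth_projector[OF subspace_kalman_range] by auto
  obtain y where y: "\<forall>i\<le>k. y i \<in> kalman_layer A B i" "z = (\<Sum>i\<le>k. y i)"
    using Suc.IH[OF z(1)] by blast
  have "x - z \<in> kalman_range A B (Suc k)"
    using z(1) kalman_range_mono[of k "Suc k" A B] Suc.prems by (intro subspace_diff subspace_kalman_range) auto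
  then have "x - z \<in> kalman_layer A B (Suc k)"
    using z(2) by (simp add: kalman_layer_def)
  then show ?case using y
    by (intro exI[of _ "y(Suc k := x - z)"]) (auto simp: le_Suc_eq)
qed

lemma kalman_range_full:
  fixes A :: "real^'n^'n"
  assumes "kalman_index A B K" shows "kalman_range A B K = UNIV"
proof -
  have "dim (kalman_range A B K) = DIM(real^'n)"
    using assms by (simp add: kalman_index_def kalman_rank_def)
  then have "span (kalman_range A B K) = UNIV" by (simp only: dim_eq_full)
  then show ?thesis using subspace_kalman_range[of A B K] by (simp add: span_eq_iff[THEN iffD2])
qed

lemma kalman_layers_decompose:
  assumes "kalman_index A B K"
  shows "(\<Sum>k\<le>K. orth_projector (kalman_layer A B k) x) = x"
proof -
  obtain y where y: "\<And>i. i \<le> K \<Longrightarrow> y i \<in> kalman_layer A B i" "x = (\<Sum>i\<le>K. y i)"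
    using kalman_range_decompose[of x A B K] kalman_range_full[OF assms] by auto
  have "orth_projector (kalman_layer A B k) x = y k" if "k \<le> K" for k
  proof (rule orth_projector_eq[OF subspace_kalman_layer])
    show "y k \<in> kalman_layer A B k" using y that by auto
    have "x - y k = (\<Sum>i\<in>{..K} - {k}. y i)" using that by (simp add: y(2) sum.remove[of _ k])
    also have "\<dots> \<in> (kalman_layer A B k)\<^sup>\<bottom>"
      using y by (intro subspace_sum subspace_orthogonal_comp)
        (auto simp: orthogonal_comp_def intro!: kalman_layers_orthogonal)
    finally show "x - y k \<in> (kalman_layer A B k)\<^sup>\<bottom>" .
  qed
  then show ?thesis using y(2) by simp
qed

text \<open>The projectors of \<open>kalman_projector\<close> act separately on real and imaginary parts, and so do matrices with real
entries; complex statements are therefore reduced to real ones by these two maps.\<close>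

definition re_vec :: "complex^'n \<Rightarrow> real^'n" where "re_vec v = (\<chi> i. Re (v $ i))"
definition im_vec :: "complex^'n \<Rightarrow> real^'n" where "im_vec v = (\<chi> i. Im (v $ i))"

lemma norm_sq_vec: "(norm (v :: 'a::real_normed_vector^'n))\<^sup>2 = (\<Sum>i\<in>UNIV. (norm (v $ i))\<^sup>2)"
  by (simp add: norm_vec_def L2_set_def sum_nonneg)

lemma norm_sq_re_im: "(norm v)\<^sup>2 = (norm (re_vec v))\<^sup>2 + (norm (im_vec v))\<^sup>2"
  by (simp add: norm_sq_vec re_vec_def im_vec_def cmod_power2 sum.distrib)

lemma re_im_mult:
  "re_vec (complex_mat M *v v) = M *v re_vec v" "im_vec (complex_mat M *v v) = M *v im_vec v"
  by (simp_all add: vec_eq_iff re_vec_def im_vec_def matrix_vector_mult_def Re_sum Im_sum)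

lemma re_im_projector:
  "re_vec (kalman_projector A B k v) = orth_projector (kalman_layer A B k) (re_vec v)"
  "im_vec (kalman_projector A B k v) = orth_projector (kalman_layer A B k) (im_vec v)"
  by (simp_all add: vec_eq_iff re_vec_def im_vec_def kalman_projector_def)

lemma re_im_eqI: "re_vec v = re_vec w \<Longrightarrow> im_vec v = im_vec w \<Longrightarrow> v = w"
  by (auto simp: vec_eq_iff re_vec_def im_vec_def complex_eq_iff)

lemma re_im_sum: "re_vec (\<Sum>i\<in>I. f i) = (\<Sum>i\<in>I. re_vec (f i))" "im_vec (\<Sum>i\<in>I. f i) = (\<Sum>i\<in>I. im_vec (f i))"
  by (simp_all add: vec_eq_iff re_vec_def im_vec_def Re_sum Im_sum)

lemma norm_kalman_projector_le: "norm (kalman_projector A B k v) \<le> norm v"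
proof -
  have "(norm (kalman_projector A B k v))\<^sup>2 \<le> (norm v)\<^sup>2"
    unfolding norm_sq_re_im[of v] norm_sq_re_im[of "kalman_projector A B k v"] re_im_projector
    by (intro add_mono power_mono norm_orth_projector_le subspace_kalman_layer) auto
  then show ?thesis by (rule power2_le_imp_le) simp
qed

lemma kalman_projector_sum:
  assumes "kalman_index A B K"
  shows "(\<Sum>k\<le>K. kalman_projector A B k v) = v"
  by (rule re_im_eqI) (simp_all add: re_im_sum re_im_projector kalman_layers_decompose[OF assms])

lemma kalman_projector_add: "kalman_projector A B k (v + w) = kalman_projector A B k v + kalman_projector A B k w"
proof -
  have a: "re_vec (x + y) = re_vec x + re_vec y" "im_vec (x + y) = im_vec x + im_vec y" for x y :: "complex^'k"
    by (simp_all add: re_vec_def im_vec_def vec_eq_iff)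
  show ?thesis
    by (rule re_im_eqI) (simp_all add: a re_im_projector linear_add[OF linear_orth_projector[OF subspace_kalman_layer]])
qed

text \<open>The right-hand side is a continuous quadratic form without zeros on the unit sphere of \<open>V\<close>, which is compact.\<close>

lemma injective_family_bound:
  fixes L :: "nat \<Rightarrow> 'a::euclidean_space \<Rightarrow> 'b::euclidean_space"
  assumes V: "subspace V" and L: "\<And>r. linear (L r)" and fin: "finite I"
    and inj: "\<And>x. x \<in> V \<Longrightarrow> (\<And>r. r \<in> I \<Longrightarrow> L r x = 0) \<Longrightarrow> x = 0"
  shows "\<exists>c>0. \<forall>x\<in>V. c * (norm x)\<^sup>2 \<le> (\<Sum>r\<in>I. (norm (L r x))\<^sup>2)"
proof -
  define Q where "Q x = (\<Sum>r\<in>I. (norm (L r x))\<^sup>2)" for x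
  have scale: "Q (t *\<^sub>R x) = t\<^sup>2 * Q x" for t x
    by (simp add: Q_def linear_scale[OF L] power_mult_distrib sum_distrib_left)
  show ?thesis
  proof (cases "sphere 0 1 \<inter> V = {}")
    case True
    have V0: "x = 0" if "x \<in> V" for x
    proof (rule ccontr)
      assume "x \<noteq> 0"
      then have "(1 / norm x) *\<^sub>R x \<in> sphere 0 1 \<inter> V" using that V by (auto intro: subspace_mul)
      then show False using True by auto
    qed
    then have "1 * (norm x)\<^sup>2 \<le> (\<Sum>r\<in>I. (norm (L r x))\<^sup>2)" if "x \<in> V" for x
      using V0[OF that] sum_nonneg[of I "\<lambda>r. (norm (L r x))\<^sup>2"] by simp
    then show ?thesis by (intro exI[of _ 1]) simp
  next
    case False
    have "compact (sphere 0 1 \<inter> V)" using V by (intro compact_Int_closed compact_sphere closed_subspace)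
    moreover have "continuous_on (sphere 0 1 \<inter> V) Q"
      unfolding Q_def using L linear_conv_bounded_linear by (intro continuous_intros linear_continuous_on) blast
    ultimately obtain x0 where x0: "x0 \<in> sphere 0 1 \<inter> V" "\<And>x. x \<in> sphere 0 1 \<inter> V \<Longrightarrow> Q x0 \<le> Q x"
      using continuous_attains_inf[of "sphere 0 1 \<inter> V" Q] False by blast
    have "Q x0 \<noteq> 0"
    proof
      assume "Q x0 = 0"
      then have "\<And>r. r \<in> I \<Longrightarrow> L r x0 = 0" using fin by (simp add: Q_def sum_nonneg_eq_0_iff)
      then have "x0 = 0" using inj x0(1) by auto
      then show False using x0(1) by simp
    qed
    then have pos: "Q x0 > 0" unfolding Q_def by (simp add: sum_nonneg less_le)
    have "Q x0 * (norm x)\<^sup>2 \<le> Q x" if "x \<in> V" for x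
    proof (cases "x = 0")
      case False
      have "(1 / norm x) *\<^sub>R x \<in> sphere 0 1 \<inter> V" using False that V by (auto intro: subspace_mul)
      then have "Q x0 \<le> Q ((1 / norm x) *\<^sub>R x)" by (rule x0(2))
      then show ?thesis unfolding scale using False by (simp add: field_simps)
    qed (simp add: Q_def sum_nonneg)
    then show ?thesis using pos by (intro exI[of _ "Q x0"]) (auto simp: Q_def)
  qed
qed

lemma injective_family_bound_complex:
  fixes M :: "nat \<Rightarrow> real^'n^'m"
  assumes V: "subspace V" and fin: "finite I"
    and inj: "\<And>x. x \<in> V \<Longrightarrow> (\<And>r. r \<in> I \<Longrightarrow> M r *v x = 0) \<Longrightarrow> x = 0"
  shows "\<exists>c>0. \<forall>v. re_vec v \<in> V \<longrightarrow> im_vec v \<in> V \<longrightarrow>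
    c * (norm v)\<^sup>2 \<le> (\<Sum>r\<in>I. (norm (complex_mat (M r) *v v))\<^sup>2)"
proof -
  obtain c where c: "c > 0" "\<And>x. x \<in> V \<Longrightarrow> c * (norm x)\<^sup>2 \<le> (\<Sum>r\<in>I. (norm (M r *v x))\<^sup>2)"
    using injective_family_bound[of V "\<lambda>r x. M r *v x" I] assms by auto
  have "c * (norm v)\<^sup>2 \<le> (\<Sum>r\<in>I. (norm (complex_mat (M r) *v v))\<^sup>2)"
    if "re_vec v \<in> V" "im_vec v \<in> V" for v
    using c(2)[OF that(1)] c(2)[OF that(2)]
    unfolding norm_sq_re_im[of v] norm_sq_re_im[of "complex_mat _ *v v"] re_im_mult
    by (simp add: sum.distrib distrib_left)
  then show ?thesis using c(1) by blast
qed

text \<open>The vector \<open>(A\<^sup>r B)\<^sup>T v = B\<^sup>T (A\<^sup>T)\<^sup>r v\<close>, which is the \<open>r\<close>-th Taylor coefficient of the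
observation of \<open>v\<close>, up to a scalar.\<close>

definition obs :: "real^'n^'n \<Rightarrow> real^'m^'n \<Rightarrow> nat \<Rightarrow> complex^'n \<Rightarrow> complex^'m" where
  "obs A B r v = complex_mat (transpose (pow_mult A r B)) *v v"

text \<open>Links the kernels of the observation matrices with orthogonality to the Kalman ranges.\<close>

lemma transpose_mult_orthogonal:
  "transpose M *v x = (0 :: real^'m) \<longleftrightarrow> (\<forall>u. orthogonal (M *v u) x)"
proof -
  have eq: "orthogonal (M *v u) x \<longleftrightarrow> orthogonal u (transpose M *v x)" for u
    unfolding orthogonal_def transpose_matrix_vector
    using dot_lmul_matrix[of x M u] by (simp add: inner_commute)
  show ?thesis
  proof
    assume "transpose M *v x = 0"
    then show "\<forall>u. orthogonal (M *v u) x" unfolding eq by (simp only: orthogonal_def inner_zero_right simp_thms)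
  next
    assume "\<forall>u. orthogonal (M *v u) x"
    then have "orthogonal (transpose M *v x) (transpose M *v x)" unfolding eq by blast
    then show "transpose M *v x = 0" by (simp only: orthogonal_self)
  qed
qed

lemma obs_full_rank:
  fixes A :: "real^'n^'n"
  assumes "kalman_index A B K"
  shows "\<exists>c>0. \<forall>v. c * (norm v)\<^sup>2 \<le> (\<Sum>r\<le>K. (norm (obs A B r v))\<^sup>2)"
proof -
  have "\<exists>c>0. \<forall>v. re_vec v \<in> UNIV \<longrightarrow> im_vec v \<in> UNIV \<longrightarrow>
    c * (norm v)\<^sup>2 \<le> (\<Sum>r\<in>{..K}. (norm (complex_mat (transpose (pow_mult A r B)) *v v))\<^sup>2)"
  proof (rule injective_family_bound_complex)
    fix x :: "real^'n"
    assume 0: "\<And>r. r \<in> {..K} \<Longrightarrow> transpose (pow_mult A r B) *v x = 0"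
    have "x \<in> kalman_range A B K" using kalman_range_full[OF assms] by simp
    then obtain u where u: "x = (\<Sum>j\<le>K. pow_mult A j B *v u j)"
      unfolding kalman_range_def by auto
    have "orthogonal (pow_mult A j B *v u j) x" if "j \<in> {..K}" for j
      using 0[OF that] unfolding transpose_mult_orthogonal by blast
    then have "orthogonal (\<Sum>j\<le>K. pow_mult A j B *v u j) x"
      by (intro orthogonal_lvsum) auto
    then have "orthogonal x x"
      unfolding u[symmetric] .
    then show "x = 0" by (simp add: orthogonal_self)
  qed auto
  then show ?thesis unfolding obs_def by simp
qed

text \<open>A vector of the layer that is killed by \<open>(A\<^sup>r B)\<^sup>T\<close> is orthogonal to the range of \<open>A\<^sup>r B\<close> and, being
in the layer, to the previous Kalman range; so it is orthogonal to the Kalman range that contains it.\<close>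

lemma obs_layer:
  fixes A :: "real^'n^'n"
  shows "\<exists>c>0. \<forall>v. c * (norm (kalman_projector A B r v))\<^sup>2 \<le> (norm (obs A B r (kalman_projector A B r v)))\<^sup>2"
proof -
  have "\<exists>c>0. \<forall>v. re_vec v \<in> kalman_layer A B r \<longrightarrow> im_vec v \<in> kalman_layer A B r \<longrightarrow>
    c * (norm v)\<^sup>2 \<le> (\<Sum>s\<in>{r}. (norm (complex_mat (transpose (pow_mult A s B)) *v v))\<^sup>2)"
  proof (rule injective_family_bound_complex)
    show "subspace (kalman_layer A B r)" by (rule subspace_kalman_layer)
    fix x :: "real^'n"
    assume x: "x \<in> kalman_layer A B r" and z: "\<And>s. s \<in> {r} \<Longrightarrow> transpose (pow_mult A s B) *v x = 0"
    have 0: "orthogonal (pow_mult A r B *v u) x" for u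
      using z[of r] unfolding transpose_mult_orthogonal by blast
    have 1: "orthogonal (pow_mult A j B *v u) x" if "j < r" for j u
      using x that mult_in_kalman_range[of j "r - 1" A B u]
      by (auto simp: kalman_layer_def orthogonal_comp_def)
    have "x \<in> kalman_range A B r" using x by (simp add: kalman_layer_def)
    then obtain u where u: "x = (\<Sum>j\<le>r. pow_mult A j B *v u j)"
      unfolding kalman_range_def by auto
    have "orthogonal (pow_mult A j B *v u j) x" if "j \<in> {..r}" for j
      using 0 1 that by (cases "j = r") auto
    then have "orthogonal (\<Sum>j\<le>r. pow_mult A j B *v u j) x"
      by (intro orthogonal_lvsum) auto
    then have "orthogonal x x" unfolding u[symmetric] .
    then show "x = 0" by (simp add: orthogonal_self)
  qed auto
  then obtain c where "c > 0" "\<And>v. re_vec v \<in> kalman_layer A B r \<Longrightarrow> im_vec v \<in> kalman_layer A B r \<Longrightarrow>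
    c * (norm v)\<^sup>2 \<le> (norm (obs A B r v))\<^sup>2"
    by (auto simp: obs_def)
  moreover have "re_vec (kalman_projector A B r v) \<in> kalman_layer A B r"
    "im_vec (kalman_projector A B r v) \<in> kalman_layer A B r" for v
    unfolding re_im_projector by (intro orth_projector subspace_kalman_layer)+
  ultimately show ?thesis by blast
qed

lemma obs_higher_layer_zero:
  assumes "r < k" shows "obs A B r (kalman_projector A B k v) = 0"
proof -
  have *: "transpose (pow_mult A r B) *v x = 0" if "x \<in> kalman_layer A B k" for x
    unfolding transpose_mult_orthogonal
  proof
    fix u
    have "r \<le> k - 1" using assms by simp
    then have "pow_mult A r B *v u \<in> kalman_range A B (k - 1)" by (rule mult_in_kalman_range)
    then show "orthogonal (pow_mult A r B *v u) x"
      using that assms by (auto simp: kalman_layer_def orthogonal_comp_def)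
  qed
  show ?thesis
  proof (rule re_im_eqI)
    have 0: "re_vec (0 :: complex^'k) = 0" "im_vec (0 :: complex^'k) = 0"
      by (simp_all add: re_vec_def im_vec_def vec_eq_iff)
    show "re_vec (obs A B r (kalman_projector A B k v)) = re_vec 0"
      unfolding obs_def re_im_mult re_im_projector 0
      by (intro * orth_projector subspace_kalman_layer)
    show "im_vec (obs A B r (kalman_projector A B k v)) = im_vec 0"
      unfolding obs_def re_im_mult re_im_projector 0
      by (intro * orth_projector subspace_kalman_layer)
  qed
qed

lemma obs_add: "obs A B r (v + w) = obs A B r v + obs A B r w"
  by (simp add: obs_def matrix_vector_right_distrib)

lemma obs_zero [simp]: "obs A B r 0 = 0"
  by (simp add: obs_def)

lemma obs_sum: "obs A B r (\<Sum>i\<in>I. f i) = (\<Sum>i\<in>I. obs A B r (f i))"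
  by (induction I rule: infinite_finite_induct) (auto simp: obs_add)

lemma norm_vector_scalar [simp]: "norm (c *s (x :: complex^'n)) = cmod c * norm x"
  by (simp add: norm_vec_def norm_mult L2_set_right_distrib)

lemma obs_bounded: "\<exists>C>0. \<forall>v. norm (obs A B r v) \<le> C * norm v"
proof -
  have "linear (obs A B r)"
    by (rule linearI, rule obs_add)
       (simp add: vec_eq_iff obs_def matrix_vector_mult_def scaleR_sum_right)
  then show ?thesis by (metis linear_bounded_pos)
qed

section \<open>Low frequencies: a finite-dimensional estimate\<close>

text \<open>The combination \<open>F (2 s) - 2\<^bsup>n+1\<^esup> F s\<close> has no term of degree \<open>n + 1\<close>, its other coefficients are those of
\<open>F\<close> up to factors of absolute value at least \<open>1\<close>, and its norm over half the interval is controlled by that of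
\<open>F\<close>. The induction hypothesis therefore bounds the lower coefficients, and the top one follows by subtraction.\<close>

lemma polynomial_coefficients_bound:
  fixes n :: nat
  shows "\<forall>\<tau>>0. \<exists>C\<ge>0. \<forall>y :: nat \<Rightarrow> 'a::real_normed_vector.
    (\<Sum>r\<le>n. (norm (y r))\<^sup>2) \<le> C * integral {0..\<tau>} (\<lambda>s. (norm (\<Sum>r\<le>n. s ^ r *\<^sub>R y r))\<^sup>2)"
proof (induction n)
  case 0
  show ?case
  proof (intro allI impI)
    fix \<tau> :: real assume "\<tau> > 0"
    then show "\<exists>C\<ge>0. \<forall>y :: nat \<Rightarrow> 'a. (\<Sum>r\<le>0. (norm (y r))\<^sup>2) \<le> C * integral {0..\<tau>} (\<lambda>s. (norm (\<Sum>r\<le>0. s ^ r *\<^sub>R y r))\<^sup>2)"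
      by (intro exI[of _ "1 / \<tau>"]) auto
  qed
next
  case (Suc n)
  show ?case
  proof (intro allI impI)
    fix \<tau> :: real assume \<tau>: "\<tau> > 0"
    obtain C where C: "C \<ge> 0" "\<And>y :: nat \<Rightarrow> 'a. (\<Sum>r\<le>n. (norm (y r))\<^sup>2) \<le> C * integral {0..\<tau> / 2} (\<lambda>s. (norm (\<Sum>r\<le>n. s ^ r *\<^sub>R y r))\<^sup>2)"
      using Suc.IH[rule_format, of "\<tau> / 2"] \<tau> by auto
    define q where "q = (2 :: real) ^ Suc n"
    define J where "J = integral {0..\<tau>} (\<lambda>s. s ^ (2 * Suc n) :: real)"
    have J: "J > 0"
    proof -
      have "((\<lambda>s. s ^ p :: real) has_integral (\<tau> ^ Suc p / real (Suc p) - 0 ^ Suc p / real (Suc p))) {0..\<tau>}" for p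
        using \<tau> by (intro fundamental_theorem_of_calculus)
          (auto intro!: derivative_eq_intros simp: has_real_derivative_iff_has_vector_derivative[symmetric]
            simp del: power_Suc of_nat_Suc)
      from this[of "2 * Suc n"]
      have "J = \<tau> ^ Suc (2 * Suc n) / real (Suc (2 * Suc n))"
        unfolding J_def by (simp add: integral_unique)
      then show ?thesis using \<tau> by simp
    qed
    define C1 where "C1 = C * (1 + 2 * q\<^sup>2)"
    have C1: "C1 \<ge> 0" using C by (simp add: C1_def)
    define M where "M = (\<Sum>r\<le>n. \<tau> ^ r)\<^sup>2"
    have M: "M \<ge> 0" by (simp add: M_def)
    define C2 where "C2 = C1 + (2 + 2 * \<tau> * M * C1) / J"
    have "C2 \<ge> 0" using C1 M J \<tau> by (simp add: C2_def)
    moreover have "(\<Sum>r\<le>Suc n. (norm (y r))\<^sup>2) \<le> C2 * integral {0..\<tau>} (\<lambda>s. (norm (\<Sum>r\<le>Suc n. s ^ r *\<^sub>R y r))\<^sup>2)"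
      for y :: "nat \<Rightarrow> 'a"
    proof -
      define F where "F s = (\<Sum>r\<le>Suc n. s ^ r *\<^sub>R y r)" for s :: real
      define E where "E = integral {0..\<tau>} (\<lambda>s. (norm (F s))\<^sup>2)"
      have contF [continuous_intros]: "continuous_on A F" for A
        unfolding F_def by (intro continuous_intros)
      have int: "(\<lambda>s. (norm (F s))\<^sup>2) integrable_on {u..v}" for u v
        by (intro integrable_continuous_interval continuous_intros)
      have int2: "(\<lambda>s. (norm (F (2 * s)))\<^sup>2) integrable_on {u..v}" for u v
        unfolding F_def by (intro integrable_continuous_interval continuous_intros)
      have E0: "E \<ge> 0" unfolding E_def by (rule integral_nonneg[OF int]) auto
      define z where "z r = (2 ^ r - q) *\<^sub>R y r" for r
      have z: "(\<Sum>r\<le>n. s ^ r *\<^sub>R z r) = F (2 * s) - q *\<^sub>R F s" for s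
      proof -
        have "F (2 * s) - q *\<^sub>R F s = (\<Sum>r\<le>Suc n. s ^ r *\<^sub>R z r)"
          unfolding F_def z_def scaleR_sum_right sum_subtractf[symmetric]
          by (intro sum.cong) (auto simp: algebra_simps power_mult_distrib)
        then show ?thesis by (simp add: z_def q_def)
      qed
      have "(norm (y r))\<^sup>2 \<le> (norm (z r))\<^sup>2" if "r \<le> n" for r
      proof -
        have "(2 :: real) ^ r \<le> 2 ^ n" using that by (intro power_increasing) auto
        moreover have "(1 :: real) \<le> 2 ^ n" by simp
        ultimately have "1 \<le> \<bar>2 ^ r - q\<bar>" unfolding q_def power_Suc by linarith
        then have "1 * norm (y r) \<le> \<bar>2 ^ r - q\<bar> * norm (y r)" by (intro mult_right_mono) auto
        then show ?thesis by (simp add: z_def power_mono)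
      qed
      then have "(\<Sum>r\<le>n. (norm (y r))\<^sup>2) \<le> (\<Sum>r\<le>n. (norm (z r))\<^sup>2)" by (intro sum_mono) auto
      also have "\<dots> \<le> C * integral {0..\<tau> / 2} (\<lambda>s. (norm (F (2 * s) - q *\<^sub>R F s))\<^sup>2)"
        using C(2)[of z] unfolding z .
      also have "\<dots> \<le> C * (integral {0..\<tau> / 2} (\<lambda>s. 2 * (norm (F (2 * s)))\<^sup>2 + 2 * q\<^sup>2 * (norm (F s))\<^sup>2))"
      proof (intro mult_left_mono integral_le)
        show "(\<lambda>s. (norm (F (2 * s) - q *\<^sub>R F s))\<^sup>2) integrable_on {0..\<tau> / 2}"
          unfolding F_def by (intro integrable_continuous_interval continuous_intros)
        show "(\<lambda>s. 2 * (norm (F (2 * s)))\<^sup>2 + 2 * q\<^sup>2 * (norm (F s))\<^sup>2) integrable_on {0..\<tau> / 2}"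
          unfolding F_def by (intro integrable_continuous_interval continuous_intros)
        show "(norm (F (2 * s) - q *\<^sub>R F s))\<^sup>2 \<le> 2 * (norm (F (2 * s)))\<^sup>2 + 2 * q\<^sup>2 * (norm (F s))\<^sup>2" for s
          using norm_diff_square_le[of "F (2 * s)" "q *\<^sub>R F s"] by (simp add: power_mult_distrib)
      qed (use C in auto)
      also have "integral {0..\<tau> / 2} (\<lambda>s. 2 * (norm (F (2 * s)))\<^sup>2 + 2 * q\<^sup>2 * (norm (F s))\<^sup>2)
         = 2 * integral {0..\<tau> / 2} (\<lambda>s. (norm (F (2 * s)))\<^sup>2) + 2 * q\<^sup>2 * integral {0..\<tau> / 2} (\<lambda>s. (norm (F s))\<^sup>2)"
        using int int2 by (subst integral_add) (auto intro: integrable_on_mult_right)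
      also have "integral {0..\<tau> / 2} (\<lambda>s. (norm (F (2 * s)))\<^sup>2) = E / 2"
      proof -
        have "((\<lambda>s. (norm (F s))\<^sup>2) has_integral E) {0..\<tau>}"
          unfolding E_def using int by (rule integrable_integral)
        from has_integral_stretch_real[OF this, of 2] show ?thesis
          using \<tau> by (simp add: integral_unique)
      qed
      also have "2 * (E / 2) + 2 * q\<^sup>2 * integral {0..\<tau> / 2} (\<lambda>s. (norm (F s))\<^sup>2) \<le> (1 + 2 * q\<^sup>2) * E"
      proof -
        have "integral {0..\<tau> / 2} (\<lambda>s. (norm (F s))\<^sup>2) \<le> E"
          unfolding E_def using \<tau> int by (intro integral_subset_le) auto
        then have "2 * q\<^sup>2 * integral {0..\<tau> / 2} (\<lambda>s. (norm (F s))\<^sup>2) \<le> 2 * q\<^sup>2 * E"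
          by (intro mult_left_mono) auto
        then show ?thesis by (simp add: distrib_right)
      qed
      finally have low: "(\<Sum>r\<le>n. (norm (y r))\<^sup>2) \<le> C1 * E"
        using C(1) by (simp add: C1_def mult_left_mono mult.assoc)
      have pw: "(norm (y (Suc n)))\<^sup>2 * s ^ (2 * Suc n) \<le> 2 * (norm (F s))\<^sup>2 + 2 * (M * (C1 * E))" if s: "s \<in> {0..\<tau>}" for s
      proof -
        have "s ^ Suc n *\<^sub>R y (Suc n) = F s - (\<Sum>r\<le>n. s ^ r *\<^sub>R y r)" by (simp add: F_def)
        then have "(norm (s ^ Suc n *\<^sub>R y (Suc n)))\<^sup>2 \<le> 2 * (norm (F s))\<^sup>2 + 2 * (norm (\<Sum>r\<le>n. s ^ r *\<^sub>R y r))\<^sup>2"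
          using norm_diff_square_le[of "F s" "\<Sum>r\<le>n. s ^ r *\<^sub>R y r"] by (simp only:)
        moreover have "(norm (s ^ Suc n *\<^sub>R y (Suc n)))\<^sup>2 = (norm (y (Suc n)))\<^sup>2 * s ^ (2 * Suc n)"
        proof -
          have "(norm (t *\<^sub>R w))\<^sup>2 = (norm w)\<^sup>2 * t\<^sup>2" for t and w :: 'a by (simp add: power_mult_distrib)
          then show ?thesis by (simp only: power_mult[symmetric] mult.commute[of "Suc n" 2])
        qed
        moreover have "(norm (\<Sum>r\<le>n. s ^ r *\<^sub>R y r))\<^sup>2 \<le> M * (C1 * E)"
        proof -
          have nr: "norm (y r) \<le> sqrt (C1 * E)" if "r \<le> n" for r
          proof -
            have "(norm (y r))\<^sup>2 \<le> (\<Sum>r\<le>n. (norm (y r))\<^sup>2)" using that by (intro member_le_sum) auto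
            then have "(norm (y r))\<^sup>2 \<le> C1 * E" using low by linarith
            then show ?thesis by (rule real_le_rsqrt)
          qed
          have "norm (\<Sum>r\<le>n. s ^ r *\<^sub>R y r) \<le> (\<Sum>r\<le>n. \<tau> ^ r * sqrt (C1 * E))"
          proof (rule sum_norm_le)
            fix r assume "r \<in> {..n}"
            then show "norm (s ^ r *\<^sub>R y r) \<le> \<tau> ^ r * sqrt (C1 * E)"
              using s nr[of r] C1 E0 by (auto simp: power_abs intro!: mult_mono power_mono)
          qed
          also have "\<dots> = (\<Sum>r\<le>n. \<tau> ^ r) * sqrt (C1 * E)" by (simp add: sum_distrib_right)
          finally have "(norm (\<Sum>r\<le>n. s ^ r *\<^sub>R y r))\<^sup>2 \<le> ((\<Sum>r\<le>n. \<tau> ^ r) * sqrt (C1 * E))\<^sup>2"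
            by (intro power_mono) auto
          also have "\<dots> = M * (C1 * E)" using C1 E0 by (simp add: M_def power_mult_distrib)
          finally show ?thesis .
        qed
        ultimately show ?thesis by linarith
      qed
      have "(norm (y (Suc n)))\<^sup>2 * J = integral {0..\<tau>} (\<lambda>s. (norm (y (Suc n)))\<^sup>2 * s ^ (2 * Suc n))"
        by (simp add: J_def)
      also have "\<dots> \<le> integral {0..\<tau>} (\<lambda>s. 2 * (norm (F s))\<^sup>2 + 2 * (M * (C1 * E)))"
      proof (rule integral_le)
        show "(\<lambda>s. (norm (y (Suc n)))\<^sup>2 * s ^ (2 * Suc n)) integrable_on {0..\<tau>}"
          by (intro integrable_continuous_interval continuous_intros)
        show "(\<lambda>s. 2 * (norm (F s))\<^sup>2 + 2 * (M * (C1 * E))) integrable_on {0..\<tau>}"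
          by (intro integrable_continuous_interval continuous_intros)
      qed (rule pw)
      also have "\<dots> = 2 * E + \<tau> * (2 * (M * (C1 * E)))"
        using int \<tau> unfolding E_def by (subst integral_add) (auto intro: integrable_on_mult_right)
      finally have "(norm (y (Suc n)))\<^sup>2 * J \<le> (2 + 2 * \<tau> * M * C1) * E"
        by (simp add: algebra_simps)
      then have "(norm (y (Suc n)))\<^sup>2 \<le> (2 + 2 * \<tau> * M * C1) * E / J"
        using J by (simp add: pos_le_divide_eq)
      then show ?thesis
        using low unfolding F_def[symmetric] E_def[symmetric] C2_def by (simp add: distrib_right)
    qed
    ultimately show "\<exists>C\<ge>0. \<forall>y :: nat \<Rightarrow> 'a. (\<Sum>r\<le>Suc n. (norm (y r))\<^sup>2) \<le> C * integral {0..\<tau>} (\<lambda>s. (norm (\<Sum>r\<le>Suc n. s ^ r *\<^sub>R y r))\<^sup>2)"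
      by (intro exI[of _ C2] conjI allI)
  qed
qed

lemma sum_square_le: 
  fixes f :: "nat \<Rightarrow> real"
  shows "(\<Sum>k\<le>K. f k)\<^sup>2 \<le> (real K + 1) * (\<Sum>k\<le>K. (f k)\<^sup>2)"
  using Cauchy_Schwarz_ineq_sum[of "\<lambda>k. 1" f "{..K}"] by (simp add: add.commute)

text \<open>Here \<open>F\<close> stands for the observation of \<open>v\<close> at the frequency \<open>\<xi>\<close>; the assumption says that it agrees with its Taylor
polynomial up to the expected error. Put \<open>u\<^sub>k = \<xi>\<^sup>k \<Pi>\<^sub>k v\<close>. As \<open>(A\<^sup>r B)\<^sup>T\<close> kills the layers above
\<open>r\<close>, the coefficient \<open>\<xi>\<^sup>r (A\<^sup>r B)\<^sup>T v\<close> differs from \<open>(A\<^sup>r B)\<^sup>T u\<^sub>r\<close> by terms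
\<open>\<xi>\<^bsup>r - k\<^esup> (A\<^sup>r B)\<^sup>T u\<^sub>k\<close> with \<open>k < r\<close>, which carry a factor \<open>\<xi>\<close>; so does the Taylor remainder,
because \<open>\<xi>\<^sup>K v\<close> is bounded by the \<open>u\<^sub>k\<close>. The polynomial with coefficients proportional to
\<open>(A\<^sup>r B)\<^sup>T u\<^sub>r\<close> controls all \<open>u\<^sub>r\<close>, and for small \<open>\<xi>\<close> the error is absorbed.\<close>

lemma low_frequency_vector_observability:
  fixes A :: "real^'n^'n" and B :: "real^'m^'n"
  assumes K: "kalman_index A B K" and \<tau>: "\<tau> > 0" and Q: "Q \<ge> 0"
  shows "\<exists>\<epsilon>>0. \<epsilon> \<le> 1 \<and> (\<exists>C>0. \<forall>\<xi> v F. \<bar>\<xi>\<bar> \<le> \<epsilon> \<longrightarrow> continuous_on {0..\<tau>} F \<longrightarrow>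
    (\<forall>s\<in>{0..\<tau>}. norm (F s - (\<Sum>r\<le>K. ((\<i> * of_real (\<xi> * s)) ^ r / fact r) *s obs A B r v)) \<le> Q * \<bar>\<xi>\<bar> ^ Suc K * norm v) \<longrightarrow>
    (\<Sum>k\<le>K. \<bar>\<xi>\<bar> ^ (2 * k) * (norm (kalman_projector A B k v))\<^sup>2) \<le> C * integral {0..\<tau>} (\<lambda>s. (norm (F s))\<^sup>2))"
proof -
  let ?P = "kalman_projector A B"
  obtain c where c: "\<And>r. c r > 0" "\<And>r v. c r * (norm (?P r v))\<^sup>2 \<le> (norm (obs A B r (?P r v)))\<^sup>2"
    using obs_layer[of A B] by metis
  obtain b where b: "\<And>r. b r > 0" "\<And>r v. norm (obs A B r v) \<le> b r * norm v"
    using obs_bounded[of A B] by metis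
  obtain Cp where Cp: "Cp \<ge> 0" "\<And>y :: nat \<Rightarrow> complex^'m.
    (\<Sum>r\<le>K. (norm (y r))\<^sup>2) \<le> Cp * integral {0..\<tau>} (\<lambda>s. (norm (\<Sum>r\<le>K. s ^ r *\<^sub>R y r))\<^sup>2)"
    using polynomial_coefficients_bound[rule_format, OF \<tau>, of K] by blast
  define m where "m = (MIN r\<in>{..K}. c r / (fact r)\<^sup>2)"
  have m: "m > 0" "\<And>r. r \<le> K \<Longrightarrow> m \<le> c r / (fact r)\<^sup>2"
    unfolding m_def using c(1) by (auto simp: Min_gr_iff)
  define R where "R = Q + (\<Sum>r\<le>K. \<tau> ^ r * b r)"
  have R: "R \<ge> 0" unfolding R_def using Q \<tau> b(1) by (intro add_nonneg_nonneg sum_nonneg) (auto simp: less_imp_le)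
  define R2 where "R2 = R\<^sup>2 * (real K + 1)"
  have R2: "R2 \<ge> 0" by (simp add: R2_def)
  \<comment> \<open>the \<open>+ 1\<close> only keeps the denominator positive\<close>
  define \<epsilon> where "\<epsilon> = min 1 (m / (4 * Cp * \<tau> * R2 + 1))"
  have den: "4 * Cp * \<tau> * R2 + 1 > 0" using Cp(1) \<tau> R2 by (simp add: add_nonneg_pos)
  have \<epsilon>: "\<epsilon> > 0" "\<epsilon> \<le> 1" using m den by (auto simp: \<epsilon>_def)
  have \<epsilon>2: "Cp * (2 * (\<tau> * (R2 * \<epsilon>\<^sup>2))) \<le> m / 2"
  proof -
    have "\<epsilon>\<^sup>2 \<le> \<epsilon>" using \<epsilon> by (simp add: power2_eq_square mult_left_le)
    also have "\<epsilon> \<le> m / (4 * Cp * \<tau> * R2 + 1)" by (simp add: \<epsilon>_def)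
    finally have "(4 * Cp * \<tau> * R2) * \<epsilon>\<^sup>2 \<le> (4 * Cp * \<tau> * R2 + 1) * (m / (4 * Cp * \<tau> * R2 + 1))"
      using Cp(1) \<tau> R2 by (intro mult_mono) auto
    also have "\<dots> = m" using den by simp
    finally show ?thesis by (simp add: algebra_simps)
  qed
  define C where "C = 4 * Cp / m + 1"
  have C: "C > 0" using Cp m by (simp add: C_def add_nonneg_pos)
  have main: "(\<Sum>k\<le>K. \<bar>\<xi>\<bar> ^ (2 * k) * (norm (?P k v))\<^sup>2) \<le> C * integral {0..\<tau>} (\<lambda>s. (norm (F s))\<^sup>2)"
    if \<xi>: "\<bar>\<xi>\<bar> \<le> \<epsilon>" and F: "continuous_on {0..\<tau>} F" and
      T: "\<And>s. s \<in> {0..\<tau>} \<Longrightarrow> norm (F s - (\<Sum>r\<le>K. ((\<i> * of_real (\<xi> * s)) ^ r / fact r) *s obs A B r v)) \<le> Q * \<bar>\<xi>\<bar> ^ Suc K * norm v"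
    for \<xi> v and F :: "real \<Rightarrow> complex^'m"
  proof -
    define n where "n k = \<bar>\<xi>\<bar> ^ k * norm (?P k v)" for k
    define U where "U = (\<Sum>k\<le>K. (n k)\<^sup>2)"
    \<comment> \<open>\<open>n k\<close> is the norm of \<open>u\<^sub>k\<close>, and \<open>F0\<close> the leading part of the observation\<close>
    define y where "y r = (\<i> ^ r * of_real (\<xi> ^ r) / fact r) *s obs A B r (?P r v)" for r
    define F0 where "F0 s = (\<Sum>r\<le>K. s ^ r *\<^sub>R y r)" for s :: real
    have xi1: "\<bar>\<xi>\<bar> \<le> 1" using \<xi> \<epsilon> by simp
    have n0: "n k \<ge> 0" for k by (simp add: n_def)
    have U0: "U \<ge> 0" by (simp add: U_def sum_nonneg)
    have mU: "m * U \<le> (\<Sum>r\<le>K. (norm (y r))\<^sup>2)"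
      unfolding U_def sum_distrib_left
    proof (rule sum_mono)
      fix r assume "r \<in> {..K}"
      then have "m * (n r)\<^sup>2 \<le> c r / (fact r)\<^sup>2 * (n r)\<^sup>2" using m by (intro mult_right_mono) auto
      also have "\<dots> = (\<bar>\<xi>\<bar> ^ r / fact r)\<^sup>2 * (c r * (norm (?P r v))\<^sup>2)"
        by (simp add: n_def power_mult_distrib power_divide)
      also have "\<dots> \<le> (\<bar>\<xi>\<bar> ^ r / fact r)\<^sup>2 * (norm (obs A B r (?P r v)))\<^sup>2"
        using c(2) by (intro mult_left_mono) auto
      also have "\<dots> = (norm (y r))\<^sup>2"
        by (simp add: y_def norm_mult norm_divide norm_power power_mult_distrib power_divide)
      finally show "m * (n r)\<^sup>2 \<le> (norm (y r))\<^sup>2" .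
    qed
    have vle: "\<bar>\<xi>\<bar> ^ K * norm v \<le> (\<Sum>k\<le>K. n k)"
    proof -
      have "norm v \<le> (\<Sum>k\<le>K. norm (?P k v))"
        using norm_sum[of "\<lambda>k. ?P k v" "{..K}"] by (simp add: kalman_projector_sum[OF K])
      then have "\<bar>\<xi>\<bar> ^ K * norm v \<le> \<bar>\<xi>\<bar> ^ K * (\<Sum>k\<le>K. norm (?P k v))" by (intro mult_left_mono) auto
      also have "\<dots> \<le> (\<Sum>k\<le>K. n k)"
        unfolding sum_distrib_left n_def using xi1
        by (intro sum_mono mult_right_mono power_decreasing) auto
      finally show ?thesis .
    qed
    have diff: "norm (F s - F0 s) \<le> R * \<bar>\<xi>\<bar> * (\<Sum>k\<le>K. n k)" if s: "s \<in> {0..\<tau>}" for s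
    proof -
      let ?T = "\<Sum>r\<le>K. ((\<i> * of_real (\<xi> * s)) ^ r / fact r) *s obs A B r v"
      have "norm (F s - ?T) \<le> Q * (\<bar>\<xi>\<bar> * (\<bar>\<xi>\<bar> ^ K * norm v))" using T[OF s] by (simp add: mult.assoc)
      also have "\<dots> \<le> Q * (\<bar>\<xi>\<bar> * (\<Sum>k\<le>K. n k))" using Q vle by (intro mult_left_mono) auto
      finally have 1: "norm (F s - ?T) \<le> Q * (\<bar>\<xi>\<bar> * (\<Sum>k\<le>K. n k))" .
      have "?T - F0 s = (\<Sum>r\<le>K. ((\<i> * of_real (\<xi> * s)) ^ r / fact r) *s obs A B r (v - ?P r v))"
      proof -
        have "s ^ r *\<^sub>R y r = ((\<i> * of_real (\<xi> * s)) ^ r / fact r) *s obs A B r (?P r v)" for r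
          by (simp only: vec_eq_iff vector_scaleR_component y_def vector_smult_component)
             (simp add: scaleR_conv_of_real power_mult_distrib)
        moreover have "obs A B r (v - w) = obs A B r v - obs A B r w" for r w
          by (metis obs_add add_diff_cancel_right' diff_add_cancel)
        moreover have "z *s (w - w') = z *s w - z *s w'" for z :: complex and w w' :: "complex^'m"
          by (simp add: vec_eq_iff right_diff_distrib)
        ultimately show ?thesis
          unfolding F0_def sum_subtractf[symmetric] by simp
      qed
      also have "norm \<dots> \<le> (\<Sum>r\<le>K. \<tau> ^ r * b r * (\<bar>\<xi>\<bar> * (\<Sum>k\<le>K. n k)))"
      proof (rule sum_norm_le)
        fix r assume r: "r \<in> {..K}"
        have "v - ?P r v = (\<Sum>k\<in>{..K} - {r}. ?P k v)"
          using r kalman_projector_sum[OF K, of v] by (simp add: sum.remove[of _ r] algebra_simps)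
        then have "obs A B r (v - ?P r v) = (\<Sum>k\<in>{..K} - {r}. obs A B r (?P k v))" by (simp add: obs_sum)
        also have "\<dots> = (\<Sum>k\<in>{..<r}. obs A B r (?P k v))"
          using r by (intro sum.mono_neutral_right) (auto intro!: obs_higher_layer_zero)
        finally have "norm (obs A B r (v - ?P r v)) \<le> (\<Sum>k<r. norm (obs A B r (?P k v)))"
          by (simp add: norm_sum)
        also have "\<dots> \<le> (\<Sum>k<r. b r * norm (?P k v))" by (intro sum_mono b(2))
        finally have "\<bar>\<xi>\<bar> ^ r * norm (obs A B r (v - ?P r v)) \<le> \<bar>\<xi>\<bar> ^ r * (\<Sum>k<r. b r * norm (?P k v))"
          by (intro mult_left_mono) auto
        also have "\<dots> = (\<Sum>k<r. b r * (\<bar>\<xi>\<bar> ^ r * norm (?P k v)))"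
          by (simp add: sum_distrib_left mult.left_commute)
        also have "\<dots> \<le> (\<Sum>k<r. b r * (\<bar>\<xi>\<bar> * n k))"
        proof (intro sum_mono mult_left_mono)
          fix k assume "k \<in> {..<r}"
          then have "\<bar>\<xi>\<bar> ^ r \<le> \<bar>\<xi>\<bar> ^ Suc k" using xi1 by (intro power_decreasing) auto
          then have "\<bar>\<xi>\<bar> ^ r * norm (?P k v) \<le> \<bar>\<xi>\<bar> ^ Suc k * norm (?P k v)" by (intro mult_right_mono) auto
          then show "\<bar>\<xi>\<bar> ^ r * norm (?P k v) \<le> \<bar>\<xi>\<bar> * n k" by (simp add: n_def mult.assoc)
        qed (use b(1)[of r] in simp)
        also have "\<dots> \<le> (\<Sum>k\<le>K. b r * (\<bar>\<xi>\<bar> * n k))"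
          using r n0 b(1)[of r] by (intro sum_mono2) auto
        also have "\<dots> = b r * (\<bar>\<xi>\<bar> * (\<Sum>k\<le>K. n k))" by (simp add: sum_distrib_left)
        finally have 2: "\<bar>\<xi>\<bar> ^ r * norm (obs A B r (v - ?P r v)) \<le> b r * (\<bar>\<xi>\<bar> * (\<Sum>k\<le>K. n k))" .
        have "norm (((\<i> * of_real (\<xi> * s)) ^ r / fact r) *s obs A B r (v - ?P r v))
          = (s ^ r / fact r) * (\<bar>\<xi>\<bar> ^ r * norm (obs A B r (v - ?P r v)))"
          using s by (simp add: norm_mult norm_divide norm_power power_mult_distrib abs_mult)
        also have "\<dots> \<le> \<tau> ^ r * (b r * (\<bar>\<xi>\<bar> * (\<Sum>k\<le>K. n k)))"
        proof (rule mult_mono[OF _ 2])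
          have "s ^ r / fact r \<le> s ^ r / 1" using s by (intro divide_left_mono) (auto simp: fact_ge_1)
          also have "\<dots> \<le> \<tau> ^ r" using s by (auto intro!: power_mono)
          finally show "s ^ r / fact r \<le> \<tau> ^ r" .
        qed (use s \<tau> in auto)
        finally show "norm (((\<i> * of_real (\<xi> * s)) ^ r / fact r) *s obs A B r (v - ?P r v)) \<le> \<tau> ^ r * b r * (\<bar>\<xi>\<bar> * (\<Sum>k\<le>K. n k))"
          by (simp add: mult.assoc)
      qed
      also have "\<dots> = (\<Sum>r\<le>K. \<tau> ^ r * b r) * (\<bar>\<xi>\<bar> * (\<Sum>k\<le>K. n k))" by (simp add: sum_distrib_right)
      finally have 3: "norm (?T - F0 s) \<le> (\<Sum>r\<le>K. \<tau> ^ r * b r) * (\<bar>\<xi>\<bar> * (\<Sum>k\<le>K. n k))" .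
      have "norm (F s - F0 s) \<le> norm (F s - ?T) + norm (?T - F0 s)"
        using norm_triangle_ineq[of "F s - ?T" "?T - F0 s"] by simp
      also have "\<dots> \<le> R * \<bar>\<xi>\<bar> * (\<Sum>k\<le>K. n k)"
        using 1 3 unfolding R_def by (simp add: distrib_right mult.assoc)
      finally show ?thesis .
    qed
    have diff2: "(norm (F0 s))\<^sup>2 \<le> 2 * (norm (F s))\<^sup>2 + 2 * (R2 * \<epsilon>\<^sup>2 * U)" if s: "s \<in> {0..\<tau>}" for s
    proof -
      have "(norm (F s - F0 s))\<^sup>2 \<le> (R * \<bar>\<xi>\<bar> * (\<Sum>k\<le>K. n k))\<^sup>2"
        using diff[OF s] by (intro power_mono) auto
      also have "\<dots> = R\<^sup>2 * \<bar>\<xi>\<bar>\<^sup>2 * (\<Sum>k\<le>K. n k)\<^sup>2" by (simp only: power_mult_distrib)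
      also have "\<dots> \<le> R\<^sup>2 * \<epsilon>\<^sup>2 * ((real K + 1) * U)"
        using \<xi> unfolding U_def by (intro mult_mono sum_square_le power_mono mult_left_mono) (auto intro!: sum_nonneg)
      finally have "(norm (F s - F0 s))\<^sup>2 \<le> R2 * \<epsilon>\<^sup>2 * U" by (simp add: R2_def ac_simps)
      moreover have "(norm (F0 s))\<^sup>2 \<le> 2 * (norm (F s))\<^sup>2 + 2 * (norm (F s - F0 s))\<^sup>2"
        using norm_diff_square_le[of "F s" "F s - F0 s"] by simp
      ultimately show ?thesis by linarith
    qed
    let ?I = "integral {0..\<tau>} (\<lambda>s. (norm (F s))\<^sup>2)"
    have intF: "(\<lambda>s. (norm (F s))\<^sup>2) integrable_on {0..\<tau>}"
      using F by (intro integrable_continuous_interval continuous_intros)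
    have "m * U \<le> Cp * integral {0..\<tau>} (\<lambda>s. (norm (F0 s))\<^sup>2)"
      using mU Cp(2)[of y] unfolding F0_def by linarith
    also have "\<dots> \<le> Cp * integral {0..\<tau>} (\<lambda>s. 2 * (norm (F s))\<^sup>2 + 2 * (R2 * \<epsilon>\<^sup>2 * U))"
    proof (intro mult_left_mono integral_le)
      show "(\<lambda>s. (norm (F0 s))\<^sup>2) integrable_on {0..\<tau>}"
        unfolding F0_def by (intro integrable_continuous_interval continuous_intros)
      show "(\<lambda>s. 2 * (norm (F s))\<^sup>2 + 2 * (R2 * \<epsilon>\<^sup>2 * U)) integrable_on {0..\<tau>}"
        using F by (intro integrable_continuous_interval continuous_intros)
    qed (use Cp diff2 in auto)
    also have "integral {0..\<tau>} (\<lambda>s. 2 * (norm (F s))\<^sup>2 + 2 * (R2 * \<epsilon>\<^sup>2 * U)) = 2 * ?I + \<tau> * (2 * (R2 * \<epsilon>\<^sup>2 * U))"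
      using intF \<tau> by (subst integral_add) (auto intro: integrable_on_mult_right)
    also have "Cp * (2 * ?I + \<tau> * (2 * (R2 * \<epsilon>\<^sup>2 * U))) = 2 * Cp * ?I + Cp * (2 * (\<tau> * (R2 * \<epsilon>\<^sup>2))) * U"
      by (simp add: algebra_simps)
    also have "\<dots> \<le> 2 * Cp * ?I + m / 2 * U"
      using \<epsilon>2 U0 by (intro add_left_mono mult_right_mono)
    finally have "m * U \<le> 4 * Cp * ?I" by simp
    then have "U \<le> 4 * Cp / m * ?I" using m by (simp add: field_simps)
    also have "\<dots> \<le> C * ?I"
      using integral_nonneg[OF intF] by (intro mult_right_mono) (auto simp: C_def)
    finally show ?thesis unfolding U_def n_def
      by (simp add: power_mult_distrib power_mult[symmetric] mult.commute)
  qed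
  show ?thesis
    by (rule exI[of _ \<epsilon>], rule conjI[OF \<epsilon>(1)], rule conjI[OF \<epsilon>(2)], rule exI[of _ C], rule conjI[OF C])
       (intro allI impI, rule main, auto)
qed

section \<open>Diagonalization, Schwartz data and characteristics\<close>

text \<open>Diagonalization in coordinates: the columns of \<open>P\<close> are eigenvectors of \<open>A\<close>, and \<open>R = matrix_inv P ** B\<close>.\<close>

lemma spectral_form:
  fixes A :: "real^'n^'n" and B :: "real^'m^'n"
  assumes "diagonalizable_over_reals A"
  obtains P :: "real^'n^'n" and d :: "'n \<Rightarrow> real" and R :: "real^'m^'n" where
    "\<And>i l. (\<Sum>j\<in>UNIV. A $ i $ j * P $ j $ l) = d l * P $ i $ l"
    "\<And>k i q. pow_mult A k B $ i $ q = (\<Sum>l\<in>UNIV. P $ i $ l * (d l ^ k * R $ l $ q))"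
    "mat_spectrum A = complex_of_real ` range d"
proof -
  obtain P D :: "real^'n^'n" where inv: "invertible P" and D: "\<And>i j. i \<noteq> j \<Longrightarrow> D $ i $ j = 0"
    and A: "A = P ** D ** matrix_inv P"
    using assms unfolding diagonalizable_over_reals_def by blast
  have "P ** matrix_inv P = mat 1 \<and> matrix_inv P ** P = mat 1"
    using inv unfolding invertible_def matrix_inv_def by (rule someI_ex)
  then have PI: "P ** matrix_inv P = mat 1" "matrix_inv P ** P = mat 1" by auto
  define d where "d l = D $ l $ l" for l
  define R where "R = matrix_inv P ** B"
  have Ddiag: "(\<Sum>j\<in>UNIV. x j * D $ j $ l) = x l * d l" for x :: "'n \<Rightarrow> real" and l
  proof -
    have "(\<Sum>j\<in>UNIV. x j * D $ j $ l) = (\<Sum>j\<in>UNIV. if j = l then x l * d l else 0)"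
      using D by (intro sum.cong) (auto simp: d_def)
    then show ?thesis by simp
  qed
  have "A ** P = P ** D" unfolding A by (simp add: matrix_mul_assoc[symmetric] PI)
  then have AP: "(\<Sum>j\<in>UNIV. A $ i $ j * P $ j $ l) = d l * P $ i $ l" for i l
    using Ddiag[of "\<lambda>j. P $ i $ j" l] by (simp add: matrix_matrix_mult_def vec_eq_iff mult.commute)
  have pow: "pow_mult A k B $ i $ q = (\<Sum>l\<in>UNIV. P $ i $ l * (d l ^ k * R $ l $ q))" for k i q
  proof (induction k arbitrary: i)
    case 0
    have "pow_mult A 0 B = P ** R" by (simp add: pow_mult_def R_def matrix_mul_assoc PI)
    then show ?case by (simp add: matrix_matrix_mult_def)
  next
    case (Suc k)
    have "pow_mult A (Suc k) B $ i $ q = (\<Sum>j\<in>UNIV. A $ i $ j * pow_mult A k B $ j $ q)"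
      by (simp add: pow_mult_def matrix_matrix_mult_def)
    also have "\<dots> = (\<Sum>j\<in>UNIV. \<Sum>l\<in>UNIV. A $ i $ j * P $ j $ l * (d l ^ k * R $ l $ q))"
      by (simp add: Suc.IH sum_distrib_left mult.assoc)
    also have "\<dots> = (\<Sum>l\<in>UNIV. (\<Sum>j\<in>UNIV. A $ i $ j * P $ j $ l) * (d l ^ k * R $ l $ q))"
      by (subst sum.swap) (simp add: sum_distrib_right)
    also have "\<dots> = (\<Sum>l\<in>UNIV. P $ i $ l * (d l ^ Suc k * R $ l $ q))"
      by (simp add: AP ac_simps)
    finally show ?case .
  qed
  have spec: "mat_spectrum A = complex_of_real ` range d"
  proof (intro equalityI subsetI)
    fix \<mu> assume "\<mu> \<in> mat_spectrum A"
    then obtain v where v: "v \<noteq> 0" "complex_mat A *v v = \<mu> *s v"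
      unfolding mat_spectrum_def by blast
    define w where "w l = (\<Sum>i\<in>UNIV. complex_of_real (matrix_inv P $ l $ i) * v $ i)" for l
    have "matrix_inv P ** A = D ** matrix_inv P"
      unfolding A by (simp add: matrix_mul_assoc PI)
    then have IA: "(\<Sum>i\<in>UNIV. matrix_inv P $ l $ i * A $ i $ j) = d l * matrix_inv P $ l $ j" for l j
    proof -
      have "(\<Sum>k\<in>UNIV. D $ l $ k * matrix_inv P $ k $ j) = (\<Sum>k\<in>UNIV. if k = l then d l * matrix_inv P $ l $ j else 0)"
        using D by (intro sum.cong) (auto simp: d_def)
      then show ?thesis
        using \<open>matrix_inv P ** A = D ** matrix_inv P\<close> by (simp add: matrix_matrix_mult_def vec_eq_iff)
    qed
    have dw: "\<mu> * w l = of_real (d l) * w l" for l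
    proof -
      have "\<mu> * w l = (\<Sum>i\<in>UNIV. complex_of_real (matrix_inv P $ l $ i) * (\<mu> *s v) $ i)"
        by (simp add: w_def sum_distrib_left ac_simps)
      also have "\<dots> = (\<Sum>i\<in>UNIV. \<Sum>j\<in>UNIV. complex_of_real (matrix_inv P $ l $ i * A $ i $ j) * v $ j)"
        unfolding v(2)[symmetric] by (simp add: matrix_vector_mult_def sum_distrib_left mult.assoc)
      also have "\<dots> = (\<Sum>j\<in>UNIV. complex_of_real (\<Sum>i\<in>UNIV. matrix_inv P $ l $ i * A $ i $ j) * v $ j)"
        by (subst sum.swap) (simp add: sum_distrib_right)
      also have "\<dots> = of_real (d l) * w l"
        unfolding IA w_def by (simp add: sum_distrib_left mult.assoc)
      finally show ?thesis .
    qed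
    have "\<exists>l. w l \<noteq> 0"
    proof (rule ccontr)
      assume "\<nexists>l. w l \<noteq> 0"
      then have w0: "w l = 0" for l by auto
      have "v $ i = 0" for i
      proof -
        have "0 = (\<Sum>l\<in>UNIV. complex_of_real (P $ i $ l) * w l)" by (simp add: w0)
        also have "\<dots> = (\<Sum>l\<in>UNIV. \<Sum>j\<in>UNIV. complex_of_real (P $ i $ l * matrix_inv P $ l $ j) * v $ j)"
          by (simp add: w_def sum_distrib_left mult.assoc)
        also have "\<dots> = (\<Sum>j\<in>UNIV. complex_of_real (\<Sum>l\<in>UNIV. P $ i $ l * matrix_inv P $ l $ j) * v $ j)"
          by (subst sum.swap) (simp add: sum_distrib_right)
        also have "\<dots> = (\<Sum>j\<in>UNIV. complex_of_real ((mat 1 :: real^'n^'n) $ i $ j) * v $ j)"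
          unfolding PI(1)[symmetric] by (simp add: matrix_matrix_mult_def)
        also have "\<dots> = (\<Sum>j\<in>UNIV. if j = i then v $ i else 0)"
          by (intro sum.cong) (auto simp: mat_def)
        finally show ?thesis by simp
      qed
      then show False using v(1) by (simp add: vec_eq_iff)
    qed
    then show "\<mu> \<in> complex_of_real ` range d" using dw by auto
  next
    fix \<mu> assume "\<mu> \<in> complex_of_real ` range d"
    then obtain l where l: "\<mu> = complex_of_real (d l)" by auto
    define v where "v = (\<chi> i. complex_of_real (P $ i $ l))"
    have "v \<noteq> 0"
    proof
      assume "v = 0"
      then have "P $ i $ l = 0" for i by (simp add: v_def vec_eq_iff)
      then have "(matrix_inv P ** P) $ l $ l = 0" by (simp add: matrix_matrix_mult_def)
      then show False using PI(2) by (simp add: mat_def)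
    qed
    moreover have "complex_mat A *v v = \<mu> *s v"
      unfolding vec_eq_iff
    proof
      fix i
      have "(complex_mat A *v v) $ i = complex_of_real (\<Sum>j\<in>UNIV. A $ i $ j * P $ j $ l)"
        by (simp add: matrix_vector_mult_def v_def)
      then show "(complex_mat A *v v) $ i = (\<mu> *s v) $ i"
        unfolding AP by (simp add: l v_def)
    qed
    ultimately show "\<mu> \<in> mat_spectrum A" unfolding mat_spectrum_def by blast
  qed
  show ?thesis by (rule that[OF AP pow spec])
qed

lemma integrable_inverse_quadratic: "integrable lborel (\<lambda>x :: real. inverse (1 + x\<^sup>2))"
proof -
  have "einterval (-\<infinity>) \<infinity> = (UNIV :: real set)" by (auto simp: einterval_def)
  then show ?thesis using integrable_inverse_1_plus_square by (simp add: set_integrable_def)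
qed

lemma schwartz_component_tame:
  fixes \<phi> :: "real \<Rightarrow> complex^'n"
  assumes "schwartz \<phi>" shows "tame (\<lambda>x. \<phi> x $ i)"
proof -
  obtain D where D: "D 0 = \<phi>" "\<And>k x. (D k has_vector_derivative D (Suc k) x) (at x)"
    "\<And>j k. bounded (range (\<lambda>x. x ^ j *\<^sub>R D k x))"
    using assms unfolding schwartz_def by auto
  have cont: "continuous_on UNIV \<phi>"
    using D(2)[of 0] unfolding D(1) by (auto intro!: continuous_at_imp_continuous_on has_vector_derivative_continuous)
  have "bounded (range \<phi>)" using D(3)[of 0 0] by (simp add: D(1))
  then obtain c0 where c0: "\<And>x. norm (\<phi> x) \<le> c0" unfolding bounded_iff by auto
  obtain c2 where c2: "\<And>x. norm (x ^ 2 *\<^sub>R \<phi> x) \<le> c2"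
    using D(3)[of 2 0] unfolding bounded_iff by (auto simp: D(1))
  have b0: "cmod (\<phi> x $ i) \<le> c0" for x using c0[of x]
    by (meson Finite_Cartesian_Product.norm_nth_le order_trans)
  have b: "cmod (\<phi> x $ i) \<le> (c0 + c2) * inverse (1 + x\<^sup>2)" for x
  proof -
    have "x\<^sup>2 * cmod (\<phi> x $ i) \<le> x\<^sup>2 * norm (\<phi> x)"
      by (intro mult_left_mono Finite_Cartesian_Product.norm_nth_le) auto
    also have "\<dots> \<le> c2" using c2[of x] by simp
    finally have "(1 + x\<^sup>2) * cmod (\<phi> x $ i) \<le> c0 + c2" using b0[of x] by (simp add: distrib_right)
    moreover have "1 + x\<^sup>2 > 0" by (simp add: add_pos_nonneg)
    ultimately show ?thesis by (simp add: field_simps)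
  qed
  have c: "continuous_on UNIV (\<lambda>x. \<phi> x $ i)" using cont by (intro continuous_intros)
  then have [measurable]: "(\<lambda>x. \<phi> x $ i) \<in> borel_measurable borel" by (rule borel_measurable_continuous_onI)
  have "integrable lborel (\<lambda>x. \<phi> x $ i)"
    by (rule Bochner_Integration.integrable_bound[OF integrable_mult_right[OF integrable_inverse_quadratic, of "c0 + c2"]])
       (auto intro!: AE_I2 order_trans[OF b abs_ge_self])
  then show ?thesis
    using c b0 unfolding tame_def by (auto simp: bounded_iff)
qed

lemma fourier_component:
  fixes \<phi> :: "real \<Rightarrow> complex^'n"
  assumes "schwartz \<phi>" shows "fourier \<phi> \<xi> $ i = FT (\<lambda>x. \<phi> x $ i) \<xi>"
proof -
  have [simp]: "integrable lborel (\<lambda>x. \<phi> x $ i)" for i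
    using schwartz_component_tame[OF assms] by (simp add: tame_def)
  have "integrable lborel (\<lambda>x. exp (- \<i> * of_real x * of_real \<xi>) *s \<phi> x)"
  proof -
    have "(\<lambda>x. exp (- \<i> * of_real x * of_real \<xi>) *s \<phi> x)
      = (\<lambda>x. \<Sum>i\<in>UNIV. axis i (exp (- \<i> * of_real x * of_real \<xi>) * \<phi> x $ i))"
      by (auto simp: vec_eq_iff axis_def if_distrib cong: if_cong)
    moreover have "bounded_linear (axis i :: complex \<Rightarrow> complex^'n)" for i
      by (rule linear_conv_bounded_linear[THEN iffD1]) (auto intro!: linearI simp: vec_eq_iff axis_def)
    ultimately show ?thesis
      by (simp only:) (intro Bochner_Integration.integrable_sum
         integrable_bounded_linear[of "axis _"] integrable_kernel_mult; simp)
  qed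
  from integral_bounded_linear[OF bounded_linear_vec_nth[of i] this]
  show ?thesis by (simp add: fourier_def FT_def)
qed

text \<open>The pairing of the solution with an eigenvector of \<open>A\<close> solves a scalar transport equation, so it has zero derivative
along the characteristic through \<open>(t, x)\<close>; continuity up to \<open>t = T\<close> gives the terminal value.\<close>

lemma eigencomponent_along_characteristic:
  fixes A :: "real^'n^'n" and P :: "real^'n^'n"
  assumes sol: "adjoint_solution A T \<phi> q"
    and AP: "\<And>i. (\<Sum>j\<in>UNIV. A $ i $ j * P $ j $ l) = dl * P $ i $ l"
    and t: "t \<in> {0<..<T}"
  shows "(\<Sum>i\<in>UNIV. complex_of_real (P $ i $ l) * q t x $ i) =
    (\<Sum>i\<in>UNIV. complex_of_real (P $ i $ l) * \<phi> (x + dl * (T - t)) $ i)"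
proof -
  define \<psi> where "\<psi> v = (\<Sum>i\<in>UNIV. complex_of_real (P $ i $ l) * v $ i)" for v :: "complex^'n"
  have bl: "bounded_linear \<psi>"
    unfolding \<psi>_def by (intro bounded_linear_sum bounded_linear_const_mult bounded_linear_vec_nth)
  define y where "y = x - dl * t"
  define g where "g s = \<psi> (q s (y + dl * s))" for s
  have cq: "continuous_on ({0..T} \<times> UNIV) (\<lambda>(t, x). q t x)"
    using sol by (simp add: adjoint_solution_def)
  have "continuous_on {0..T} (\<lambda>s. (\<lambda>(t, x). q t x) (s, y + dl * s))"
    by (rule continuous_on_compose2[OF cq]) (auto intro!: continuous_intros)
  then have cg: "continuous_on {0..T} g"
    unfolding g_def by (intro bounded_linear.continuous_on[OF bl]) simp
  have dg: "(g has_derivative (\<lambda>h. 0)) (at s within {0..T})" if s: "s \<in> {0..T} - {0, T}" for s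
  proof -
    have "s \<in> {0<..<T}" using s by auto
    then obtain qt qx where q: "((\<lambda>(s, y). q s y) has_derivative (\<lambda>(h, k). h *\<^sub>R qt + k *\<^sub>R qx)) (at (s, y + dl * s))"
      and eq: "qt + complex_mat (transpose A) *v qx = 0"
      using sol unfolding adjoint_solution_def by blast
    have "\<psi> (complex_mat (transpose A) *v qx) = (\<Sum>i\<in>UNIV. \<Sum>j\<in>UNIV. complex_of_real (A $ j $ i * P $ i $ l) * qx $ j)"
      by (simp add: \<psi>_def matrix_vector_mult_def transpose_def sum_distrib_left ac_simps)
    also have "\<dots> = (\<Sum>j\<in>UNIV. complex_of_real (\<Sum>i\<in>UNIV. A $ j $ i * P $ i $ l) * qx $ j)"
      by (subst sum.swap) (simp add: sum_distrib_right)
    also have "\<dots> = of_real dl * \<psi> qx" unfolding AP \<psi>_def by (simp add: sum_distrib_left mult.assoc)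
    finally have "\<psi> (complex_mat (transpose A) *v qx) = of_real dl * \<psi> qx" .
    moreover have "\<psi> (qt + complex_mat (transpose A) *v qx) = 0"
      unfolding eq by (simp add: \<psi>_def)
    ultimately have qtx: "\<psi> qt = - (of_real dl * \<psi> qx)"
      by (simp add: linear_add[OF bounded_linear.linear[OF bl]] eq_neg_iff_add_eq_0)
    have "((\<lambda>s. (\<lambda>(s, y). q s y) (s, y + dl * s)) has_derivative (\<lambda>h. (\<lambda>(h, k). h *\<^sub>R qt + k *\<^sub>R qx) (h, dl * h))) (at s)"
      by (rule has_derivative_compose[where g = "\<lambda>(s, y). q s y" and f = "\<lambda>s. (s, y + dl * s)", OF _ q]) (auto intro!: derivative_eq_intros)
    then have "((\<lambda>s. q s (y + dl * s)) has_derivative (\<lambda>h. h *\<^sub>R qt + (dl * h) *\<^sub>R qx)) (at s)"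
      by simp
    then have "(g has_derivative (\<lambda>h. \<psi> (h *\<^sub>R qt + (dl * h) *\<^sub>R qx))) (at s)"
      unfolding g_def by (rule bounded_linear.has_derivative[OF bl])
    moreover have "\<psi> (h *\<^sub>R qt + (dl * h) *\<^sub>R qx) = 0" for h
    proof -
      have "\<psi> (h *\<^sub>R qt + (dl * h) *\<^sub>R qx) = h *\<^sub>R \<psi> qt + (dl * h) *\<^sub>R \<psi> qx"
        using bounded_linear.linear[OF bl] by (simp add: linear_add linear_scale)
      then show ?thesis by (simp add: qtx scaleR_conv_of_real)
    qed
    ultimately have "(g has_derivative (\<lambda>h. 0)) (at s)" by simp
    then show ?thesis by (rule has_derivative_at_withinI)
  qed
  have const: "g r = g 0" if "r \<in> {0..T}" for r
    by (rule has_derivative_zero_unique_strong_interval[of "{0, T}" 0 T g, OF _ cg])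
       (use that dg in \<open>auto\<close>)
  have "g T = g 0" "g t = g 0" using t by (intro const; simp)+
  then have "g T = g t" by (rule trans[OF _ sym])
  moreover have "q T z = \<phi> z" for z using sol by (simp add: adjoint_solution_def)
  ultimately show ?thesis
    by (simp add: g_def y_def \<psi>_def algebra_simps)
qed

section \<open>The observation as a superposition of waves\<close>

text \<open>A pair that satisfies the Kalman condition, together with the data of \<open>spectral_form\<close>.\<close>

locale spectral_system =
  fixes A :: "real^'n^'n" and B :: "real^'m^'n" and K :: nat
    and P :: "real^'n^'n" and d :: "'n \<Rightarrow> real" and R :: "real^'m^'n"
  assumes kalman: "kalman_index A B K"
    and eigen: "\<And>i l. (\<Sum>j\<in>UNIV. A $ i $ j * P $ j $ l) = d l * P $ i $ l"
    and pow: "\<And>k i q. pow_mult A k B $ i $ q = (\<Sum>l\<in>UNIV. P $ i $ l * (d l ^ k * R $ l $ q))"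
begin

abbreviation speeds :: "real set" where "speeds \<equiv> range d"

text \<open>The component with index \<open>q\<close> of \<open>B\<^sup>T E v\<close>, where \<open>E\<close> is the spectral projection of
the transpose of \<open>A\<close> for the eigenvalue \<open>\<nu>\<close>.\<close>

definition wave :: "real \<Rightarrow> 'm \<Rightarrow> complex^'n \<Rightarrow> complex" where
  "wave \<nu> q v = (\<Sum>l | d l = \<nu>. complex_of_real (R $ l $ q) * (\<Sum>i\<in>UNIV. complex_of_real (P $ i $ l) * v $ i))"

lemma obs_eq_wave: "obs A B k v $ q = (\<Sum>\<nu>\<in>speeds. complex_of_real (\<nu> ^ k) * wave \<nu> q v)"
proof -
  let ?\<psi> = "\<lambda>l. \<Sum>i\<in>UNIV. complex_of_real (P $ i $ l) * v $ i"
  have "obs A B k v $ q = (\<Sum>i\<in>UNIV. \<Sum>l\<in>UNIV. complex_of_real (P $ i $ l * (d l ^ k * R $ l $ q)) * v $ i)"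
    by (simp add: obs_def matrix_vector_mult_def transpose_def pow sum_distrib_right)
  also have "\<dots> = (\<Sum>l\<in>UNIV. complex_of_real (d l ^ k * R $ l $ q) * ?\<psi> l)"
    by (subst sum.swap) (simp add: sum_distrib_left ac_simps)
  also have "\<dots> = (\<Sum>\<nu>\<in>speeds. \<Sum>l | l \<in> UNIV \<and> d l = \<nu>. complex_of_real (d l ^ k * R $ l $ q) * ?\<psi> l)"
    by (rule sum.image_gen) simp
  also have "\<dots> = (\<Sum>\<nu>\<in>speeds. complex_of_real (\<nu> ^ k) * wave \<nu> q v)"
    unfolding wave_def sum_distrib_left by (intro sum.cong) auto
  finally show ?thesis .
qed

lemma bounded_linear_wave: "bounded_linear (wave \<nu> q)"
  unfolding wave_def
  by (intro bounded_linear_sum bounded_linear_const_mult bounded_linear_vec_nth)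

text \<open>By the Kalman condition \<open>v\<close> is determined by the vectors \<open>(A\<^sup>r B)\<^sup>T v\<close>, and these are linear combinations of the waves.\<close>

lemma vector_bound_by_waves:
  "\<exists>C>0. \<forall>v. (norm v)\<^sup>2 \<le> C * (\<Sum>q\<in>UNIV. \<Sum>\<nu>\<in>speeds. (cmod (wave \<nu> q v))\<^sup>2)"
proof -
  obtain c where c: "c > 0" "\<And>v. c * (norm v)\<^sup>2 \<le> (\<Sum>r\<le>K. (norm (obs A B r v))\<^sup>2)"
    using obs_full_rank[OF kalman] by blast
  define Z where "Z r = (\<Sum>\<nu>\<in>speeds. (\<bar>\<nu>\<bar> ^ r)\<^sup>2)" for r :: nat
  have Z: "Z r \<ge> 0" for r by (simp add: Z_def sum_nonneg)
  have "(norm v)\<^sup>2 \<le> ((\<Sum>r\<le>K. Z r) / c + 1) * (\<Sum>q\<in>UNIV. \<Sum>\<nu>\<in>speeds. (cmod (wave \<nu> q v))\<^sup>2)" (is "_ \<le> _ * ?W") for v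
  proof -
    have W: "?W \<ge> 0" by (intro sum_nonneg) auto
    have "(norm (obs A B r v))\<^sup>2 \<le> Z r * ?W" for r
    proof -
      have "(cmod (obs A B r v $ q))\<^sup>2 \<le> Z r * (\<Sum>\<nu>\<in>speeds. (cmod (wave \<nu> q v))\<^sup>2)" for q
      proof -
        have "cmod (obs A B r v $ q) \<le> (\<Sum>\<nu>\<in>speeds. \<bar>\<nu>\<bar> ^ r * cmod (wave \<nu> q v))"
          unfolding obs_eq_wave by (rule sum_norm_le) (simp add: norm_mult norm_power power_abs)
        then have "(cmod (obs A B r v $ q))\<^sup>2 \<le> (\<Sum>\<nu>\<in>speeds. \<bar>\<nu>\<bar> ^ r * cmod (wave \<nu> q v))\<^sup>2"
          by (intro power_mono) auto
        also have "\<dots> \<le> Z r * (\<Sum>\<nu>\<in>speeds. (cmod (wave \<nu> q v))\<^sup>2)"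
          unfolding Z_def by (rule Cauchy_Schwarz_ineq_sum)
        finally show ?thesis .
      qed
      then show ?thesis
        unfolding norm_sq_vec[of "obs A B r v"] sum_distrib_left by (intro sum_mono) (auto simp: sum_distrib_left)
    qed
    then have "c * (norm v)\<^sup>2 \<le> (\<Sum>r\<le>K. Z r) * ?W"
      unfolding sum_distrib_right by (intro order_trans[OF c(2)] sum_mono)
    then have "(norm v)\<^sup>2 \<le> (\<Sum>r\<le>K. Z r) / c * ?W" using c(1) by (simp add: field_simps)
    then show ?thesis using W by (simp add: distrib_right)
  qed
  moreover have "(\<Sum>r\<le>K. Z r) / c + 1 > 0" using Z c(1) by (simp add: sum_nonneg add_nonneg_pos)
  ultimately show ?thesis by blast
qed

text \<open>The observation is a sum of exponentials \<open>exp (\<i> \<nu> s \<xi>)\<close>, whose Taylor remainders supply the hypothesis of the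
finite-dimensional estimate.\<close>

lemma low_frequency_bound_by_waves:
  assumes \<tau>: "\<tau> > 0"
  shows "\<exists>\<epsilon>>0. \<epsilon> \<le> 1 \<and> (\<exists>C>0. \<forall>\<xi> v. \<bar>\<xi>\<bar> \<le> \<epsilon> \<longrightarrow>
    (\<Sum>k\<le>K. \<bar>\<xi>\<bar> ^ (2 * k) * (norm (kalman_projector A B k v))\<^sup>2) \<le>
      C * integral {0..\<tau>} (\<lambda>s. \<Sum>q\<in>UNIV. (cmod (\<Sum>\<nu>\<in>speeds. exp (\<i> * of_real (\<nu> * s * \<xi>)) * wave \<nu> q v))\<^sup>2))"
proof -
  have "\<exists>w. \<forall>v. cmod (wave \<nu> q v) \<le> norm v * w \<and> w \<ge> 0" for \<nu> q
    using bounded_linear.nonneg_bounded[OF bounded_linear_wave] by blast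
  then obtain w where w: "\<And>\<nu> q v. cmod (wave \<nu> q v) \<le> norm v * w \<nu> q" "\<And>\<nu> q. w \<nu> q \<ge> 0"
    by metis
  define Q where "Q = (\<Sum>q\<in>UNIV. \<Sum>\<nu>\<in>speeds. (\<bar>\<nu>\<bar> * \<tau>) ^ Suc K * w \<nu> q)"
  have Q: "Q \<ge> 0" unfolding Q_def using w(2) \<tau> by (intro sum_nonneg mult_nonneg_nonneg) auto
  obtain \<epsilon> C where \<epsilon>: "\<epsilon> > 0" "\<epsilon> \<le> 1" "C > 0" and main: "\<forall>\<xi> v F. \<bar>\<xi>\<bar> \<le> \<epsilon> \<longrightarrow> continuous_on {0..\<tau>} F \<longrightarrow>
    (\<forall>s\<in>{0..\<tau>}. norm (F s - (\<Sum>r\<le>K. ((\<i> * of_real (\<xi> * s)) ^ r / fact r) *s obs A B r v)) \<le> Q * \<bar>\<xi>\<bar> ^ Suc K * norm v) \<longrightarrow>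
    (\<Sum>k\<le>K. \<bar>\<xi>\<bar> ^ (2 * k) * (norm (kalman_projector A B k v))\<^sup>2) \<le> C * integral {0..\<tau>} (\<lambda>s. (norm (F s))\<^sup>2)"
    using low_frequency_vector_observability[OF kalman \<tau> Q] by (elim exE conjE) (rule that, assumption+)
  have "(\<Sum>k\<le>K. \<bar>\<xi>\<bar> ^ (2 * k) * (norm (kalman_projector A B k v))\<^sup>2) \<le>
      C * integral {0..\<tau>} (\<lambda>s. \<Sum>q\<in>UNIV. (cmod (\<Sum>\<nu>\<in>speeds. exp (\<i> * of_real (\<nu> * s * \<xi>)) * wave \<nu> q v))\<^sup>2)"
    if \<xi>: "\<bar>\<xi>\<bar> \<le> \<epsilon>" for \<xi> v
  proof -
    define F :: "real \<Rightarrow> complex^'m" where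
      "F s = (\<chi> q. \<Sum>\<nu>\<in>speeds. exp (\<i> * of_real (\<nu> * s * \<xi>)) * wave \<nu> q v)" for s
    have "continuous_on {0..\<tau>} F"
      unfolding F_def by (intro continuous_on_vec_lambda continuous_intros)
    moreover have "norm (F s - (\<Sum>r\<le>K. ((\<i> * of_real (\<xi> * s)) ^ r / fact r) *s obs A B r v)) \<le> Q * \<bar>\<xi>\<bar> ^ Suc K * norm v"
      if s: "s \<in> {0..\<tau>}" for s
    proof -
      let ?D = "F s - (\<Sum>r\<le>K. ((\<i> * of_real (\<xi> * s)) ^ r / fact r) *s obs A B r v)"
      have comp: "cmod (?D $ q) \<le> (\<Sum>\<nu>\<in>speeds. (\<bar>\<nu>\<bar> * \<tau>) ^ Suc K * w \<nu> q) * (\<bar>\<xi>\<bar> ^ Suc K * norm v)" for q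
      proof -
        have "(\<Sum>r\<le>K. ((\<i> * of_real (\<xi> * s)) ^ r / fact r) *s obs A B r v) $ q
          = (\<Sum>r\<le>K. \<Sum>\<nu>\<in>speeds. ((\<i> * of_real (\<nu> * s * \<xi>)) ^ r / fact r) * wave \<nu> q v)"
          unfolding sum_component vector_smult_component obs_eq_wave sum_distrib_left
          by (intro sum.cong refl) (simp add: power_mult_distrib)
        also have "\<dots> = (\<Sum>\<nu>\<in>speeds. (\<Sum>r\<le>K. (\<i> * of_real (\<nu> * s * \<xi>)) ^ r / fact r) * wave \<nu> q v)"
          by (subst sum.swap) (simp add: sum_distrib_right)
        finally have "?D $ q = (\<Sum>\<nu>\<in>speeds. (exp (\<i> * of_real (\<nu> * s * \<xi>)) - (\<Sum>r\<le>K. (\<i> * of_real (\<nu> * s * \<xi>)) ^ r / fact r)) * wave \<nu> q v)"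
          by (simp add: F_def sum_subtractf left_diff_distrib)
        also have "cmod \<dots> \<le> (\<Sum>\<nu>\<in>speeds. ((\<bar>\<nu>\<bar> * \<tau>) ^ Suc K * w \<nu> q) * (\<bar>\<xi>\<bar> ^ Suc K * norm v))"
        proof (rule sum_norm_le)
          fix \<nu>
          have "cmod (exp (\<i> * of_real (\<nu> * s * \<xi>)) - (\<Sum>r\<le>K. (\<i> * of_real (\<nu> * s * \<xi>)) ^ r / fact r)) \<le> \<bar>\<nu> * s * \<xi>\<bar> ^ Suc K / fact (Suc K)"
            by (rule iexp_approx1)
          also have "\<dots> \<le> \<bar>\<nu> * s * \<xi>\<bar> ^ Suc K / 1"
            by (intro divide_left_mono) (auto simp: fact_ge_1 simp del: fact_Suc)
          also have "\<dots> = (\<bar>\<nu>\<bar> * s * \<bar>\<xi>\<bar>) ^ Suc K" using s by (simp add: abs_mult)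
          also have "\<dots> \<le> (\<bar>\<nu>\<bar> * \<tau> * \<bar>\<xi>\<bar>) ^ Suc K"
            using s by (intro power_mono mult_right_mono mult_left_mono) auto
          finally have "cmod (exp (\<i> * of_real (\<nu> * s * \<xi>)) - (\<Sum>r\<le>K. (\<i> * of_real (\<nu> * s * \<xi>)) ^ r / fact r)) * cmod (wave \<nu> q v)
             \<le> (\<bar>\<nu>\<bar> * \<tau> * \<bar>\<xi>\<bar>) ^ Suc K * (norm v * w \<nu> q)"
            using w \<tau> by (intro mult_mono) auto
          then show "cmod ((exp (\<i> * of_real (\<nu> * s * \<xi>)) - (\<Sum>r\<le>K. (\<i> * of_real (\<nu> * s * \<xi>)) ^ r / fact r)) * wave \<nu> q v)
             \<le> ((\<bar>\<nu>\<bar> * \<tau>) ^ Suc K * w \<nu> q) * (\<bar>\<xi>\<bar> ^ Suc K * norm v)"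
            unfolding norm_mult by (simp only: power_mult_distrib ac_simps)
        qed
        finally show ?thesis by (simp only: sum_distrib_right)
      qed
      have "norm ?D \<le> (\<Sum>q\<in>UNIV. cmod (?D $ q))"
        unfolding norm_vec_def by (rule L2_set_le_sum) simp
      also have "\<dots> \<le> (\<Sum>q\<in>UNIV. (\<Sum>\<nu>\<in>speeds. (\<bar>\<nu>\<bar> * \<tau>) ^ Suc K * w \<nu> q) * (\<bar>\<xi>\<bar> ^ Suc K * norm v))"
        by (intro sum_mono comp)
      also have "\<dots> = Q * \<bar>\<xi>\<bar> ^ Suc K * norm v"
        unfolding Q_def by (simp only: sum_distrib_right mult.assoc)
      finally show ?thesis .
    qed
    ultimately have "(\<Sum>k\<le>K. \<bar>\<xi>\<bar> ^ (2 * k) * (norm (kalman_projector A B k v))\<^sup>2) \<le> C * integral {0..\<tau>} (\<lambda>s. (norm (F s))\<^sup>2)"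
      by (intro main[rule_format, OF \<xi>])
    then show ?thesis by (simp add: norm_sq_vec F_def)
  qed
  then show ?thesis
    using \<epsilon> by (intro exI[of _ \<epsilon>] exI[of _ C] conjI allI impI)
qed

lemma tame_wave: "schwartz \<phi> \<Longrightarrow> tame (\<lambda>x. wave \<nu> q (\<phi> x))"
  unfolding wave_def by (intro tame_sum tame_cmult schwartz_component_tame) auto

lemma FT_wave: 
  assumes "schwartz \<phi>" shows "FT (\<lambda>x. wave \<nu> q (\<phi> x)) \<xi> = wave \<nu> q (fourier \<phi> \<xi>)"
proof -
  note t = tame_sum tame_cmult schwartz_component_tame[OF assms]
  have "FT (\<lambda>x. wave \<nu> q (\<phi> x)) \<xi> = (\<Sum>l | d l = \<nu>. complex_of_real (R $ l $ q) *
     FT (\<lambda>x. \<Sum>i\<in>UNIV. complex_of_real (P $ i $ l) * \<phi> x $ i) \<xi>)"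
    unfolding wave_def by (subst FT_sum) (auto intro!: t simp: FT_cmult)
  moreover have "FT (\<lambda>x. \<Sum>i\<in>UNIV. complex_of_real (P $ i $ l) * \<phi> x $ i) \<xi> = (\<Sum>i\<in>UNIV. complex_of_real (P $ i $ l) * fourier \<phi> \<xi> $ i)" for l
    by (subst FT_sum) (auto intro!: t simp: FT_cmult fourier_component[OF assms])
  ultimately show ?thesis unfolding wave_def by (simp only:)
qed

lemma observation_eq_waves:
  assumes sol: "adjoint_solution A T \<phi> u" and t: "t \<in> {0<..<T}"
  shows "(complex_mat (transpose B) *v u t x) $ q = (\<Sum>\<nu>\<in>speeds. wave \<nu> q (\<phi> (x + \<nu> * (T - t))))"
proof -
  have "complex_mat (transpose B) *v u t x = obs A B 0 (u t x)"
    by (simp add: obs_def pow_mult_def)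
  then have "(complex_mat (transpose B) *v u t x) $ q = (\<Sum>\<nu>\<in>speeds. wave \<nu> q (u t x))"
    by (simp add: obs_eq_wave)
  also have "\<dots> = (\<Sum>\<nu>\<in>speeds. wave \<nu> q (\<phi> (x + \<nu> * (T - t))))"
    unfolding wave_def
    by (intro sum.cong refl) (simp add: eigencomponent_along_characteristic[OF sol eigen t])
  finally show ?thesis .
qed

end

section \<open>From the estimates to the observability inequality\<close>

lemma kalman_projector_measurable [measurable]:
  fixes A :: "real^'n^'n"
  shows "kalman_projector A B k \<in> borel_measurable borel"
proof -
  have "linear (kalman_projector A B k)"
  proof (rule linearI, rule kalman_projector_add)
    fix c :: real and v :: "complex^'n"
    have a: "re_vec (c *\<^sub>R x) = c *\<^sub>R re_vec x" "im_vec (c *\<^sub>R x) = c *\<^sub>R im_vec x" for x :: "complex^'n"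
      by (simp_all add: re_vec_def im_vec_def vec_eq_iff)
    show "kalman_projector A B k (c *\<^sub>R v) = c *\<^sub>R kalman_projector A B k v"
      by (rule re_im_eqI) (simp_all add: a re_im_projector linear_scale[OF linear_orth_projector[OF subspace_kalman_layer]])
  qed
  then show ?thesis
    by (intro borel_measurable_continuous_onI linear_continuous_on) (simp add: linear_conv_bounded_linear)
qed

lemma fourier_measurable:
  assumes "schwartz \<phi>" shows "fourier \<phi> \<in> borel_measurable borel"
proof -
  have "continuous_on UNIV (\<lambda>\<xi>. \<chi> i. FT (\<lambda>x. \<phi> x $ i) \<xi>)"
    using schwartz_component_tame[OF assms]
    by (intro continuous_on_vec_lambda FT_continuous) (simp add: tame_def)
  moreover have "fourier \<phi> = (\<lambda>\<xi>. \<chi> i. FT (\<lambda>x. \<phi> x $ i) \<xi>)"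
    by (simp add: fun_eq_iff vec_eq_iff fourier_component[OF assms])
  ultimately show ?thesis by (simp add: borel_measurable_continuous_onI)
qed

lemma weight_measurable [measurable]: "weight k \<in> borel_measurable borel"
  unfolding weight_def[abs_def] by measurable

lemma weight_nonneg: "0 \<le> weight k \<xi>"
  by (simp add: weight_def)

text \<open>Together with \<open>sq_integral_triangle\<close>, this passes the estimate for Schwartz data to the limit.\<close>

lemma Ynorm_sq_triangle:
  assumes [measurable]: "f \<in> borel_measurable borel" "g \<in> borel_measurable borel"
  shows "Ynorm_sq A B K g \<le> 2 * Ynorm_sq A B K f + 2 * Ynorm_sq A B K (\<lambda>\<xi>. f \<xi> - g \<xi>)"
proof -
  let ?P = "kalman_projector A B"
  have "(\<integral>\<^sup>+\<xi>. ennreal (weight k \<xi> * (norm (?P k (g \<xi>)))\<^sup>2) \<partial>lborel) \<le>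
     2 * (\<integral>\<^sup>+\<xi>. ennreal (weight k \<xi> * (norm (?P k (f \<xi>)))\<^sup>2) \<partial>lborel) +
     2 * (\<integral>\<^sup>+\<xi>. ennreal (weight k \<xi> * (norm (?P k (f \<xi> - g \<xi>)))\<^sup>2) \<partial>lborel)" for k
  proof -
    have "(\<integral>\<^sup>+\<xi>. ennreal (weight k \<xi> * (norm (?P k (g \<xi>)))\<^sup>2) \<partial>lborel) \<le>
      (\<integral>\<^sup>+\<xi>. 2 * ennreal (weight k \<xi> * (norm (?P k (f \<xi>)))\<^sup>2) + 2 * ennreal (weight k \<xi> * (norm (?P k (f \<xi> - g \<xi>)))\<^sup>2) \<partial>lborel)"
    proof (rule nn_integral_mono)
      fix \<xi>
      have "?P k (g \<xi>) = ?P k (f \<xi>) - ?P k (f \<xi> - g \<xi>)"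
        using kalman_projector_add[of A B k "f \<xi> - g \<xi>" "g \<xi>"] by simp
      then have "(norm (?P k (g \<xi>)))\<^sup>2 \<le> 2 * (norm (?P k (f \<xi>)))\<^sup>2 + 2 * (norm (?P k (f \<xi> - g \<xi>)))\<^sup>2"
        by (simp only: norm_diff_square_le)
      then have "weight k \<xi> * (norm (?P k (g \<xi>)))\<^sup>2 \<le> weight k \<xi> * (2 * (norm (?P k (f \<xi>)))\<^sup>2 + 2 * (norm (?P k (f \<xi> - g \<xi>)))\<^sup>2)"
        by (rule mult_left_mono[OF _ weight_nonneg])
      then have "ennreal (weight k \<xi> * (norm (?P k (g \<xi>)))\<^sup>2) \<le>
        ennreal (2 * (weight k \<xi> * (norm (?P k (f \<xi>)))\<^sup>2) + 2 * (weight k \<xi> * (norm (?P k (f \<xi> - g \<xi>)))\<^sup>2))"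
        by (intro ennreal_leI) (simp add: algebra_simps)
      also have "\<dots> = 2 * ennreal (weight k \<xi> * (norm (?P k (f \<xi>)))\<^sup>2) + 2 * ennreal (weight k \<xi> * (norm (?P k (f \<xi> - g \<xi>)))\<^sup>2)"
        using weight_nonneg[of k \<xi>] by (simp add: ennreal_mult)
      finally show "ennreal (weight k \<xi> * (norm (?P k (g \<xi>)))\<^sup>2) \<le> \<dots>" .
    qed
    also have "\<dots> = 2 * (\<integral>\<^sup>+\<xi>. ennreal (weight k \<xi> * (norm (?P k (f \<xi>)))\<^sup>2) \<partial>lborel) +
     2 * (\<integral>\<^sup>+\<xi>. ennreal (weight k \<xi> * (norm (?P k (f \<xi> - g \<xi>)))\<^sup>2) \<partial>lborel)"
      by (subst nn_integral_add) (auto simp: nn_integral_cmult)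
    finally show ?thesis .
  qed
  then have "Ynorm_sq A B K g \<le> (\<Sum>k\<le>K. 2 * (\<integral>\<^sup>+\<xi>. ennreal (weight k \<xi> * (norm (?P k (f \<xi>)))\<^sup>2) \<partial>lborel) +
     2 * (\<integral>\<^sup>+\<xi>. ennreal (weight k \<xi> * (norm (?P k (f \<xi> - g \<xi>)))\<^sup>2) \<partial>lborel))"
    unfolding Ynorm_sq_def by (rule sum_mono)
  then show ?thesis unfolding Ynorm_sq_def by (simp only: sum.distrib sum_distrib_left)
qed

lemma sq_integral_triangle:
  assumes [measurable]: "(\<lambda>(t, x). u t x) \<in> borel_measurable borel" "(\<lambda>(t, x). z t x) \<in> borel_measurable borel"
    and [measurable]: "S \<in> sets borel"
  shows "sq_integral T S u \<le> 2 * sq_integral T S z + 2 * sq_integral T UNIV (\<lambda>t x. u t x - z t x)"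
proof -
  have [measurable]: "(\<lambda>(t, x). u t x) \<in> borel_measurable (borel \<Otimes>\<^sub>M borel)"
    "(\<lambda>(t, x). z t x) \<in> borel_measurable (borel \<Otimes>\<^sub>M borel)"
    using assms(1,2) by (simp_all add: borel_prod)
  have "sq_integral T S u \<le> (\<integral>\<^sup>+t. \<integral>\<^sup>+x. 2 * (ennreal ((norm (z t x))\<^sup>2) * indicator S x * indicator {0<..<T} t)
      + 2 * (ennreal ((norm (u t x - z t x))\<^sup>2) * indicator UNIV x * indicator {0<..<T} t) \<partial>lborel \<partial>lborel)"
    unfolding sq_integral_def
    apply (subst nn_integral_multc[symmetric])
     apply measurable
  proof (intro nn_integral_mono)
    fix t x
    have "ennreal ((norm (u t x))\<^sup>2) \<le> ennreal (2 * (norm (z t x))\<^sup>2 + 2 * (norm (u t x - z t x))\<^sup>2)"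
      using norm_diff_square_le[of "z t x" "z t x - u t x"]
      unfolding norm_minus_commute[of "z t x" "u t x"] by (intro ennreal_leI) simp
    also have "\<dots> = 2 * ennreal ((norm (z t x))\<^sup>2) + 2 * ennreal ((norm (u t x - z t x))\<^sup>2)"
      by (simp add: ennreal_mult)
    finally show "ennreal ((norm (u t x))\<^sup>2) * indicator S x * indicator {0<..<T} t \<le>
      2 * (ennreal ((norm (z t x))\<^sup>2) * indicator S x * indicator {0<..<T} t)
      + 2 * (ennreal ((norm (u t x - z t x))\<^sup>2) * indicator UNIV x * indicator {0<..<T} t)"
      by (auto simp: indicator_def)
  qed
  also have "\<dots> = 2 * sq_integral T S z + 2 * sq_integral T UNIV (\<lambda>t x. u t x - z t x)"
    unfolding sq_integral_def by (simp add: nn_integral_add nn_integral_cmult nn_integral_multc)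
  finally show ?thesis .
qed

lemma sq_integral_cong:
  "(\<And>t x. t \<in> {0<..<T} \<Longrightarrow> u t x = v t x) \<Longrightarrow> sq_integral T X u = sq_integral T X v"
  unfolding sq_integral_def by (intro nn_integral_cong) (auto simp: indicator_def)

text \<open>Splits the norm into components and reverses time.\<close>

lemma sq_integral_eq_energy:
  fixes w :: "'m::finite \<Rightarrow> real \<Rightarrow> real \<Rightarrow> complex"
  assumes w: "\<And>q. (\<lambda>(s, x). w q s x) \<in> borel_measurable (borel \<Otimes>\<^sub>M borel)"
    and [measurable]: "S \<in> sets borel"
  shows "sq_integral T S (\<lambda>t x. \<chi> q. w q (T - t) x) = (\<Sum>q\<in>UNIV. energy T S (w q))"
proof -
  note [measurable] = w
  define E where "E q s = (\<integral>\<^sup>+x. indicator {0<..<T} s * indicator S x * ennreal ((cmod (w q s x))\<^sup>2) \<partial>lborel)" for q s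
  have [measurable]: "E q \<in> borel_measurable borel" for q unfolding E_def by measurable
  have "sq_integral T S (\<lambda>t x. \<chi> q. w q (T - t) x) = (\<integral>\<^sup>+t. (\<Sum>q\<in>UNIV. E q (T + -1 * t)) \<partial>lborel)"
    unfolding sq_integral_def
  proof (rule nn_integral_cong)
    fix t
    have e: "ennreal ((norm (\<chi> q. w q (T - t) x))\<^sup>2) = (\<Sum>q\<in>UNIV. ennreal ((cmod (w q (T - t) x))\<^sup>2))" for x
      by (simp add: norm_sq_vec del: sum_ennreal flip: sum_ennreal)
    have "(\<integral>\<^sup>+x\<in>S. ennreal ((norm (\<chi> q. w q (T - t) x))\<^sup>2) \<partial>lborel)
       = (\<Sum>q\<in>UNIV. \<integral>\<^sup>+x. indicator S x * ennreal ((cmod (w q (T - t) x))\<^sup>2) \<partial>lborel)"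
      unfolding e mult.commute[of _ "indicator S _"] unfolding sum_distrib_left
      by (rule nn_integral_sum) measurable
    then show "(\<integral>\<^sup>+x\<in>S. ennreal ((norm (\<chi> q. w q (T - t) x))\<^sup>2) \<partial>lborel) * indicator {0<..<T} t = (\<Sum>q\<in>UNIV. E q (T + -1 * t))"
      by (auto simp: E_def indicator_def)
  qed
  also have "\<dots> = (\<Sum>q\<in>UNIV. \<integral>\<^sup>+t. E q (T + -1 * t) \<partial>lborel)"
    by (rule nn_integral_sum) measurable
  also have "\<dots> = (\<Sum>q\<in>UNIV. energy T S (w q))"
  proof (rule sum.cong[OF refl])
    fix q
    have "energy T S (w q) = (\<integral>\<^sup>+s. E q s \<partial>lborel)" by (simp add: energy_def E_def)
    also have "\<dots> = \<bar>-1::real\<bar> * (\<integral>\<^sup>+t. E q (T + -1 * t) \<partial>lborel)"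
      by (rule nn_integral_real_affine) auto
    finally show "(\<integral>\<^sup>+t. E q (T + -1 * t) \<partial>lborel) = energy T S (w q)" by simp
  qed
  finally show ?thesis .
qed

text \<open>The component \<open>q\<close> of the observation of \<open>v\<close> at frequency \<open>\<xi>\<close> and remaining time \<open>s\<close>.\<close>

abbreviation (in spectral_system) wave_sum :: "real \<Rightarrow> complex^'n \<Rightarrow> 'm \<Rightarrow> real \<Rightarrow> complex" where
  "wave_sum \<xi> v q s \<equiv> \<Sum>\<nu>\<in>speeds. exp (\<i> * of_real (\<nu> * s) * of_real \<xi>) * wave \<nu> q v"

context spectral_system
begin

text \<open>For \<open>\<bar>\<xi>\<bar> < \<epsilon>\<close> the weights are at most \<open>\<bar>\<xi>\<bar>\<^bsup>2 k\<^esup>\<close> and the low-frequency estimate applies;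
otherwise they are at most \<open>1\<close>, and the waves control the whole vector. The threshold may be lowered freely.\<close>

lemma pointwise_bound:
  assumes \<tau>: "\<tau> > 0" 
  shows "\<exists>\<epsilon>1>0. \<forall>\<epsilon>. 0 < \<epsilon> \<longrightarrow> \<epsilon> \<le> \<epsilon>1 \<longrightarrow> (\<exists>C>0. \<forall>\<xi> v.
    (\<Sum>k\<le>K. ennreal (weight k \<xi> * (norm (kalman_projector A B k v))\<^sup>2)) \<le>
      ennreal C * (\<Sum>q\<in>UNIV. \<integral>\<^sup>+s. indicator {0..\<tau>} s * ennreal ((cmod (wave_sum \<xi> v q s))\<^sup>2) \<partial>lborel) +
      ennreal C * (\<Sum>q\<in>UNIV. \<Sum>\<nu>\<in>speeds. indicator {\<xi>. \<epsilon> \<le> \<bar>\<xi>\<bar>} \<xi> * ennreal ((cmod (wave \<nu> q v))\<^sup>2)))"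
proof -
  let ?P = "kalman_projector A B"
  obtain \<epsilon>1 C1 where e1: "\<epsilon>1 > 0" "\<epsilon>1 \<le> 1" "C1 > 0" and low: "\<And>\<xi> v. \<bar>\<xi>\<bar> \<le> \<epsilon>1 \<Longrightarrow>
    (\<Sum>k\<le>K. \<bar>\<xi>\<bar> ^ (2 * k) * (norm (?P k v))\<^sup>2) \<le>
      C1 * integral {0..\<tau>} (\<lambda>s. \<Sum>q\<in>UNIV. (cmod (\<Sum>\<nu>\<in>speeds. exp (\<i> * of_real (\<nu> * s * \<xi>)) * wave \<nu> q v))\<^sup>2)"
    using low_frequency_bound_by_waves[OF \<tau>] by blast
  obtain C2 where C2: "C2 > 0" "\<And>v. (norm v)\<^sup>2 \<le> C2 * (\<Sum>q\<in>UNIV. \<Sum>\<nu>\<in>speeds. (cmod (wave \<nu> q v))\<^sup>2)"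
    using vector_bound_by_waves by blast
  define C where "C = max C1 ((real K + 1) * C2)"
  have C: "C > 0" "C1 \<le> C" "(real K + 1) * C2 \<le> C" using e1 by (auto simp: C_def)
  have main: "(\<Sum>k\<le>K. ennreal (weight k \<xi> * (norm (?P k v))\<^sup>2)) \<le>
      ennreal C * (\<Sum>q\<in>UNIV. \<integral>\<^sup>+s. indicator {0..\<tau>} s * ennreal ((cmod (wave_sum \<xi> v q s))\<^sup>2) \<partial>lborel) +
      ennreal C * (\<Sum>q\<in>UNIV. \<Sum>\<nu>\<in>speeds. indicator {\<xi>. \<epsilon> \<le> \<bar>\<xi>\<bar>} \<xi> * ennreal ((cmod (wave \<nu> q v))\<^sup>2))"
    (is "?L \<le> ennreal C * ?X + ennreal C * ?Y") if \<epsilon>: "0 < \<epsilon>" "\<epsilon> \<le> \<epsilon>1" for \<epsilon> \<xi> v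
  proof -
    have L: "?L = ennreal (\<Sum>k\<le>K. weight k \<xi> * (norm (?P k v))\<^sup>2)"
      by (rule sum_ennreal) (simp add: weight_nonneg)
    show ?thesis
    proof (cases "\<epsilon> \<le> \<bar>\<xi>\<bar>")
      case True
      have "(\<Sum>k\<le>K. weight k \<xi> * (norm (?P k v))\<^sup>2) \<le> (\<Sum>k\<le>K. 1 * (norm v)\<^sup>2)"
        by (intro sum_mono mult_mono power_mono norm_kalman_projector_le) (auto simp: weight_def)
      also have "\<dots> = (real K + 1) * (norm v)\<^sup>2" by simp
      also have "\<dots> \<le> (real K + 1) * (C2 * (\<Sum>q\<in>UNIV. \<Sum>\<nu>\<in>speeds. (cmod (wave \<nu> q v))\<^sup>2))"
        by (intro mult_left_mono C2(2)) simp
      also have "\<dots> \<le> C * (\<Sum>q\<in>UNIV. \<Sum>\<nu>\<in>speeds. (cmod (wave \<nu> q v))\<^sup>2)"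
        unfolding mult.assoc[symmetric] using C(3) by (intro mult_right_mono sum_nonneg) auto
      finally have "?L \<le> ennreal (C * (\<Sum>q\<in>UNIV. \<Sum>\<nu>\<in>speeds. (cmod (wave \<nu> q v))\<^sup>2))"
        unfolding L by (rule ennreal_leI)
      also have "\<dots> = ennreal C * ?Y"
      proof -
        have "?Y = ennreal (\<Sum>q\<in>UNIV. \<Sum>\<nu>\<in>speeds. (cmod (wave \<nu> q v))\<^sup>2)"
          using True by (simp add: sum_nonneg)
        then show ?thesis
          using C(1) by (simp only:) (intro ennreal_mult sum_nonneg, auto)
      qed
      also have "\<dots> \<le> ennreal C * ?X + ennreal C * ?Y" by simp
      finally show ?thesis .
    next
      case False
      define g where "g s = (\<Sum>q\<in>UNIV. (cmod (wave_sum \<xi> v q s))\<^sup>2)" for s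
      have g0: "g s \<ge> 0" for s by (simp add: g_def sum_nonneg)
      have "continuous_on {0..\<tau>} g" unfolding g_def by (intro continuous_intros)
      then have gi: "(g has_integral (integral {0..\<tau>} g)) {0..\<tau>}"
        by (intro integrable_integral integrable_continuous_interval)
      have "(\<Sum>k\<le>K. weight k \<xi> * (norm (?P k v))\<^sup>2) \<le> (\<Sum>k\<le>K. \<bar>\<xi>\<bar> ^ (2 * k) * (norm (?P k v))\<^sup>2)"
        by (intro sum_mono mult_right_mono) (auto simp: weight_def)
      also have "\<dots> \<le> C1 * integral {0..\<tau>} g"
        using low[of \<xi> v] False \<epsilon> by (simp add: g_def[abs_def] mult.assoc)
      also have "\<dots> \<le> C * integral {0..\<tau>} g"
        using C(2) has_integral_nonneg[OF gi] g0 by (intro mult_right_mono) auto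
      finally have "?L \<le> ennreal (C * integral {0..\<tau>} g)"
        unfolding L by (rule ennreal_leI)
      also have "\<dots> = ennreal C * ennreal (integral {0..\<tau>} g)"
        using C(1) has_integral_nonneg[OF gi] g0 by (intro ennreal_mult) auto
      also have "ennreal (integral {0..\<tau>} g) = (\<integral>\<^sup>+s. ennreal (g s) * indicator {0..\<tau>} s \<partial>lborel)"
        using g0 by (intro nn_integral_has_integral_lebesgue'[OF _ gi, symmetric])
      also have "\<dots> = (\<integral>\<^sup>+s. (\<Sum>q\<in>UNIV. indicator {0..\<tau>} s * ennreal ((cmod (wave_sum \<xi> v q s))\<^sup>2)) \<partial>lborel)"
        unfolding g_def by (intro nn_integral_cong) (simp add: sum_ennreal[symmetric] sum_distrib_left mult.commute del: sum_ennreal)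
      also have "\<dots> = ?X"
        by (rule nn_integral_sum) measurable
      also have "ennreal C * ?X \<le> ennreal C * ?X + ennreal C * ?Y" by simp
      finally show ?thesis .
    qed
  qed
  show ?thesis
    by (rule exI[of _ \<epsilon>1], rule conjI[OF e1(1)], intro allI impI, rule exI[of _ C], rule conjI[OF C(1)])
       (intro allI main)
qed

text \<open>Integrate the pointwise bound over \<open>\<xi>\<close>, with \<open>\<tau>\<close> the geometric time. In the first term, exchange the integrals
and apply gap filling to the observation at each fixed \<open>s \<le> \<tau>\<close>; this leaves the observed energy and
high frequencies of the waves. The latter, as well as the second term, are controlled by the high-frequency estimate.\<close>

lemma schwartz_observability:
  assumes "gaps a b G l" and lam: "lam > 0" "\<And>\<nu>. \<nu> \<in> speeds \<Longrightarrow> lam \<le> \<bar>\<nu>\<bar>" and D: "D > 0"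
  shows "\<exists>C>0. \<forall>T \<phi>. G / lam < T \<longrightarrow> T \<le> G / lam + D \<longrightarrow> schwartz \<phi> \<longrightarrow>
    Ynorm_sq A B K (fourier \<phi>) \<le> ennreal (C / (T - G / lam) ^ (2 * card speeds - 1)) *
      (\<Sum>q\<in>UNIV. energy T (shrink a b 0) (\<lambda>s x. \<Sum>\<nu>\<in>speeds. wave \<nu> q (\<phi> (x + \<nu> * s))))"
proof -
  interpret gaps a b G l by fact
  let ?S = "shrink a b 0"
  have G: "G > 0" using gap[of 0] disj[of 0] by linarith
  define \<tau> where "\<tau> = G / lam"
  have \<tau>: "\<tau> > 0" using G lam by (simp add: \<tau>_def)
  define p where "p = card speeds"
  have p: "p \<ge> 1" unfolding p_def using card_gt_0_iff[of speeds] by (simp add: Suc_le_eq)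
  define N where "N = 2 * card speeds - 1"
  obtain \<epsilon>1 where e1: "\<epsilon>1 > 0" and pw: "\<forall>\<epsilon>. 0 < \<epsilon> \<longrightarrow> \<epsilon> \<le> \<epsilon>1 \<longrightarrow> (\<exists>C>0. \<forall>\<xi> v.
    (\<Sum>k\<le>K. ennreal (weight k \<xi> * (norm (kalman_projector A B k v))\<^sup>2)) \<le>
      ennreal C * (\<Sum>q\<in>UNIV. \<integral>\<^sup>+s. indicator {0..\<tau>} s * ennreal ((cmod (wave_sum \<xi> v q s))\<^sup>2) \<partial>lborel) +
      ennreal C * (\<Sum>q\<in>UNIV. \<Sum>\<nu>\<in>speeds. indicator {\<xi>. \<epsilon> \<le> \<bar>\<xi>\<bar>} \<xi> * ennreal ((cmod (wave \<nu> q v))\<^sup>2)))"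
    using pointwise_bound[OF \<tau>] by (elim exE conjE) (rule that, assumption+)
  obtain \<epsilon>0 C3 where e0: "\<epsilon>0 > 0" and C3: "C3 > 0" and fill: "\<forall>g. tame g \<longrightarrow>
    l2_sq (FT g) \<le>
      ennreal C3 * (\<integral>\<^sup>+x. indicator ?S x * ennreal ((cmod (g x))\<^sup>2) \<partial>lborel) +
      ennreal C3 * high_sq \<epsilon>0 (FT g)"
    using gap_filling by (elim exE conjE) (rule that, assumption+)
  define \<epsilon> where "\<epsilon> = min \<epsilon>0 \<epsilon>1"
  have \<epsilon>: "0 < \<epsilon>" "\<epsilon> \<le> \<epsilon>1" "\<epsilon> \<le> \<epsilon>0" using e0 e1 by (auto simp: \<epsilon>_def)
  obtain C1 where C1: "C1 > 0" and pt: "\<forall>\<xi> v.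
    (\<Sum>k\<le>K. ennreal (weight k \<xi> * (norm (kalman_projector A B k v))\<^sup>2)) \<le>
      ennreal C1 * (\<Sum>q\<in>UNIV. \<integral>\<^sup>+s. indicator {0..\<tau>} s * ennreal ((cmod (wave_sum \<xi> v q s))\<^sup>2) \<partial>lborel) +
      ennreal C1 * (\<Sum>q\<in>UNIV. \<Sum>\<nu>\<in>speeds. indicator {\<xi>. \<epsilon> \<le> \<bar>\<xi>\<bar>} \<xi> * ennreal ((cmod (wave \<nu> q v))\<^sup>2))"
    using pw[rule_format, OF \<epsilon>(1,2)] by (elim exE conjE) (rule that, assumption+)
  obtain C4 where C4: "C4 > 0" and high: "\<forall>T f j. G / lam < T \<longrightarrow> T \<le> G / lam + D \<longrightarrow> (\<forall>\<nu>. tame (f \<nu>)) \<longrightarrow> j \<in> speeds \<longrightarrow>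
    high_sq \<epsilon> (FT (f j))
      \<le> ennreal (C4 / (T - G / lam) ^ (2 * card speeds - 1)) *
        energy T ?S (\<lambda>s x. \<Sum>\<nu>\<in>speeds. f \<nu> (x + \<nu> * s))"
    by (rule exE[OF high_frequency_observability[OF finite_imageI[OF finite] lam(1) lam(2) \<epsilon>(1) D]], assumption,
        elim conjE, rule that, assumption+)
  define C5 where "C5 = C1 * (C3 * (real p * \<tau>)) + C1"
  have C5: "C5 \<ge> 0" using C1 C3 \<tau> by (simp add: C5_def)
  define C where "C = C1 * C3 * D ^ N + C5 * (real p * C4)"
  have C: "C > 0" using C1 C3 C4 C5 D by (simp add: C_def add_pos_nonneg)
  have main: "Ynorm_sq A B K (fourier \<phi>) \<le> ennreal (C / (T - G / lam) ^ (2 * card speeds - 1)) *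
      (\<Sum>q\<in>UNIV. energy T ?S (\<lambda>s x. \<Sum>\<nu>\<in>speeds. wave \<nu> q (\<phi> (x + \<nu> * s))))"
    if T: "G / lam < T" "T \<le> G / lam + D" and \<phi>: "schwartz \<phi>" for T \<phi>
  proof -
    define \<delta> where "\<delta> = T - G / lam"
    have \<delta>: "0 < \<delta>" "\<delta> \<le> D" using T by (auto simp: \<delta>_def)
    have \<tau>T: "\<tau> < T" using T by (simp add: \<tau>_def)
    define f where "f q \<nu> x = wave \<nu> q (\<phi> x)" for q \<nu> x
    have f: "tame (f q \<nu>)" for q \<nu> unfolding f_def by (rule tame_wave[OF \<phi>])
    have [measurable]: "f q \<nu> \<in> borel_measurable borel" for q \<nu> using tame_measurable[OF f] .
    define F where "F q \<nu> = FT (f q \<nu>)" for q \<nu>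
    have [measurable]: "F q \<nu> \<in> borel_measurable borel" for q \<nu> unfolding F_def using FT_measurable[OF f] .
    have F: "wave \<nu> q (fourier \<phi> \<xi>) = F q \<nu> \<xi>" for q \<nu> \<xi>
      unfolding F_def f_def by (rule FT_wave[OF \<phi>, symmetric])
    define w where "w q s x = (\<Sum>\<nu>\<in>speeds. f q \<nu> (x + \<nu> * s))" for q s x
    have [measurable]: "(\<lambda>(s, x). w q s x) \<in> borel_measurable (borel \<Otimes>\<^sub>M borel)" for q
      unfolding w_def by measurable
    have wt: "tame (w q s)" for q s unfolding w_def by (intro tame_sum tame_shift f) simp
    have Fw: "FT (w q s) \<xi> = (\<Sum>\<nu>\<in>speeds. exp (\<i> * of_real (\<nu> * s) * of_real \<xi>) * F q \<nu> \<xi>)" for q s \<xi>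
      unfolding w_def by (subst FT_sum) (auto intro!: tame_shift f simp: FT_shift F_def simp del: of_real_mult)
    define E where "E q = energy T ?S (w q)" for q
    define H where "H q \<nu> = high_sq \<epsilon> (F q \<nu>)" for q \<nu>
    define X where "X q = (\<integral>\<^sup>+\<xi>. \<integral>\<^sup>+s. indicator {0..\<tau>} s * ennreal ((cmod (\<Sum>\<nu>\<in>speeds. exp (\<i> * of_real (\<nu> * s) * of_real \<xi>) * F q \<nu> \<xi>))\<^sup>2) \<partial>lborel \<partial>lborel)" for q
    have Hle: "(\<Sum>\<nu>\<in>speeds. H q \<nu>) \<le> ennreal (real p * C4 / \<delta> ^ N) * E q" for q
    proof -
      have "(\<Sum>\<nu>\<in>speeds. H q \<nu>) \<le> (\<Sum>\<nu>\<in>speeds. ennreal (C4 / \<delta> ^ N) * E q)"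
        unfolding H_def F_def E_def w_def \<delta>_def N_def
        by (intro sum_mono high[rule_format] T f)
      also have "\<dots> = ennreal (real p) * (ennreal (C4 / \<delta> ^ N) * E q)"
        by (simp add: p_def ennreal_of_nat_eq_real_of_nat)
      also have "\<dots> = ennreal (real p * C4 / \<delta> ^ N) * E q"
        using C4 \<delta> by (intro ennreal_mult_collapse) auto
      finally show ?thesis .
    qed
    have Xle: "X q \<le> ennreal C3 * E q + ennreal (C3 * (real p * \<tau>)) * (\<Sum>\<nu>\<in>speeds. H q \<nu>)" for q
    proof -
      define O' where "O' s = (\<integral>\<^sup>+x. indicator ?S x * ennreal ((cmod (w q s x))\<^sup>2) \<partial>lborel)" for s
      have [measurable]: "O' \<in> borel_measurable borel" unfolding O'_def by measurable
      have hi: "high_sq \<epsilon>0 (FT (w q s)) \<le> ennreal (real p) * (\<Sum>\<nu>\<in>speeds. H q \<nu>)" for s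
      proof -
        have "high_sq \<epsilon>0 (FT (w q s)) \<le>
          (\<integral>\<^sup>+\<xi>. ennreal (real p) * (\<Sum>\<nu>\<in>speeds. indicator {\<xi>. \<epsilon> \<le> \<bar>\<xi>\<bar>} \<xi> * ennreal ((cmod (F q \<nu> \<xi>))\<^sup>2)) \<partial>lborel)"
        proof (rule nn_integral_mono)
          fix \<xi>
          have "cmod (FT (w q s) \<xi>) \<le> (\<Sum>\<nu>\<in>speeds. 1 * cmod (F q \<nu> \<xi>))"
            unfolding Fw by (rule sum_norm_le) (simp add: norm_mult norm_exp_eq_Re)
          then have "(cmod (FT (w q s) \<xi>))\<^sup>2 \<le> (\<Sum>\<nu>\<in>speeds. 1 * cmod (F q \<nu> \<xi>))\<^sup>2"
            by (intro power_mono) auto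
          also have "\<dots> \<le> (\<Sum>\<nu>\<in>speeds. 1\<^sup>2) * (\<Sum>\<nu>\<in>speeds. (cmod (F q \<nu> \<xi>))\<^sup>2)"
            by (rule Cauchy_Schwarz_ineq_sum)
          finally have "(cmod (FT (w q s) \<xi>))\<^sup>2 \<le> real p * (\<Sum>\<nu>\<in>speeds. (cmod (F q \<nu> \<xi>))\<^sup>2)"
            by (simp add: p_def)
          then have "ennreal ((cmod (FT (w q s) \<xi>))\<^sup>2) \<le> ennreal (real p * (\<Sum>\<nu>\<in>speeds. (cmod (F q \<nu> \<xi>))\<^sup>2))"
            by (rule ennreal_leI)
          also have "\<dots> = ennreal (real p) * (\<Sum>\<nu>\<in>speeds. ennreal ((cmod (F q \<nu> \<xi>))\<^sup>2))"
            by (subst ennreal_mult) (auto simp: sum_nonneg)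
          finally show "indicator {\<xi>. \<epsilon>0 \<le> \<bar>\<xi>\<bar>} \<xi> * ennreal ((cmod (FT (w q s) \<xi>))\<^sup>2) \<le>
             ennreal (real p) * (\<Sum>\<nu>\<in>speeds. indicator {\<xi>. \<epsilon> \<le> \<bar>\<xi>\<bar>} \<xi> * ennreal ((cmod (F q \<nu> \<xi>))\<^sup>2))"
            using \<epsilon>(3) by (cases "\<epsilon>0 \<le> \<bar>\<xi>\<bar>") auto
        qed
        also have "\<dots> = ennreal (real p) * (\<integral>\<^sup>+\<xi>. (\<Sum>\<nu>\<in>speeds. indicator {\<xi>. \<epsilon> \<le> \<bar>\<xi>\<bar>} \<xi> * ennreal ((cmod (F q \<nu> \<xi>))\<^sup>2)) \<partial>lborel)"
          by (rule nn_integral_cmult) measurable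
        also have "(\<integral>\<^sup>+\<xi>. (\<Sum>\<nu>\<in>speeds. indicator {\<xi>. \<epsilon> \<le> \<bar>\<xi>\<bar>} \<xi> * ennreal ((cmod (F q \<nu> \<xi>))\<^sup>2)) \<partial>lborel) = (\<Sum>\<nu>\<in>speeds. H q \<nu>)"
          unfolding H_def by (rule nn_integral_sum) measurable
        finally show ?thesis .
      qed
      have "X q = (\<integral>\<^sup>+s. indicator {0..\<tau>} s * l2_sq (FT (w q s)) \<partial>lborel)"
        unfolding X_def Fw
        by (subst lborel_pair.Fubini'[symmetric], measurable) (simp add: nn_integral_cmult)
      also have "\<dots> \<le> (\<integral>\<^sup>+s. ennreal C3 * (indicator {0..\<tau>} s * O' s) +
          indicator {0..\<tau>} s * (ennreal C3 * (ennreal (real p) * (\<Sum>\<nu>\<in>speeds. H q \<nu>))) \<partial>lborel)"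
      proof (rule nn_integral_mono)
        fix s
        have "l2_sq (FT (w q s)) \<le>
           ennreal C3 * O' s + ennreal C3 * (ennreal (real p) * (\<Sum>\<nu>\<in>speeds. H q \<nu>))"
          unfolding O'_def using fill[rule_format, OF wt[of q s]] mult_left_mono[OF hi[of s], of "ennreal C3"]
          by (meson add_left_mono order_trans zero_le)
        then show "indicator {0..\<tau>} s * l2_sq (FT (w q s)) \<le>
          ennreal C3 * (indicator {0..\<tau>} s * O' s) + indicator {0..\<tau>} s * (ennreal C3 * (ennreal (real p) * (\<Sum>\<nu>\<in>speeds. H q \<nu>)))"
          by (auto simp: indicator_def)
      qed
      also have "\<dots> = ennreal C3 * (\<integral>\<^sup>+s. indicator {0..\<tau>} s * O' s \<partial>lborel) +
          ennreal \<tau> * (ennreal C3 * (ennreal (real p) * (\<Sum>\<nu>\<in>speeds. H q \<nu>)))"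
        using \<tau> by (subst nn_integral_add) (auto simp: nn_integral_cmult nn_integral_multc)
      also have "ennreal \<tau> * (ennreal C3 * (ennreal (real p) * (\<Sum>\<nu>\<in>speeds. H q \<nu>))) = ennreal (C3 * (real p * \<tau>)) * (\<Sum>\<nu>\<in>speeds. H q \<nu>)"
      proof -
        have "ennreal C3 * (ennreal (real p) * (\<Sum>\<nu>\<in>speeds. H q \<nu>)) = ennreal (C3 * real p) * (\<Sum>\<nu>\<in>speeds. H q \<nu>)"
          using C3 by (intro ennreal_mult_collapse) auto
        then show ?thesis using C3 \<tau> by (simp only:) (intro ennreal_mult_collapse, auto)
      qed
      also have "(\<integral>\<^sup>+s. indicator {0..\<tau>} s * O' s \<partial>lborel) \<le> E q"
      proof -
        have "(\<integral>\<^sup>+s. indicator {0..\<tau>} s * O' s \<partial>lborel) \<le> (\<integral>\<^sup>+s. indicator {0<..<T} s * O' s \<partial>lborel)"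
          by (rule nn_integral_mono_AE, rule AE_mp[OF AE_lborel_singleton[of 0]])
             (use \<tau>T in \<open>auto simp: indicator_def\<close>)
        also have "\<dots> = E q"
          unfolding E_def energy_def O'_def by (simp add: nn_integral_cmult[symmetric] mult.assoc)
        finally show ?thesis .
      qed
      finally show ?thesis by (simp add: mult_left_mono add_mono)
    qed
    have each: "ennreal C1 * X q + ennreal C1 * (\<Sum>\<nu>\<in>speeds. H q \<nu>) \<le> ennreal (C / \<delta> ^ N) * E q" for q
    proof -
      let ?H = "\<Sum>\<nu>\<in>speeds. H q \<nu>"
      have "ennreal C1 * X q + ennreal C1 * ?H \<le> ennreal C1 * (ennreal C3 * E q + ennreal (C3 * (real p * \<tau>)) * ?H) + ennreal C1 * ?H"
        by (intro add_right_mono mult_left_mono Xle) simp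
      also have "\<dots> = ennreal (C1 * C3) * E q + ennreal C5 * ?H"
      proof -
        have "ennreal C1 * (ennreal C3 * E q) = ennreal (C1 * C3) * E q"
          "ennreal C1 * (ennreal (C3 * (real p * \<tau>)) * ?H) = ennreal (C1 * (C3 * (real p * \<tau>))) * ?H"
          using C1 C3 \<tau> by (intro ennreal_mult_collapse; simp)+
        moreover have "ennreal C5 = ennreal (C1 * (C3 * (real p * \<tau>))) + ennreal C1"
          unfolding C5_def using C1 C3 \<tau> by (intro ennreal_plus) auto
        ultimately show ?thesis by (simp only: distrib_left distrib_right add.assoc)
      qed
      also have "\<dots> \<le> ennreal (C1 * C3) * E q + ennreal C5 * (ennreal (real p * C4 / \<delta> ^ N) * E q)"
        by (intro add_left_mono mult_left_mono Hle) simp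
      also have "\<dots> = ennreal (C1 * C3 + C5 * (real p * C4 / \<delta> ^ N)) * E q"
      proof -
        have "ennreal C5 * (ennreal (real p * C4 / \<delta> ^ N) * E q) = ennreal (C5 * (real p * C4 / \<delta> ^ N)) * E q"
          using C4 C5 \<delta> by (intro ennreal_mult_collapse) auto
        moreover have "ennreal (C1 * C3 + C5 * (real p * C4 / \<delta> ^ N)) = ennreal (C1 * C3) + ennreal (C5 * (real p * C4 / \<delta> ^ N))"
          using C1 C3 C4 C5 \<delta> by (intro ennreal_plus) auto
        ultimately show ?thesis by (simp only: distrib_right)
      qed
      also have "\<dots> \<le> ennreal (C / \<delta> ^ N) * E q"
      proof (intro mult_right_mono ennreal_leI)
        \<comment> \<open>the contribution of the observed energy itself is bounded, hence at most a multiple of \<open>\<delta>\<^bsup>-N\<^esup>\<close> as \<open>\<delta> \<le> D\<close>\<close>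
        have "1 \<le> D ^ N / \<delta> ^ N" using \<delta> by (simp add: power_mono)
        then have "C1 * C3 * 1 \<le> C1 * C3 * (D ^ N / \<delta> ^ N)" using C1 C3 by (intro mult_left_mono) auto
        then show "C1 * C3 + C5 * (real p * C4 / \<delta> ^ N) \<le> C / \<delta> ^ N"
          by (simp add: C_def add_divide_distrib)
      qed simp
      finally show ?thesis .
    qed
    have [measurable]: "fourier \<phi> \<in> borel_measurable borel" by (rule fourier_measurable[OF \<phi>])
    have "Ynorm_sq A B K (fourier \<phi>) = (\<integral>\<^sup>+\<xi>. (\<Sum>k\<le>K. ennreal (weight k \<xi> * (norm (kalman_projector A B k (fourier \<phi> \<xi>)))\<^sup>2)) \<partial>lborel)"
      unfolding Ynorm_sq_def by (rule nn_integral_sum[symmetric]) measurable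
    also have "\<dots> \<le> (\<integral>\<^sup>+\<xi>. ennreal C1 * (\<Sum>q\<in>UNIV. \<integral>\<^sup>+s. indicator {0..\<tau>} s * ennreal ((cmod (\<Sum>\<nu>\<in>speeds. exp (\<i> * of_real (\<nu> * s) * of_real \<xi>) * F q \<nu> \<xi>))\<^sup>2) \<partial>lborel) +
      ennreal C1 * (\<Sum>q\<in>UNIV. \<Sum>\<nu>\<in>speeds. indicator {\<xi>. \<epsilon> \<le> \<bar>\<xi>\<bar>} \<xi> * ennreal ((cmod (F q \<nu> \<xi>))\<^sup>2)) \<partial>lborel)"
      by (rule nn_integral_mono, unfold F[symmetric], rule pt[rule_format])
    also have "\<dots> = ennreal C1 * (\<Sum>q\<in>UNIV. X q) + ennreal C1 * (\<Sum>q\<in>UNIV. \<Sum>\<nu>\<in>speeds. H q \<nu>)"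
    proof -
      let ?x = "\<lambda>q \<xi>. \<integral>\<^sup>+s. indicator {0..\<tau>} s * ennreal ((cmod (\<Sum>\<nu>\<in>speeds. exp (\<i> * of_real (\<nu> * s) * of_real \<xi>) * F q \<nu> \<xi>))\<^sup>2) \<partial>lborel"
      let ?h = "\<lambda>q \<nu> \<xi>. indicator {\<xi>. \<epsilon> \<le> \<bar>\<xi>\<bar>} \<xi> * ennreal ((cmod (F q \<nu> \<xi>))\<^sup>2)"
      have x: "(\<lambda>\<xi>. ?x q \<xi>) \<in> borel_measurable lborel" and h: "(\<lambda>\<xi>. ?h q \<nu> \<xi>) \<in> borel_measurable lborel" for q \<nu>
        by measurable
      have "(\<integral>\<^sup>+\<xi>. (\<Sum>q\<in>UNIV. ?x q \<xi>) \<partial>lborel) = (\<Sum>q\<in>UNIV. X q)"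
        unfolding X_def by (rule nn_integral_sum[OF x])
      moreover have "(\<integral>\<^sup>+\<xi>. (\<Sum>q\<in>UNIV. \<Sum>\<nu>\<in>speeds. ?h q \<nu> \<xi>) \<partial>lborel) = (\<Sum>q\<in>UNIV. \<Sum>\<nu>\<in>speeds. H q \<nu>)"
        unfolding H_def by (simp only: nn_integral_sum[OF h] nn_integral_sum[OF borel_measurable_sum[OF h]])
      ultimately show ?thesis
        by (subst nn_integral_add, (intro borel_measurable_times_ennreal borel_measurable_sum x h borel_measurable_const)+)
           (simp only: nn_integral_cmult borel_measurable_sum x h)
    qed
    also have "\<dots> = (\<Sum>q\<in>UNIV. ennreal C1 * X q + ennreal C1 * (\<Sum>\<nu>\<in>speeds. H q \<nu>))"
      by (simp only: sum_distrib_left sum.distrib)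
    also have "\<dots> \<le> (\<Sum>q\<in>UNIV. ennreal (C / \<delta> ^ N) * E q)" by (intro sum_mono each)
    also have "\<dots> = ennreal (C / \<delta> ^ N) * (\<Sum>q\<in>UNIV. E q)" by (rule sum_distrib_left[symmetric])
    finally show ?thesis unfolding E_def w_def f_def \<delta>_def N_def .
  qed
  show ?thesis
    by (rule exI[of _ C], rule conjI[OF C]) (intro allI impI main)
qed

end

theorem theorem2p2:
  fixes A :: "real^'n^'n" and B :: "real^'m^'n" and K :: nat
    and S :: "real set" and a b :: "int \<Rightarrow> real"
  assumes "CARD('m) \<le> CARD('n)"
    and "diagonalizable_over_reals A"
    and "kalman_index A B K"
    and "0 \<notin> mat_spectrum A"
    and "bounded_gap S a b"
  shows "\<forall>T1 > geom_time A a b. \<exists>C::real. C > 0 \<and>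
    (\<forall>T \<in> {geom_time A a b <.. T1}. \<forall>qT \<in> Yspace A B K. \<forall>Bq.
       is_observation A B K T qT Bq \<longrightarrow>
       Ynorm_sq A B K qT
         \<le> ennreal (C / (T - geom_time A a b) ^ (2 * card (mat_spectrum A) - 1))
             * sq_integral T S Bq)"
proof (intro allI impI)
  fix T1 assume T1: "T1 > geom_time A a b"
  obtain P :: "real^'n^'n" and d :: "'n \<Rightarrow> real" and R :: "real^'m^'n" where
    eig: "\<And>i l. (\<Sum>j\<in>UNIV. A $ i $ j * P $ j $ l) = d l * P $ i $ l" and
    pow: "\<And>k i q. pow_mult A k B $ i $ q = (\<Sum>l\<in>UNIV. P $ i $ l * (d l ^ k * R $ l $ q))" and
    spec: "mat_spectrum A = complex_of_real ` range d"
    using spectral_form[OF assms(2)] by blast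
  interpret spectral_system A B K P d R
    by unfold_locales (fact assms(3), fact eig, fact pow)
  define l where "l = (INF n. b n - a n)"
  define G where "G = max_gap a b"
  define lam where "lam = min_speed A"
  have bg: "S = shrink a b 0" "\<And>n. a n < b n" "\<And>n. b n < a (n + 1)" "l > 0"
    "bdd_above (range (\<lambda>n. a (n + 1) - b n))"
    using assms(5) by (auto simp: bounded_gap_def shrink_def l_def)
  have "bdd_below (range (\<lambda>n. b n - a n))"
    using bg(2) by (intro bdd_belowI[of _ 0]) (auto intro: less_imp_le)
  then have len: "l \<le> b n - a n" for n
    unfolding l_def by (intro cINF_lower) auto
  have gap: "a (n + 1) - b n \<le> G" for n
    unfolding G_def max_gap_def using bg(5) by (intro cSUP_upper) auto
  have gaps: "gaps a b G l"
    by unfold_locales (use bg len gap in auto)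
  have lam_eq: "lam = Min (abs ` speeds)"
    by (simp add: lam_def min_speed_def spec image_image)
  have lam_le: "lam \<le> \<bar>\<nu>\<bar>" if "\<nu> \<in> speeds" for \<nu>
    unfolding lam_eq using that by (intro Min_le) auto
  have "lam \<in> abs ` speeds" unfolding lam_eq by (intro Min_in) auto
  moreover have "0 \<notin> speeds" using assms(4) unfolding spec by force
  ultimately have lam: "lam > 0" by force
  have card: "card (mat_spectrum A) = card speeds"
    unfolding spec by (rule card_image) (simp add: inj_on_def)
  have geom: "geom_time A a b = G / lam"
    by (simp add: geom_time_def G_def lam_def)
  obtain C0 where C0: "C0 > 0" and main: "\<forall>T \<phi>. G / lam < T \<longrightarrow> T \<le> G / lam + (T1 - G / lam) \<longrightarrow> schwartz \<phi> \<longrightarrow>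
    Ynorm_sq A B K (fourier \<phi>) \<le> ennreal (C0 / (T - G / lam) ^ (2 * card speeds - 1)) *
      (\<Sum>q\<in>UNIV. energy T (shrink a b 0) (\<lambda>s x. \<Sum>\<nu>\<in>speeds. wave \<nu> q (\<phi> (x + \<nu> * s))))"
    by (rule exE[OF schwartz_observability[OF gaps lam lam_le, of "T1 - G / lam"]], assumption)
       (use T1 geom in simp, elim conjE, rule that, assumption+)
  have final: "Ynorm_sq A B K qT \<le> ennreal (4 * C0 / (T - geom_time A a b) ^ (2 * card (mat_spectrum A) - 1)) * sq_integral T S Bq"
    if T: "T \<in> {geom_time A a b <.. T1}" and qT: "qT \<in> Yspace A B K" and obs: "is_observation A B K T qT Bq" for T qT Bq
  proof -
    let ?c = "C0 / (T - geom_time A a b) ^ (2 * card (mat_spectrum A) - 1)"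
    have c: "?c \<ge> 0" using C0 T by simp
    have [measurable]: "qT \<in> borel_measurable borel" using qT by (simp add: Yspace_def)
    have [measurable]: "(\<lambda>(t, x). Bq t x) \<in> borel_measurable borel" using obs by (simp add: is_observation_def)
    have [measurable]: "S \<in> sets borel" unfolding bg(1) by measurable
    obtain \<phi> u where \<phi>: "\<And>n. schwartz (\<phi> n)" and u: "\<And>n. adjoint_solution A T (\<phi> n) (u n)" and
      lim1: "(\<lambda>n. Ynorm_sq A B K (\<lambda>\<xi>. fourier (\<phi> n) \<xi> - qT \<xi>)) \<longlonglongrightarrow> 0" and
      lim2: "(\<lambda>n. sq_integral T UNIV (\<lambda>t x. complex_mat (transpose B) *v u n t x - Bq t x)) \<longlonglongrightarrow> 0"
      using obs unfolding is_observation_def by blast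
    let ?e = "\<lambda>n. Ynorm_sq A B K (\<lambda>\<xi>. fourier (\<phi> n) \<xi> - qT \<xi>)"
    let ?h = "\<lambda>n. sq_integral T UNIV (\<lambda>t x. complex_mat (transpose B) *v u n t x - Bq t x)"
    \<comment> \<open>one factor \<open>2\<close> from each triangle inequality, in the data and in the observation\<close>
    have bound: "Ynorm_sq A B K qT \<le> ennreal (4 * ?c) * sq_integral T S Bq + (ennreal (4 * ?c) * ?h n + 2 * ?e n)" for n
    proof -
      \<comment> \<open>the values of \<open>u n\<close> outside the time interval are arbitrary; the superposition \<open>w\<close> is measurable everywhere and agrees with the observation for \<open>0 < t < T\<close>\<close>
      define w where "w q s x = (\<Sum>\<nu>\<in>speeds. wave \<nu> q (\<phi> n (x + \<nu> * s)))" for q s x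
      have [measurable]: "(\<lambda>x. wave \<nu> q (\<phi> n x)) \<in> borel_measurable borel" for \<nu> q
        using tame_measurable[OF tame_wave[OF \<phi>]] .
      have wm [measurable]: "(\<lambda>(s, x). w q s x) \<in> borel_measurable (borel \<Otimes>\<^sub>M borel)" for q
        unfolding w_def by measurable
      have Wm: "(\<lambda>(t, x). \<chi> q. w q (T - t) x) \<in> borel_measurable borel"
      proof -
        have [continuous_intros]: "continuous_on X (\<lambda>y. wave \<nu> q (\<phi> n (g y)))"
          if "continuous_on X g" for \<nu> q X and g :: "real \<times> real \<Rightarrow> real"
          using continuous_on_compose2[of UNIV "\<lambda>x. wave \<nu> q (\<phi> n x)" X g] tame_wave[OF \<phi>, of \<nu> q n] that
          by (simp add: tame_def)
        show ?thesis
          unfolding w_def split_beta'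
          by (intro borel_measurable_continuous_onI continuous_on_vec_lambda continuous_intros)
      qed
      have uw: "complex_mat (transpose B) *v u n t x = (\<chi> q. w q (T - t) x)" if "t \<in> {0<..<T}" for t x
        using observation_eq_waves[OF u that] by (simp add: vec_eq_iff w_def)
      have "Ynorm_sq A B K (fourier (\<phi> n)) \<le> ennreal ?c * (\<Sum>q\<in>UNIV. energy T S (w q))"
        unfolding geom card bg(1) w_def using T \<phi> geom by (intro main[rule_format]) auto
      also have "(\<Sum>q\<in>UNIV. energy T S (w q)) = sq_integral T S (\<lambda>t x. \<chi> q. w q (T - t) x)"
        by (rule sq_integral_eq_energy[symmetric]) (rule wm, measurable)
      also have "\<dots> \<le> 2 * sq_integral T S Bq + 2 * sq_integral T UNIV (\<lambda>t x. (\<chi> q. w q (T - t) x) - Bq t x)"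
        by (rule sq_integral_triangle[OF Wm]) measurable
      also have "sq_integral T UNIV (\<lambda>t x. (\<chi> q. w q (T - t) x) - Bq t x) = ?h n"
        by (rule sq_integral_cong) (simp add: uw)
      finally have Y: "Ynorm_sq A B K (fourier (\<phi> n)) \<le> ennreal ?c * (2 * sq_integral T S Bq + 2 * ?h n)"
        by (simp add: mult_left_mono)
      have "Ynorm_sq A B K qT \<le> 2 * Ynorm_sq A B K (fourier (\<phi> n)) + 2 * ?e n"
        by (rule Ynorm_sq_triangle[OF fourier_measurable[OF \<phi>]]) measurable
      also have "\<dots> \<le> 2 * (ennreal ?c * (2 * sq_integral T S Bq + 2 * ?h n)) + 2 * ?e n"
        by (intro add_right_mono mult_left_mono Y) simp
      also have "2 * (ennreal ?c * (2 * sq_integral T S Bq + 2 * ?h n)) = ennreal (4 * ?c) * sq_integral T S Bq + ennreal (4 * ?c) * ?h n"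
      proof -
        have "ennreal (4 * x) = 2 * ennreal x * 2" if "x \<ge> 0" for x
          using that by (simp add: ennreal_mult mult.commute mult.left_commute flip: mult_2_right distrib_left)
        from this[OF c] show ?thesis by (simp only: distrib_left mult.assoc)
      qed
      finally show ?thesis by (simp only: add.assoc)
    qed
    have "(\<lambda>n. ennreal (4 * ?c) * sq_integral T S Bq + (ennreal (4 * ?c) * ?h n + 2 * ?e n))
       \<longlonglongrightarrow> ennreal (4 * ?c) * sq_integral T S Bq + (ennreal (4 * ?c) * 0 + 2 * 0)"
      by (intro tendsto_add tendsto_const ennreal_tendsto_cmult lim1 lim2) auto
    then have "Ynorm_sq A B K qT \<le> ennreal (4 * ?c) * sq_integral T S Bq + (ennreal (4 * ?c) * 0 + 2 * 0)"
      by (rule LIMSEQ_le_const) (use bound in blast)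
    then show ?thesis by simp
  qed
  show "\<exists>C::real. C > 0 \<and>
    (\<forall>T \<in> {geom_time A a b <.. T1}. \<forall>qT \<in> Yspace A B K. \<forall>Bq.
       is_observation A B K T qT Bq \<longrightarrow>
       Ynorm_sq A B K qT
         \<le> ennreal (C / (T - geom_time A a b) ^ (2 * card (mat_spectrum A) - 1))
             * sq_integral T S Bq)"
    by (rule exI[of _ "4 * C0"], rule conjI) (use C0 in simp, intro ballI allI impI final)
qed

end
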